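(* Let $V\subset\mathbb{P}^{n-1}$ be an irreducible variety. If $V$ is rational, then the Bombieri–Weyl correspondence $\mathcal B_V$ is rational.
   Context: Let $X=\nu_2(V)\subset\mathbb{P}(\mathrm{Sym}^2(\mathbb{C}^n))$ be the image of $V$ under the second Veronese embedding $\psi\mapsto\psi\psi^T$, let $C(X)\subset\mathrm{Sym}^2(\mathbb{C}^n)$ be the affine cone over $X$, and $C(X)_{\mathrm{reg}}$ its nonsingular locus. The Bombieri–Weyl bilinear form on symmetric matrices is $\langle A,B\rangle_{\mathrm{BW}}=\mathrm{trace}(AB)$, with quadratic form $q_{\mathrm{BW}}(A)=\mathrm{trace}(A^2)$. For $H\in\mathrm{Sym}^2(\mathbb{C}^n)$, a point $Z\in C(X)_{\mathrm{reg}}$ is a critical point of the BW distance problem (minimize $q_{\mathrm{BW}}(H-Z)$ subject to $Z\in C(X)$) if $Z-H$ is orthogonal to the tangent space $T_Z(C(X))$ with respect to $\langle\cdot,\cdot\rangle_{\mathrm{BW}}$. The BW correspondence is the Zariski closure $$\mathcal B_V=\overline{\{(Z,H)\in C(X)_{\mathrm{reg}}\times\mathrm{Sym}^2(\mathbb{C}^n):Z\text{ is a critical point for }H\}}\subset\mathrm{Sym}^2(\mathbb{C}^n)\times\mathrm{Sym}^2(\mathbb{C}^n).$$ A variety is rational if it is birational to an affine (equivalently projective) space. *)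

theory Defs
  imports "HOL-Analysis.Analysis" "HOL-Library.Function_Algebras"
begin

section \<open>Complex vector spaces\<close>

class complex_vector = ab_group_add +
  fixes scaleC :: "complex \<Rightarrow> 'a \<Rightarrow> 'a"  (infixr "*\<^sub>C" 75)
  assumes scaleC_add_right: "a *\<^sub>C (x + y) = a *\<^sub>C x + a *\<^sub>C y"
    and scaleC_add_left: "(a + b) *\<^sub>C x = a *\<^sub>C x + b *\<^sub>C x"
    and scaleC_scaleC: "a *\<^sub>C (b *\<^sub>C x) = (a * b) *\<^sub>C x"
    and scaleC_one: "1 *\<^sub>C x = x"

global_interpretation complex_vector: vector_space "scaleC :: complex \<Rightarrow> 'a \<Rightarrow> 'a::complex_vector"
  by unfold_locales
    (simp_all add: scaleC_add_right scaleC_add_left scaleC_scaleC scaleC_one)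

instantiation complex :: complex_vector
begin
definition scaleC_complex_def: "a *\<^sub>C (x::complex) = a * x"
instance by standard (simp_all add: scaleC_complex_def algebra_simps)
end

instantiation vec :: (complex_vector, finite) complex_vector
begin
definition scaleC_vec_def: "a *\<^sub>C x = (\<chi> i. a *\<^sub>C (x $ i))"
instance
  by standard (simp_all add: scaleC_vec_def vec_eq_iff scaleC_add_right scaleC_add_left
      scaleC_scaleC scaleC_one)
end

instantiation prod :: (complex_vector, complex_vector) complex_vector
begin
definition scaleC_prod_def: "a *\<^sub>C x = (a *\<^sub>C fst x, a *\<^sub>C snd x)"
instance
  by standard (simp_all add: scaleC_prod_def prod_eq_iff scaleC_add_right scaleC_add_left
      scaleC_scaleC scaleC_one)
end

instantiation "fun" :: (type, complex_vector) complex_vector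
begin
definition scaleC_fun_def: "a *\<^sub>C f = (\<lambda>i. a *\<^sub>C f i)"
instance
  by standard (simp_all add: scaleC_fun_def fun_eq_iff scaleC_add_right scaleC_add_left
      scaleC_scaleC scaleC_one)
end

section \<open>Polynomial functions and Zariski topologies\<close>

text \<open>Over the infinite field of complex numbers, polynomials and polynomial functions are the
  same thing.  The polynomial functions on a finite-dimensional space form the algebra
  generated by the constants and the linear functionals.\<close>

inductive_set poly_fun :: "('a::complex_vector \<Rightarrow> complex) set" where
  poly_fun_const: "(\<lambda>_. c) \<in> poly_fun"
| poly_fun_linear: "Vector_Spaces.linear scaleC scaleC l \<Longrightarrow> l \<in> poly_fun"
| poly_fun_add: "f \<in> poly_fun \<Longrightarrow> g \<in> poly_fun \<Longrightarrow> (\<lambda>x. f x + g x) \<in> poly_fun"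
| poly_fun_mult: "f \<in> poly_fun \<Longrightarrow> g \<in> poly_fun \<Longrightarrow> (\<lambda>x. f x * g x) \<in> poly_fun"

definition homogeneous_poly :: "nat \<Rightarrow> ('a::complex_vector \<Rightarrow> complex) \<Rightarrow> bool" where
  "homogeneous_poly d f \<longleftrightarrow> f \<in> poly_fun \<and> (\<forall>c v. f (c *\<^sub>C v) = c ^ d * f v)"

definition zariski :: "'a::complex_vector topology" where
  "zariski = topology (\<lambda>U. \<exists>S \<subseteq> poly_fun. U = {x. \<exists>f\<in>S. f x \<noteq> 0})"

lemma openin_zariski:
  "openin zariski U \<longleftrightarrow> (\<exists>S \<subseteq> poly_fun. U = {x::'a::complex_vector. \<exists>f\<in>S. f x \<noteq> 0})"
proof -
  let ?P = "\<lambda>U. \<exists>S \<subseteq> poly_fun. U = {x::'a. \<exists>f\<in>S. f x \<noteq> 0}"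
  have "?P (U \<inter> V)" if "?P U" "?P V" for U V
  proof -
    from that obtain S T where S: "S \<subseteq> poly_fun" "U = {x. \<exists>f\<in>S. f x \<noteq> 0}"
      and T: "T \<subseteq> poly_fun" "V = {x. \<exists>f\<in>T. f x \<noteq> 0}" by auto
    let ?R = "{\<lambda>x. f x * g x | f g. f \<in> S \<and> g \<in> T}"
    have R: "?R \<subseteq> poly_fun" using S(1) T(1) by (auto intro!: poly_fun_mult)
    have iff: "(\<exists>f\<in>?R. f x \<noteq> 0) \<longleftrightarrow> (\<exists>f\<in>S. f x \<noteq> 0) \<and> (\<exists>g\<in>T. g x \<noteq> 0)" for x
    proof
      assume "\<exists>f\<in>?R. f x \<noteq> 0"
      then show "(\<exists>f\<in>S. f x \<noteq> 0) \<and> (\<exists>g\<in>T. g x \<noteq> 0)" by auto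
    next
      assume "(\<exists>f\<in>S. f x \<noteq> 0) \<and> (\<exists>g\<in>T. g x \<noteq> 0)"
      then obtain f g where fg: "f \<in> S" "g \<in> T" "f x * g x \<noteq> 0" by auto
      then show "\<exists>f\<in>?R. f x \<noteq> 0" by (intro bexI[of _ "\<lambda>x. f x * g x"]) blast+
    qed
    have "U \<inter> V = {x. \<exists>f\<in>?R. f x \<noteq> 0}"
      unfolding S(2) T(2) iff by (rule Collect_conj_eq[symmetric])
    with R show ?thesis by blast
  qed
  moreover have "?P (\<Union>K)" if K: "\<forall>U\<in>K. ?P U" for K
  proof -
    let ?R = "{f \<in> poly_fun. \<forall>x. f x \<noteq> 0 \<longrightarrow> x \<in> \<Union>K}"
    have "\<Union>K = {x. \<exists>f\<in>?R. f x \<noteq> 0}"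
    proof (intro equalityI subsetI)
      fix x assume "x \<in> \<Union>K"
      then obtain U where U: "U \<in> K" "x \<in> U" by blast
      with K obtain S where S: "S \<subseteq> poly_fun" "U = {x. \<exists>f\<in>S. f x \<noteq> 0}" by blast
      from U(2) obtain f where f: "f \<in> S" "f x \<noteq> 0" unfolding S(2) by blast
      have "y \<in> U" if "f y \<noteq> 0" for y unfolding S(2) using f(1) that by blast
      with f S(1) U(1) have "f \<in> ?R" by blast
      with f(2) show "x \<in> {x. \<exists>f\<in>?R. f x \<noteq> 0}" by blast
    qed blast
    moreover have "?R \<subseteq> poly_fun" by blast
    ultimately show ?thesis by blast
  qed
  ultimately have "istopology ?P" unfolding istopology_def by (intro conjI allI impI)
  then show ?thesis unfolding zariski_def by (simp add: topology_inverse')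
qed

text \<open>Points of a projective space are the one-dimensional linear subspaces.\<close>

definition proj_space :: "'a::complex_vector set set" where
  "proj_space = {complex_vector.span {v} | v. v \<noteq> 0}"

definition proj_zariski :: "'a::complex_vector set topology" where
  "proj_zariski = topology (\<lambda>U. \<exists>S. (\<forall>f\<in>S. \<exists>d. homogeneous_poly d f) \<and>
     U = {L \<in> proj_space. \<exists>f\<in>S. \<exists>v\<in>L. f v \<noteq> 0})"

lemma homogeneous_poly_mult:
  "homogeneous_poly d f \<Longrightarrow> homogeneous_poly e g \<Longrightarrow> homogeneous_poly (d + e) (\<lambda>x. f x * g x)"
  by (auto simp: homogeneous_poly_def power_add intro: poly_fun_mult)

lemma homogeneous_poly_nonzero_on_line:
  assumes "homogeneous_poly d f" "L \<in> proj_space" "v \<in> L" "f v \<noteq> 0" "w \<in> L" "w \<noteq> 0"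
  shows "f w \<noteq> 0"
proof -
  obtain u where L: "L = complex_vector.span {u}"
    using assms by (auto simp: proj_space_def)
  from assms L obtain a b where ab: "v = a *\<^sub>C u" "w = b *\<^sub>C u"
    by (auto simp: complex_vector.span_singleton)
  with assms have "b \<noteq> 0" "f u \<noteq> 0"
    by (auto simp: homogeneous_poly_def)
  with assms ab show ?thesis by (auto simp: homogeneous_poly_def)
qed

lemma openin_proj_zariski:
  "openin proj_zariski U \<longleftrightarrow> (\<exists>S. (\<forall>f\<in>S. \<exists>d. homogeneous_poly d f) \<and>
     U = {L::'a::complex_vector set. L \<in> proj_space \<and> (\<exists>f\<in>S. \<exists>v\<in>L. f v \<noteq> 0)})"
proof -
  let ?D = "\<lambda>S. {L::'a set. L \<in> proj_space \<and> (\<exists>f\<in>S. \<exists>v\<in>L. f v \<noteq> 0)}"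
  let ?H = "\<lambda>S. \<forall>f\<in>S. \<exists>d. homogeneous_poly d (f::'a\<Rightarrow>complex)"
  let ?P = "\<lambda>U. \<exists>S. ?H S \<and> U = ?D S"
  have "?P (U \<inter> V)" if "?P U" "?P V" for U V
  proof -
    from that obtain S T where S: "?H S" "U = ?D S" and T: "?H T" "V = ?D T"
      by auto
    let ?R = "{\<lambda>x. f x * g x | f g. f \<in> S \<and> g \<in> T}"
    have "?H ?R" using S(1) T(1) homogeneous_poly_mult by blast
    moreover have "U \<inter> V = ?D ?R"
    proof (intro equalityI subsetI)
      fix L assume "L \<in> U \<inter> V"
      then obtain f g v w where L: "L \<in> proj_space" "f \<in> S" "v \<in> L" "f v \<noteq> 0"
        "g \<in> T" "w \<in> L" "g w \<noteq> 0" unfolding S T by auto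
      from L(1) obtain u where u: "u \<in> L" "u \<noteq> 0"
        by (auto simp: proj_space_def intro: complex_vector.span_base)
      have "f u \<noteq> 0" "g u \<noteq> 0"
        using L u S(1) T(1) homogeneous_poly_nonzero_on_line by blast+
      then have "f u * g u \<noteq> 0" by simp
      moreover have "(\<lambda>x. f x * g x) \<in> ?R" using L by blast
      ultimately have "\<exists>f\<in>?R. \<exists>v\<in>L. f v \<noteq> 0"
        using u(1) by (intro bexI[of _ "\<lambda>x. f x * g x"] bexI[of _ u])
      with L(1) show "L \<in> ?D ?R" by blast
    next
      fix L assume "L \<in> ?D ?R"
      then obtain f g v where "L \<in> proj_space" "f \<in> S" "g \<in> T" "v \<in> L" "f v * g v \<noteq> 0"
        by blast
      then show "L \<in> U \<inter> V" unfolding S(2) T(2) by auto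
    qed
    ultimately show ?thesis by blast
  qed
  moreover have "?P (\<Union>K)" if K: "\<forall>U\<in>K. ?P U" for K
  proof -
    let ?R = "{f. (\<exists>d. homogeneous_poly d f) \<and>
      (\<forall>L\<in>proj_space. (\<exists>v\<in>L. f v \<noteq> 0) \<longrightarrow> L \<in> \<Union>K)}"
    have "\<Union>K = ?D ?R"
    proof (intro equalityI subsetI)
      fix L assume "L \<in> \<Union>K"
      then obtain U where U: "U \<in> K" "L \<in> U" by blast
      with K obtain S where S: "?H S" "U = ?D S" by blast
      from U(2) obtain f v where f: "L \<in> proj_space" "f \<in> S" "v \<in> L" "f v \<noteq> 0"
        unfolding S(2) by blast
      have "M \<in> U" if "M \<in> proj_space" "w \<in> M" "f w \<noteq> 0" for M w
        unfolding S(2) using f(2) that by blast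
      with f(2) S(1) U(1) have "f \<in> ?R" by blast
      with f show "L \<in> ?D ?R" by blast
    qed blast
    moreover have "?H ?R" by blast
    ultimately show ?thesis by blast
  qed
  ultimately have "istopology ?P" unfolding istopology_def by (intro conjI allI impI)
  then show ?thesis unfolding proj_zariski_def by (simp add: topology_inverse')
qed

definition irreducible_in :: "'p topology \<Rightarrow> 'p set \<Rightarrow> bool" where
  "irreducible_in T X \<longleftrightarrow> X \<subseteq> topspace T \<and> X \<noteq> {} \<and>
     (\<forall>C D. closedin T C \<and> closedin T D \<and> X \<subseteq> C \<union> D \<longrightarrow> X \<subseteq> C \<or> X \<subseteq> D)"

section \<open>Regular functions, birational equivalence and rationality\<close>

text \<open>\<open>regular U f\<close> and \<open>proj_regular U f\<close>: \<open>f\<close> is a regular function on the subset \<open>U\<close> (open in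
  some closed set) of an affine or projective space, that is, locally on \<open>U\<close> a quotient of
  polynomials, homogeneous of the same degree in the projective case.\<close>

definition regular :: "'a::complex_vector set \<Rightarrow> ('a \<Rightarrow> complex) \<Rightarrow> bool" where
  "regular U f \<longleftrightarrow> (\<forall>p\<in>U. \<exists>N g h. openin zariski N \<and> p \<in> N \<and> g \<in> poly_fun \<and> h \<in> poly_fun \<and>
     (\<forall>x \<in> N \<inter> U. h x \<noteq> 0 \<and> f x = g x / h x))"

definition proj_regular :: "'a::complex_vector set set \<Rightarrow> ('a set \<Rightarrow> complex) \<Rightarrow> bool" where
  "proj_regular U f \<longleftrightarrow> (\<forall>p\<in>U. \<exists>N d g h. openin proj_zariski N \<and> p \<in> N \<and>
     homogeneous_poly d g \<and> homogeneous_poly d h \<and>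
     (\<forall>L \<in> N \<inter> U. \<forall>v \<in> L - {0}. h v \<noteq> 0 \<and> f L = g v / h v))"

text \<open>Affine and projective varieties are treated uniformly: \<open>T\<close> is the Zariski topology of the
  ambient space and \<open>R\<close> its notion of regular function.  A morphism is a continuous map
  that pulls regular functions back to regular functions.\<close>

definition morphism ::
  "'p topology \<Rightarrow> ('p set \<Rightarrow> ('p \<Rightarrow> complex) \<Rightarrow> bool) \<Rightarrow> 'p set \<Rightarrow>
   'q topology \<Rightarrow> ('q set \<Rightarrow> ('q \<Rightarrow> complex) \<Rightarrow> bool) \<Rightarrow> 'q set \<Rightarrow> ('p \<Rightarrow> 'q) \<Rightarrow> bool" where
  "morphism T R X T' R' Y \<phi> \<longleftrightarrow>
     continuous_map (subtopology T X) (subtopology T' Y) \<phi> \<and>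
     (\<forall>N f. openin (subtopology T' Y) N \<and> R' N f \<longrightarrow> R (X \<inter> \<phi> -` N) (f \<circ> \<phi>))"

definition birational ::
  "'p topology \<Rightarrow> ('p set \<Rightarrow> ('p \<Rightarrow> complex) \<Rightarrow> bool) \<Rightarrow> 'p set \<Rightarrow>
   'q topology \<Rightarrow> ('q set \<Rightarrow> ('q \<Rightarrow> complex) \<Rightarrow> bool) \<Rightarrow> 'q set \<Rightarrow> bool" where
  "birational T R X T' R' Y \<longleftrightarrow>
     (\<exists>U U' \<phi> \<psi>. openin (subtopology T X) U \<and> X \<subseteq> T closure_of U \<and>
        openin (subtopology T' Y) U' \<and> Y \<subseteq> T' closure_of U' \<and>
        morphism T R U T' R' U' \<phi> \<and> morphism T' R' U' T R U \<psi> \<and>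
        (\<forall>x\<in>U. \<psi> (\<phi> x) = x) \<and> (\<forall>y\<in>U'. \<phi> (\<psi> y) = y))"

text \<open>Affine \<open>d\<close>-space, realised inside sequences so that \<open>d\<close> can be quantified over.\<close>

definition affine_space :: "nat \<Rightarrow> (nat \<Rightarrow> complex) set" where
  "affine_space d = {x. \<forall>i\<ge>d. x i = 0}"

definition rational_variety ::
  "'p topology \<Rightarrow> ('p set \<Rightarrow> ('p \<Rightarrow> complex) \<Rightarrow> bool) \<Rightarrow> 'p set \<Rightarrow> bool" where
  "rational_variety T R X \<longleftrightarrow> closedin T X \<and> irreducible_in T X \<and>
     (\<exists>d. birational T R X zariski regular (affine_space d))"

section \<open>Tangent spaces and nonsingular points\<close>

text \<open>The Zariski tangent space: the common kernel of the differentials at \<open>Z\<close> of all polynomials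
  vanishing on \<open>W\<close>.\<close>

definition tangent_space :: "'a::complex_vector set \<Rightarrow> 'a \<Rightarrow> 'a set" where
  "tangent_space W Z =
     {A. \<forall>f\<in>poly_fun. (\<forall>x\<in>W. f x = 0) \<longrightarrow> deriv (\<lambda>t. f (Z + t *\<^sub>C A)) 0 = 0}"

text \<open>The dimension of an irreducible affine variety is the transcendence degree of its coordinate
  ring: the largest number \<open>d\<close> of polynomial functions (the components of \<open>F\<close>) that are
  algebraically independent on \<open>W\<close>.\<close>

definition variety_dim :: "'a::complex_vector set \<Rightarrow> nat" where
  "variety_dim W = Max {d. \<exists>F. (\<forall>x. F x \<in> affine_space d) \<and> (\<forall>i. (\<lambda>x. F x i) \<in> poly_fun) \<and>
     (\<forall>P\<in>poly_fun. (\<forall>x\<in>W. P (F x) = 0) \<longrightarrow> (\<forall>y\<in>affine_space d. P y = 0))}"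

text \<open>Nonsingular locus of an irreducible affine variety.\<close>

definition nonsingular_locus :: "'a::complex_vector set \<Rightarrow> 'a set" where
  "nonsingular_locus W = {Z \<in> W. complex_vector.dim (tangent_space W Z) = variety_dim W}"

section \<open>The Bombieri--Weyl correspondence\<close>

text \<open>\<open>Sym\<^sup>2(\<complex>\<^sup>n)\<close> is the space of symmetric matrices, a linear subspace of the space of all
  matrices.\<close>

definition sym_matrices :: "(complex^'n^'n) set" where
  "sym_matrices = {A. transpose A = A}"

definition outer_square :: "complex^'n \<Rightarrow> complex^'n^'n" where
  "outer_square \<psi> = (\<chi> i j. \<psi> $ i * \<psi> $ j)"

text \<open>The second Veronese embedding sends the line through \<open>\<psi>\<close> to the line through the symmetric
  matrix \<open>\<psi>\<psi>\<^sup>T\<close>.\<close>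

definition veronese2 :: "(complex^'n) set \<Rightarrow> (complex^'n^'n) set" where
  "veronese2 L = complex_vector.span (outer_square ` L)"

definition affine_cone :: "'a::complex_vector set set \<Rightarrow> 'a set" where
  "affine_cone X = insert 0 (\<Union>X)"

definition bw_form :: "complex^'n^'n \<Rightarrow> complex^'n^'n \<Rightarrow> complex" where
  "bw_form A B = trace (A ** B)"

definition bw_critical :: "(complex^'n^'n) set \<Rightarrow> complex^'n^'n \<Rightarrow> complex^'n^'n \<Rightarrow> bool" where
  "bw_critical W H Z \<longleftrightarrow> Z \<in> nonsingular_locus W \<and> (\<forall>A \<in> tangent_space W Z. bw_form (Z - H) A = 0)"

definition bw_correspondence :: "(complex^'n) set set \<Rightarrow> ((complex^'n^'n) \<times> (complex^'n^'n)) set" where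
  "bw_correspondence V =
     zariski closure_of {(Z, H). H \<in> sym_matrices \<and> bw_critical (affine_cone (veronese2 ` V)) H Z}"

end

theory Submission
  imports Defs
begin

text \<open>Let \<open>W\<close> be the affine cone over the Veronese image. A birational map from affine \<open>d\<close>-space to
  \<open>V\<close>, with lines represented by vectors \<open>x(y)\<close> normalized in one coordinate, gives the birational
  parametrization \<open>\<Phi>(y, t) = t x(y) x(y)\<^sup>T\<close> of \<open>W\<close>; its inverse reads \<open>t\<close> and \<open>x\<close> off one row of the matrix.
  Since \<open>\<Phi>\<close> has a rational inverse, \<open>W\<close> has dimension \<open>d + 1\<close>, and at \<open>Z = \<Phi>(p)\<close> the tangent space is the
  image of the differential of \<open>\<Phi>\<close>. So the critical pairs over the image of \<open>\<Phi>\<close> are described by a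
  linear system for \<open>Z - H\<close> with coefficients rational in \<open>p\<close>. Solving it by Gaussian elimination
  parametrizes these pairs rationally, and they are dense among all critical pairs because each
  normal vector at \<open>Z\<^sub>0\<close> is a gradient of an equation of \<open>W\<close> and so extends polynomially to all of \<open>W\<close>.\<close>

section \<open>Linear, polynomial and rational functions\<close>

text \<open>The scalar \<open>t\<close> multiplies the matrix and not the vector:
  \<open>t \<mapsto> (t x)(t x)^T\<close> would be two to one, whereas \<open>t x x^T\<close> is
  injective in \<open>t\<close> and stays in \<open>W\<close> because complex scalars have square
  roots. Normalizing \<open>x\<close> at an index \<open>i0\<close> makes row \<open>i0\<close> of
  \<open>t x x^T\<close> equal to \<open>t x\<close>, so no square root is needed to invert.
  Morphisms are given only by local quotients. All data are therefore shrunk to the nonvanishing set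
  of one polynomial; there every denominator is a power of a fixed polynomial, and an identity on a
  dense set extends to the closure by clearing denominators. The exact dimension of \<open>W\<close>
  matters because nonsingularity compares it with the dimension of the tangent space: the pairs over
  the image of \<open>\<Phi>\<close> count as critical only once these points are known to be
  nonsingular. Conversely, the chart may miss nonsingular points of \<open>W\<close>, which is the
  obstacle to the density of the parametrized pairs.\<close>

abbreviation clinear :: "('a::complex_vector \<Rightarrow> 'b::complex_vector) \<Rightarrow> bool" where
  "clinear \<equiv> Vector_Spaces.linear scaleC scaleC"

interpretation clin: vector_space_pair
  "scaleC :: complex \<Rightarrow> 'a::complex_vector \<Rightarrow> 'a" "scaleC :: complex \<Rightarrow> 'b::complex_vector \<Rightarrow> 'b"
  by unfold_locales

lemma clinearI:
  assumes "\<And>x y. f (x + y) = f x + f y" "\<And>c x. f (c *\<^sub>C x) = c *\<^sub>C f x"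
  shows "clinear f"
  using assms unfolding Vector_Spaces.linear_iff
  by (auto simp: complex_vector.vector_space_axioms)

lemma clinear_functionalI:
  fixes f :: "'a::complex_vector \<Rightarrow> complex"
  assumes "\<And>x y. f (x + y) = f x + f y" "\<And>c x. f (c *\<^sub>C x) = c * f x"
  shows "clinear f"
  using assms by (intro clinearI) (simp_all add: scaleC_complex_def)

lemmas clinear_add = clin.linear_add
lemmas clinear_diff = clin.linear_diff
lemmas clinear_zero = clin.linear_0
lemmas clinear_sum = clin.linear_sum
lemmas clinear_scale = clin.linear_scale

lemma clinear_compose: "clinear f \<Longrightarrow> clinear g \<Longrightarrow> clinear (\<lambda>x. f (g x))"
  by (intro clinearI) (simp_all add: clinear_add clinear_scale)

lemma clinear_functional_scale: "clinear l \<Longrightarrow> l (c *\<^sub>C x) = c * (l x :: complex)"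
  by (simp add: clinear_scale scaleC_complex_def)

text \<open>If \<open>x\<close> and \<open>y\<close> differ, then \<open>{x - y}\<close> is
  independent and some functional has value 1 on it. Equations between vector-valued maps thus
  reduce to scalar ones.\<close>

lemma clinear_functional_separates:
  assumes "\<And>l :: 'a::complex_vector \<Rightarrow> complex. clinear l \<Longrightarrow> l x = l y"
  shows "x = y"
proof (rule ccontr)
  assume "x \<noteq> y"
  then have "complex_vector.independent {x - y}" by simp
  then obtain l :: "'a \<Rightarrow> complex" where "clinear l" "\<forall>v\<in>{x - y}. l v = 1"
    using clin.linear_independent_extend[of "{x - y}" "\<lambda>_. 1"] by metis
  with assms[of l] show False by (simp add: clinear_diff)
qed

lemma poly_fun_sum: "(\<And>i. i \<in> I \<Longrightarrow> f i \<in> poly_fun) \<Longrightarrow> (\<lambda>x. \<Sum>i\<in>I. f i x) \<in> poly_fun"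
  by (induction I rule: infinite_finite_induct) (auto intro: poly_fun_const poly_fun_add)

lemma poly_fun_prod: "(\<And>i. i \<in> I \<Longrightarrow> f i \<in> poly_fun) \<Longrightarrow> (\<lambda>x. \<Prod>i\<in>I. f i x) \<in> poly_fun"
  by (induction I rule: infinite_finite_induct) (auto intro: poly_fun_const poly_fun_mult)

lemma poly_fun_power: "f \<in> poly_fun \<Longrightarrow> (\<lambda>x. f x ^ k) \<in> poly_fun"
  by (induction k) (auto intro: poly_fun_const poly_fun_mult)

lemma poly_fun_cmult: "f \<in> poly_fun \<Longrightarrow> (\<lambda>x. c * f x) \<in> poly_fun"
  by (intro poly_fun_mult poly_fun_const)

lemma poly_fun_diff: "f \<in> poly_fun \<Longrightarrow> g \<in> poly_fun \<Longrightarrow> (\<lambda>x. f x - g x) \<in> poly_fun"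
  using poly_fun_add[OF _ poly_fun_cmult[of g "-1"], of f] by simp

text \<open>The polynomial ring localized at the powers of \<open>h\<close>. Values at zeros of
  \<open>h\<close> are left free, so total division causes no side conditions.\<close>

definition rat_fun :: "('a::complex_vector \<Rightarrow> complex) \<Rightarrow> ('a \<Rightarrow> complex) set" where
  "rat_fun h = {f. \<exists>k. \<exists>g\<in>poly_fun. \<forall>x. h x \<noteq> 0 \<longrightarrow> h x ^ k * f x = g x}"

text \<open>Linear functionals replace coordinates, so that one definition serves matrices, pairs
  and sequences.\<close>

definition rat_map :: "('a::complex_vector \<Rightarrow> complex) \<Rightarrow> ('a \<Rightarrow> 'b::complex_vector) \<Rightarrow> bool" where
  "rat_map h \<Phi> \<longleftrightarrow> (\<forall>l. clinear l \<longrightarrow> (\<lambda>x. l (\<Phi> x)) \<in> rat_fun h)"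

lemma rat_funI:
  "g \<in> poly_fun \<Longrightarrow> (\<And>x. h x \<noteq> 0 \<Longrightarrow> h x ^ k * f x = g x) \<Longrightarrow> f \<in> rat_fun h"
  unfolding rat_fun_def by blast

lemma rat_funE:
  assumes "f \<in> rat_fun h"
  obtains k g where "g \<in> poly_fun" "\<And>x. h x \<noteq> 0 \<Longrightarrow> h x ^ k * f x = g x"
  using assms unfolding rat_fun_def by blast

lemma rat_fun_poly: "f \<in> poly_fun \<Longrightarrow> f \<in> rat_fun h"
  by (rule rat_funI[where k = 0]) auto

lemma rat_fun_const: "(\<lambda>_. c) \<in> rat_fun h"
  by (intro rat_fun_poly poly_fun_const)

text \<open>With denominator 1 the localization is trivial, so the composition lemma for
  \<open>rat_map\<close> also yields polynomiality of composites.\<close>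

lemma rat_fun_one_poly: "f \<in> rat_fun (\<lambda>_. 1) \<Longrightarrow> f \<in> poly_fun"
proof (elim rat_funE)
  fix k g assume g: "g \<in> poly_fun" "\<And>x. (1::complex) \<noteq> 0 \<Longrightarrow> 1 ^ k * f x = g x"
  then have "f = g" by auto
  with g show ?thesis by simp
qed

lemma rat_fun_cong:
  assumes "f \<in> rat_fun h" "\<And>x. h x \<noteq> 0 \<Longrightarrow> f x = f' x"
  shows "f' \<in> rat_fun h"
  using assms unfolding rat_fun_def by fastforce

lemma rat_fun_mult:
  assumes "f \<in> rat_fun h" "f' \<in> rat_fun h"
  shows "(\<lambda>x. f x * f' x) \<in> rat_fun h"
proof -
  obtain k g k' g' where g: "g \<in> poly_fun" "\<And>x. h x \<noteq> 0 \<Longrightarrow> h x ^ k * f x = g x"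
    and g': "g' \<in> poly_fun" "\<And>x. h x \<noteq> 0 \<Longrightarrow> h x ^ k' * f' x = g' x"
    using assms by (metis rat_funE)
  show ?thesis
  proof (rule rat_funI)
    show "(\<lambda>x. g x * g' x) \<in> poly_fun" using g g' by (intro poly_fun_mult)
    show "h x ^ (k + k') * (f x * f' x) = g x * g' x" if "h x \<noteq> 0" for x
      using g(2)[OF that, symmetric] g'(2)[OF that, symmetric] by (simp add: power_add)
  qed
qed

lemma rat_fun_add:
  assumes "h \<in> poly_fun" "f \<in> rat_fun h" "f' \<in> rat_fun h"
  shows "(\<lambda>x. f x + f' x) \<in> rat_fun h"
proof -
  obtain k g k' g' where g: "g \<in> poly_fun" "\<And>x. h x \<noteq> 0 \<Longrightarrow> h x ^ k * f x = g x"
    and g': "g' \<in> poly_fun" "\<And>x. h x \<noteq> 0 \<Longrightarrow> h x ^ k' * f' x = g' x"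
    using assms by (metis rat_funE)
  show ?thesis
  proof (rule rat_funI)
    show "(\<lambda>x. h x ^ k' * g x + h x ^ k * g' x) \<in> poly_fun"
      using g g' assms(1) by (intro poly_fun_add poly_fun_mult poly_fun_power)
    show "h x ^ (k + k') * (f x + f' x) = h x ^ k' * g x + h x ^ k * g' x" if "h x \<noteq> 0" for x
      using g(2)[OF that, symmetric] g'(2)[OF that, symmetric]
      by (simp add: power_add algebra_simps)
  qed
qed

lemma rat_fun_diff:
  assumes "h \<in> poly_fun" "f \<in> rat_fun h" "f' \<in> rat_fun h"
  shows "(\<lambda>x. f x - f' x) \<in> rat_fun h"
  using rat_fun_add[OF assms(1,2) rat_fun_mult[OF rat_fun_const[of "-1"] assms(3)]] by simp

lemma rat_fun_sum:
  "h \<in> poly_fun \<Longrightarrow> (\<And>i. i \<in> I \<Longrightarrow> f i \<in> rat_fun h) \<Longrightarrow> (\<lambda>x. \<Sum>i\<in>I. f i x) \<in> rat_fun h"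
  by (induction I rule: infinite_finite_induct) (auto intro: rat_fun_const rat_fun_add)

lemma rat_fun_power: "f \<in> rat_fun h \<Longrightarrow> (\<lambda>x. f x ^ k) \<in> rat_fun h"
  by (induction k) (auto intro: rat_fun_const rat_fun_mult)

lemma rat_fun_inverse: "(\<lambda>x. inverse (h x)) \<in> rat_fun h"
  by (rule rat_funI[where k = 1 and g = "\<lambda>_. 1"]) (auto intro: poly_fun_const)

lemma rat_fun_mono:
  assumes "f \<in> rat_fun h" "s \<in> poly_fun"
  shows "f \<in> rat_fun (\<lambda>x. h x * s x)"
proof -
  obtain k g where g: "g \<in> poly_fun" "\<And>x. h x \<noteq> 0 \<Longrightarrow> h x ^ k * f x = g x"
    using assms(1) by (metis rat_funE)
  show ?thesis
  proof (rule rat_funI)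
    show "(\<lambda>x. s x ^ k * g x) \<in> poly_fun" using g assms by (intro poly_fun_mult poly_fun_power)
    show "(h x * s x) ^ k * f x = s x ^ k * g x" if "h x * s x \<noteq> 0" for x
      using g(2)[of x] that by (auto simp: power_mult_distrib)
  qed
qed

lemma rat_fun_divide:
  assumes "h \<in> poly_fun" "f \<in> rat_fun h" "s \<in> poly_fun"
  shows "(\<lambda>x. f x / s x) \<in> rat_fun (\<lambda>x. h x * s x)"
proof (rule rat_fun_cong)
  \<comment> \<open>Only the inverse of the whole denominator \<open>h * s\<close> is available; the
    extra \<open>h\<close> cancels.\<close>
  show "(\<lambda>x. f x * (h x * inverse (h x * s x))) \<in> rat_fun (\<lambda>x. h x * s x)"
    using assms by (intro rat_fun_mult rat_fun_inverse rat_fun_mono[OF rat_fun_poly] rat_fun_mono[OF assms(2)])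
qed (auto simp: field_simps)

lemma rat_map_poly_comp:
  assumes "h \<in> poly_fun" "rat_map h \<Psi>" "P \<in> poly_fun"
  shows "(\<lambda>x. P (\<Psi> x)) \<in> rat_fun h"
  using assms(3)
proof induction
  case (poly_fun_linear l)
  with assms(2) show ?case by (simp add: rat_map_def)
qed (use assms(1) in \<open>auto intro: rat_fun_const rat_fun_add rat_fun_mult\<close>)

lemma poly_fun_comp:
  assumes "\<And>l. clinear l \<Longrightarrow> (\<lambda>x. l (\<Psi> x)) \<in> poly_fun" "P \<in> poly_fun"
  shows "(\<lambda>x. P (\<Psi> x)) \<in> poly_fun"
  using assms(2)
  by induction (auto intro: poly_fun.intros assms(1))

lemma poly_fun_comp_linear:
  assumes "clinear L" "P \<in> poly_fun"
  shows "(\<lambda>x. P (L x)) \<in> poly_fun"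
  by (rule poly_fun_comp[OF poly_fun.poly_fun_linear[OF clinear_compose[OF _ assms(1)]] assms(2)])

lemma rat_fun_comp_linear:
  assumes "clinear L" "f \<in> rat_fun h"
  shows "(\<lambda>x. f (L x)) \<in> rat_fun (\<lambda>x. h (L x))"
proof -
  obtain k g where g: "g \<in> poly_fun" "\<And>x. h x \<noteq> 0 \<Longrightarrow> h x ^ k * f x = g x"
    using assms(2) by (metis rat_funE)
  show ?thesis
    by (rule rat_funI[OF poly_fun_comp_linear[OF assms(1) g(1)]]) (rule g(2))
qed

text \<open>Clearing denominators in \<open>q (\<Psi> x)\<close> gives the polynomial
  \<open>s\<close>. Where \<open>h * s\<close> is nonzero,
  \<open>1 / q (\<Psi> x) = h x ^ c / s x\<close>, so inverting \<open>s\<close> besides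
  \<open>h\<close> suffices to substitute \<open>\<Psi>\<close> into functions with denominator
  \<open>q\<close>.\<close>

lemma rat_map_rat_comp:
  assumes "h \<in> poly_fun" "rat_map h \<Psi>" "q \<in> poly_fun"
  obtains s c where "s \<in> poly_fun" "\<And>x. h x \<noteq> 0 \<Longrightarrow> s x = h x ^ c * q (\<Psi> x)"
    "\<And>f. f \<in> rat_fun q \<Longrightarrow> (\<lambda>x. f (\<Psi> x)) \<in> rat_fun (\<lambda>x. h x * s x)"
proof -
  obtain c s where s: "s \<in> poly_fun" "\<And>x. h x \<noteq> 0 \<Longrightarrow> h x ^ c * q (\<Psi> x) = s x"
    using rat_map_poly_comp[OF assms] by (metis rat_funE)
  have "(\<lambda>x. f (\<Psi> x)) \<in> rat_fun (\<lambda>x. h x * s x)" if f: "f \<in> rat_fun q" for f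
  proof -
    obtain k g where g: "g \<in> poly_fun" "\<And>x. q x \<noteq> 0 \<Longrightarrow> q x ^ k * f x = g x"
      using f by (metis rat_funE)
    show ?thesis
    proof (rule rat_fun_cong)
      show "(\<lambda>x. g (\<Psi> x) * (h x ^ c / s x) ^ k) \<in> rat_fun (\<lambda>x. h x * s x)"
        using assms(1) s(1)
        by (intro rat_fun_mult rat_fun_power rat_fun_divide rat_fun_poly poly_fun_power
            rat_fun_mono[OF rat_map_poly_comp[OF assms(1,2) g(1)]])
      fix x assume "h x * s x \<noteq> 0"
      then have q: "q (\<Psi> x) \<noteq> 0" and "s x = h x ^ c * q (\<Psi> x)" "h x \<noteq> 0"
        using s(2)[of x] by auto
      then have r: "h x ^ c / s x = 1 / q (\<Psi> x)" by simp
      with q g(2)[of "\<Psi> x"] show "g (\<Psi> x) * (h x ^ c / s x) ^ k = f (\<Psi> x)"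
        unfolding r by (auto simp: field_simps)
    qed
  qed
  with s show thesis by (intro that[of s c]) auto
qed

section \<open>Restriction of polynomial functions to lines\<close>

lemma poly_fun_on_line:
  assumes "f \<in> poly_fun"
  obtains P :: "complex poly" where "\<And>t. f (x + t *\<^sub>C v) = poly P t"
proof -
  from assms have "\<exists>P. \<forall>t. f (x + t *\<^sub>C v) = poly P t"
  proof induction
    case (poly_fun_const c)
    show ?case by (rule exI[of _ "[:c:]"]) simp
  next
    case (poly_fun_linear l)
    then show ?case
      by (intro exI[of _ "[:l x, l v:]"]) (simp add: clinear_add clinear_functional_scale)
  next
    case (poly_fun_add f g)
    then obtain P Q where "\<forall>t. f (x + t *\<^sub>C v) = poly P t" "\<forall>t. g (x + t *\<^sub>C v) = poly Q t" by blast
    then show ?case by (intro exI[of _ "P + Q"]) simp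
  next
    case (poly_fun_mult f g)
    then obtain P Q where "\<forall>t. f (x + t *\<^sub>C v) = poly P t" "\<forall>t. g (x + t *\<^sub>C v) = poly Q t" by blast
    then show ?case by (intro exI[of _ "P * Q"]) simp
  qed
  with that show thesis by blast
qed

text \<open>Irreducibility of a linear subspace: on the line through \<open>x\<close> and
  \<open>y\<close> both functions become nonzero univariate polynomials, whose product has a
  non-root.\<close>

lemma subspace_poly_fun_mult_nonzero:
  assumes S: "complex_vector.subspace S" and f: "f \<in> poly_fun" "x \<in> S" "f x \<noteq> 0"
    and g: "g \<in> poly_fun" "y \<in> S" "g y \<noteq> 0"
  obtains z where "z \<in> S" "f z \<noteq> 0" "g z \<noteq> 0"
proof -
  obtain P where P: "\<And>t. f (x + t *\<^sub>C (y - x)) = poly P t"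
    using poly_fun_on_line[OF f(1)] by blast
  obtain Q where Q: "\<And>t. g (x + t *\<^sub>C (y - x)) = poly Q t"
    using poly_fun_on_line[OF g(1)] by blast
  have "P \<noteq> 0" using P[of 0] f(3) by auto
  moreover have "Q \<noteq> 0" using Q[of 1] g(3) by (auto simp: scaleC_one)
  ultimately have "P * Q \<noteq> 0" by simp
  then obtain t where "poly (P * Q) t \<noteq> 0" using poly_all_0_iff_0 by blast
  moreover have "x + t *\<^sub>C (y - x) \<in> S"
    using S f(2) g(2)
    by (intro complex_vector.subspace_add complex_vector.subspace_scale complex_vector.subspace_diff)
  ultimately show thesis using that P Q by auto
qed

section \<open>Directional derivatives\<close>

definition dir_deriv :: "('a::complex_vector \<Rightarrow> complex) \<Rightarrow> 'a \<Rightarrow> 'a \<Rightarrow> complex" where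
  "dir_deriv f x v = deriv (\<lambda>t. f (x + t *\<^sub>C v)) 0"

text \<open>A weak derivative at 0, tested on functionals, because a \<open>complex_vector\<close>
  carries no topology.\<close>

definition curve_deriv :: "(complex \<Rightarrow> 'a::complex_vector) \<Rightarrow> 'a \<Rightarrow> bool" where
  "curve_deriv \<gamma> v \<longleftrightarrow> (\<forall>l. clinear l \<longrightarrow> ((\<lambda>t. l (\<gamma> t)) has_field_derivative l v) (at 0))"

lemma curve_deriv_line: "curve_deriv (\<lambda>t. x + t *\<^sub>C v) v"
  unfolding curve_deriv_def
  by (auto simp: clinear_add clinear_functional_scale intro!: derivative_eq_intros)

text \<open>The value \<open>d\<close> is chosen before the curve, so it depends only on the point
  and the velocity; this is the content of the chain rule.\<close>

lemma poly_fun_curve_deriv_ex: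
  assumes "f \<in> poly_fun"
  shows "\<exists>d. \<forall>\<gamma>. \<gamma> 0 = x \<and> curve_deriv \<gamma> v \<longrightarrow> ((\<lambda>t. f (\<gamma> t)) has_field_derivative d) (at 0)"
  using assms
proof induction
  case (poly_fun_linear l)
  then show ?case unfolding curve_deriv_def by blast
next
  case (poly_fun_const c)
  show ?case by (auto intro!: exI[of _ 0] derivative_eq_intros)
next
  case (poly_fun_add f g)
  then obtain d e where
    "\<forall>\<gamma>. \<gamma> 0 = x \<and> curve_deriv \<gamma> v \<longrightarrow> ((\<lambda>t. f (\<gamma> t)) has_field_derivative d) (at 0)"
    "\<forall>\<gamma>. \<gamma> 0 = x \<and> curve_deriv \<gamma> v \<longrightarrow> ((\<lambda>t. g (\<gamma> t)) has_field_derivative e) (at 0)" by blast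
  then show ?case by (intro exI[of _ "d + e"]) (auto intro!: derivative_intros)
next
  case (poly_fun_mult f g)
  then obtain d e where
    "\<forall>\<gamma>. \<gamma> 0 = x \<and> curve_deriv \<gamma> v \<longrightarrow> ((\<lambda>t. f (\<gamma> t)) has_field_derivative d) (at 0)"
    "\<forall>\<gamma>. \<gamma> 0 = x \<and> curve_deriv \<gamma> v \<longrightarrow> ((\<lambda>t. g (\<gamma> t)) has_field_derivative e) (at 0)" by blast
  then show ?case
    by (intro exI[of _ "d * g x + e * f x"]) (auto intro!: DERIV_mult)
qed

lemma rat_fun_curve_deriv_ex:
  assumes "h \<in> poly_fun" "f \<in> rat_fun h" "h x \<noteq> 0"
  shows "\<exists>d. \<forall>\<gamma>. \<gamma> 0 = x \<and> curve_deriv \<gamma> v \<longrightarrow> ((\<lambda>t. f (\<gamma> t)) has_field_derivative d) (at 0)"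
proof -
  obtain k g where g: "g \<in> poly_fun" "\<And>x. h x \<noteq> 0 \<Longrightarrow> h x ^ k * f x = g x"
    using assms(2) by (metis rat_funE)
  obtain d where d: "\<forall>\<gamma>. \<gamma> 0 = x \<and> curve_deriv \<gamma> v \<longrightarrow> ((\<lambda>t. g (\<gamma> t)) has_field_derivative d) (at 0)"
    using poly_fun_curve_deriv_ex[OF g(1)] by blast
  obtain e where e: "\<forall>\<gamma>. \<gamma> 0 = x \<and> curve_deriv \<gamma> v \<longrightarrow> ((\<lambda>t. h (\<gamma> t) ^ k) has_field_derivative e) (at 0)"
    using poly_fun_curve_deriv_ex[OF poly_fun_power[OF assms(1)]] by blast
  obtain e1 where e1: "\<forall>\<gamma>. \<gamma> 0 = x \<and> curve_deriv \<gamma> v \<longrightarrow> ((\<lambda>t. h (\<gamma> t)) has_field_derivative e1) (at 0)"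
    using poly_fun_curve_deriv_ex[OF assms(1)] by blast
  show ?thesis
  proof (intro exI allI impI, elim conjE)
    fix \<gamma> :: "complex \<Rightarrow> 'a" assume \<gamma>: "\<gamma> 0 = x" "curve_deriv \<gamma> v"
    have "isCont (\<lambda>t. h (\<gamma> t)) 0" using e1 \<gamma> DERIV_isCont by blast
    then have "(\<lambda>t. h (\<gamma> t)) \<midarrow>0\<rightarrow> h x" using \<gamma>(1) by (simp add: isCont_def)
    then have "\<forall>\<^sub>F t in at 0. h (\<gamma> t) \<noteq> 0" using assms(3) by (rule tendsto_imp_eventually_ne)
    then have ev: "\<forall>\<^sub>F t in nhds 0. h (\<gamma> t) \<noteq> 0"
      using \<gamma>(1) assms(3) by (simp add: eventually_nhds_conv_at)
    have "((\<lambda>t. g (\<gamma> t) / h (\<gamma> t) ^ k) has_field_derivative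
        (d * h x ^ k - g x * e) / (h x ^ k * h x ^ k)) (at 0)"
      using d e \<gamma> assms(3) DERIV_divide[of "\<lambda>t. g (\<gamma> t)" d 0 UNIV "\<lambda>t. h (\<gamma> t) ^ k" e] by auto
    moreover have "\<forall>\<^sub>F t in nhds 0. g (\<gamma> t) / h (\<gamma> t) ^ k = f (\<gamma> t)"
      using ev by eventually_elim (simp add: g(2)[symmetric])
    ultimately show "((\<lambda>t. f (\<gamma> t)) has_field_derivative
        (d * h x ^ k - g x * e) / (h x ^ k * h x ^ k)) (at 0)"
      by (subst (asm) DERIV_cong_ev[OF refl _ refl]) auto
  qed
qed

text \<open>All curves through the point with velocity \<open>v\<close> share one derivative; the
  straight line identifies it as \<open>dir_deriv\<close>.\<close>

lemma rat_fun_curve_deriv: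
  assumes "h \<in> poly_fun" "f \<in> rat_fun h" "h (\<gamma> 0) \<noteq> 0" "curve_deriv \<gamma> v"
  shows "((\<lambda>t. f (\<gamma> t)) has_field_derivative dir_deriv f (\<gamma> 0) v) (at 0)"
proof -
  let ?l = "\<lambda>t. \<gamma> 0 + t *\<^sub>C v"
  obtain d where d: "\<forall>\<delta>. \<delta> 0 = \<gamma> 0 \<and> curve_deriv \<delta> v \<longrightarrow> ((\<lambda>t. f (\<delta> t)) has_field_derivative d) (at 0)"
    using rat_fun_curve_deriv_ex[OF assms(1-3)] by blast
  have "((\<lambda>t. f (?l t)) has_field_derivative d) (at 0)"
    using d[rule_format, of ?l] curve_deriv_line by auto
  then have "dir_deriv f (\<gamma> 0) v = d" unfolding dir_deriv_def by (rule DERIV_imp_deriv)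
  with d assms(4) show ?thesis by blast
qed

lemma rat_fun_has_deriv:
  assumes "h \<in> poly_fun" "f \<in> rat_fun h" "h x \<noteq> 0"
  shows "((\<lambda>t. f (x + t *\<^sub>C v)) has_field_derivative dir_deriv f x v) (at 0)"
  using rat_fun_curve_deriv[OF assms(1,2) _ curve_deriv_line, of x v] assms(3) by simp

lemma poly_fun_curve_deriv:
  assumes "f \<in> poly_fun" "curve_deriv \<gamma> v"
  shows "((\<lambda>t. f (\<gamma> t)) has_field_derivative dir_deriv f (\<gamma> 0) v) (at 0)"
  by (rule rat_fun_curve_deriv[OF poly_fun_const[of 1] rat_fun_poly[OF assms(1)] _ assms(2)]) simp

lemma poly_fun_has_deriv:
  "f \<in> poly_fun \<Longrightarrow> ((\<lambda>t. f (x + t *\<^sub>C v)) has_field_derivative dir_deriv f x v) (at 0)"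
  using poly_fun_curve_deriv[OF _ curve_deriv_line, of f x v] by simp

lemma dir_deriv_eqI: "((\<lambda>t. f (x + t *\<^sub>C v)) has_field_derivative d) (at 0) \<Longrightarrow> dir_deriv f x v = d"
  unfolding dir_deriv_def by (rule DERIV_imp_deriv)

lemma dir_deriv_linear: "clinear l \<Longrightarrow> dir_deriv l x v = l v"
  using curve_deriv_line[of x v] unfolding curve_deriv_def by (intro dir_deriv_eqI) blast

lemma dir_deriv_const [simp]: "dir_deriv (\<lambda>_. c) x v = 0"
  by (simp add: dir_deriv_def)

lemma dir_deriv_add:
  assumes "f \<in> poly_fun" "g \<in> poly_fun"
  shows "dir_deriv (\<lambda>x. f x + g x) x v = dir_deriv f x v + dir_deriv g x v"
  using assms by (intro dir_deriv_eqI DERIV_add poly_fun_has_deriv)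

lemma dir_deriv_mult:
  assumes "f \<in> poly_fun" "g \<in> poly_fun"
  shows "dir_deriv (\<lambda>x. f x * g x) x v = dir_deriv f x v * g x + dir_deriv g x v * f x"
  using DERIV_mult[OF poly_fun_has_deriv[OF assms(1), of x v] poly_fun_has_deriv[OF assms(2), of x v]]
  by (intro dir_deriv_eqI) simp

lemma poly_fun_dir_deriv:
  assumes "f \<in> poly_fun"
  shows "(\<lambda>x. dir_deriv f x v) \<in> poly_fun"
  using assms
  by induction (auto simp: dir_deriv_linear dir_deriv_add dir_deriv_mult intro: poly_fun.intros)

lemma dir_deriv_poly_linear:
  assumes "f \<in> poly_fun"
  shows "clinear (dir_deriv f x)"
  using assms
proof induction
  case (poly_fun_const c)
  show ?case by (intro clinear_functionalI) simp_all
next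
  case (poly_fun_linear l)
  then have "dir_deriv l x = l" by (auto simp: dir_deriv_linear)
  with poly_fun_linear show ?case by simp
next
  case (poly_fun_add f g)
  then show ?case
    by (intro clinear_functionalI) (simp_all add: dir_deriv_add clinear_add clinear_functional_scale algebra_simps)
next
  case (poly_fun_mult f g)
  then show ?case
    by (intro clinear_functionalI) (simp_all add: dir_deriv_mult clinear_add clinear_functional_scale algebra_simps)
qed

lemma poly_fun_eventually_nonzero:
  assumes "f \<in> poly_fun" "f x \<noteq> 0"
  shows "\<forall>\<^sub>F t in nhds 0. f (x + t *\<^sub>C v) \<noteq> 0"
proof -
  have "isCont (\<lambda>t. f (x + t *\<^sub>C v)) 0" using poly_fun_has_deriv[OF assms(1)] DERIV_isCont by blast
  then have "(\<lambda>t. f (x + t *\<^sub>C v)) \<midarrow>0\<rightarrow> f x" by (simp add: isCont_def)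
  then have "\<forall>\<^sub>F t in at 0. f (x + t *\<^sub>C v) \<noteq> 0" using assms(2) by (rule tendsto_imp_eventually_ne)
  then show ?thesis using assms(2) by (simp add: eventually_nhds_conv_at)
qed

text \<open>The identity \<open>h x ^ k * f x = g x\<close> holds near the point along the line,
  since \<open>h\<close> stays nonzero there; differentiate it by the product rule and solve for the
  derivative of \<open>f\<close>.\<close>

lemma rat_fun_dir_deriv_formula:
  assumes h: "h \<in> poly_fun" and f: "f \<in> rat_fun h" and g: "g \<in> poly_fun"
    and eq: "\<And>x. h x \<noteq> 0 \<Longrightarrow> h x ^ k * f x = g x" and x: "h x \<noteq> 0"
  shows "dir_deriv f x v = (dir_deriv g x v - f x * dir_deriv (\<lambda>x. h x ^ k) x v) * inverse (h x) ^ k"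
proof -
  let ?\<gamma> = "\<lambda>t. x + t *\<^sub>C v"
  have "((\<lambda>t. h (?\<gamma> t) ^ k * f (?\<gamma> t)) has_field_derivative
     dir_deriv (\<lambda>x. h x ^ k) x v * f (?\<gamma> 0) + dir_deriv f x v * h (?\<gamma> 0) ^ k) (at 0)"
    by (intro DERIV_mult poly_fun_has_deriv[OF poly_fun_power[OF h]] rat_fun_has_deriv[OF h f x])
  moreover have "\<forall>\<^sub>F t in nhds 0. h (?\<gamma> t) ^ k * f (?\<gamma> t) = g (?\<gamma> t)"
    using poly_fun_eventually_nonzero[of h x v, OF h x] by eventually_elim (rule eq)
  ultimately have "((\<lambda>t. g (?\<gamma> t)) has_field_derivative
     dir_deriv (\<lambda>x. h x ^ k) x v * f (?\<gamma> 0) + dir_deriv f x v * h (?\<gamma> 0) ^ k) (at 0)"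
    by (subst (asm) DERIV_cong_ev[OF refl _ refl]) auto
  then have "dir_deriv g x v = dir_deriv (\<lambda>x. h x ^ k) x v * f x + dir_deriv f x v * h x ^ k"
    by (intro dir_deriv_eqI) simp
  with x show ?thesis by (simp add: field_simps power_inverse)
qed

lemma rat_fun_dir_deriv:
  assumes h: "h \<in> poly_fun" and f: "f \<in> rat_fun h"
  shows "(\<lambda>x. dir_deriv f x v) \<in> rat_fun h"
proof -
  obtain k g where g: "g \<in> poly_fun" "\<And>x. h x \<noteq> 0 \<Longrightarrow> h x ^ k * f x = g x"
    using f by (metis rat_funE)
  show ?thesis
  proof (rule rat_fun_cong)
    show "(\<lambda>x. (dir_deriv g x v - f x * dir_deriv (\<lambda>x. h x ^ k) x v) * inverse (h x) ^ k) \<in> rat_fun h"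
      using h g(1) f
      by (intro rat_fun_mult rat_fun_diff rat_fun_power rat_fun_inverse rat_fun_poly[OF poly_fun_dir_deriv]
          poly_fun_power)
  qed (rule rat_fun_dir_deriv_formula[OF h f g, symmetric])
qed

lemma dir_deriv_rat_linear:
  assumes h: "h \<in> poly_fun" and f: "f \<in> rat_fun h" and x: "h x \<noteq> 0"
  shows "clinear (dir_deriv f x)"
proof -
  obtain k g where g: "g \<in> poly_fun" "\<And>x. h x \<noteq> 0 \<Longrightarrow> h x ^ k * f x = g x"
    using f by (metis rat_funE)
  note lin = dir_deriv_poly_linear[OF g(1), of x] dir_deriv_poly_linear[OF poly_fun_power[OF h], of k x]
  show ?thesis
    by (intro clinear_functionalI) (simp_all add: rat_fun_dir_deriv_formula[OF h f g x]
        lin[THEN clinear_add] lin[THEN clinear_functional_scale] algebra_simps)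
qed

section \<open>Closures of rationally parametrized sets\<close>

lemma openin_zariski_basic: "f \<in> poly_fun \<Longrightarrow> openin zariski {x. f x \<noteq> 0}"
  unfolding openin_zariski by (intro exI[of _ "{f}"]) auto

lemma openin_zariskiE:
  assumes "openin zariski N" "x \<in> N"
  obtains f where "f \<in> poly_fun" "f x \<noteq> 0" "\<And>y. f y \<noteq> 0 \<Longrightarrow> y \<in> N"
  using assms unfolding openin_zariski by blast

lemma topspace_zariski [simp]: "topspace (zariski :: 'a::complex_vector topology) = UNIV"
proof -
  have "openin zariski {x::'a. (1::complex) \<noteq> 0}"
    by (rule openin_zariski_basic[of "\<lambda>_. 1", OF poly_fun_const])
  then show ?thesis using openin_subset by fastforce
qed

lemma closedin_zariski_basic: "f \<in> poly_fun \<Longrightarrow> closedin zariski {x. f x = 0}"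
  unfolding closedin_def by (simp add: openin_zariski_basic Compl_eq_Diff_UNIV[symmetric] Collect_neg_eq[symmetric])

lemma closedin_zariskiE:
  assumes "closedin zariski C" "x \<notin> C"
  obtains f where "f \<in> poly_fun" "f x \<noteq> 0" "\<And>y. y \<in> C \<Longrightarrow> f y = 0"
proof -
  have "openin zariski (- C)" using assms(1) by (simp add: closedin_def Compl_eq_Diff_UNIV)
  then show thesis using assms(2) that by (metis ComplD ComplI openin_zariskiE)
qed

lemma zariski_closure_iff:
  "x \<in> zariski closure_of S \<longleftrightarrow> (\<forall>f\<in>poly_fun. (\<forall>y\<in>S. f y = 0) \<longrightarrow> f x = 0)"
proof (intro iffI ballI impI)
  fix f assume "x \<in> zariski closure_of S" "f \<in> poly_fun" "\<forall>y\<in>S. f y = 0"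
  moreover have "zariski closure_of S \<subseteq> {x. f x = 0}"
    using calculation by (intro closure_of_minimal closedin_zariski_basic) auto
  ultimately show "f x = 0" by blast
next
  assume *: "\<forall>f\<in>poly_fun. (\<forall>y\<in>S. f y = 0) \<longrightarrow> f x = 0"
  show "x \<in> zariski closure_of S"
  proof (rule ccontr)
    assume "x \<notin> zariski closure_of S"
    then obtain f where "f \<in> poly_fun" "f x \<noteq> 0" "\<And>y. y \<in> zariski closure_of S \<Longrightarrow> f y = 0"
      by (rule closedin_zariskiE[OF closedin_closure_of]) blast
    with * show False using closure_of_subset[of S zariski] by auto
  qed
qed

text \<open>For polynomial \<open>u\<close> some \<open>h x ^ k * u (\<Phi> x)\<close> is
  polynomial, so basic open sets pull back to basic open subsets of \<open>X\<close>; the same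
  clearing turns \<open>a / b\<close> composed with \<open>\<Phi>\<close> into a quotient of
  polynomials.\<close>

lemma rat_map_morphism:
  assumes h: "h \<in> poly_fun" and \<Phi>: "rat_map h \<Phi>" and nz: "\<And>x. x \<in> X \<Longrightarrow> h x \<noteq> 0"
    and img: "\<Phi> ` X \<subseteq> Y"
  shows "morphism zariski regular X zariski regular Y \<Phi>"
proof -
  have pull: "\<exists>u'\<in>poly_fun. \<forall>x\<in>X. u' x \<noteq> 0 \<longleftrightarrow> u (\<Phi> x) \<noteq> 0" if u: "u \<in> poly_fun" for u
  proof -
    obtain k u' where "u' \<in> poly_fun" "\<And>x. h x \<noteq> 0 \<Longrightarrow> h x ^ k * u (\<Phi> x) = u' x"
      using rat_map_poly_comp[OF h \<Phi> u] by (metis rat_funE)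
    with nz show ?thesis by (metis mult_eq_0_iff power_not_zero)
  qed
  have cont: "\<exists>N'. openin zariski N' \<and> p \<in> N' \<and> (\<forall>x\<in>N' \<inter> X. \<Phi> x \<in> N)"
    if N: "openin zariski N" "p \<in> X" "\<Phi> p \<in> N" for N p
  proof -
    obtain u where u: "u \<in> poly_fun" "u (\<Phi> p) \<noteq> 0" "\<And>y. u y \<noteq> 0 \<Longrightarrow> y \<in> N"
      using N by (metis openin_zariskiE)
    obtain u' where u': "u' \<in> poly_fun" "\<forall>x\<in>X. u' x \<noteq> 0 \<longleftrightarrow> u (\<Phi> x) \<noteq> 0"
      using pull[OF u(1)] by blast
    show ?thesis
      using N u u' by (intro exI[of _ "{x. u' x \<noteq> 0}"]) (auto intro: openin_zariski_basic)
  qed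
  have "continuous_map (subtopology zariski X) (subtopology zariski Y) \<Phi>"
    unfolding continuous_map_def
  proof (intro conjI allI impI)
    show "\<Phi> \<in> topspace (subtopology zariski X) \<rightarrow> topspace (subtopology zariski Y)"
      using img by auto
    fix U assume "openin (subtopology zariski Y) U"
    then obtain N where N: "openin zariski N" "U = N \<inter> Y" by (auto simp: openin_subtopology)
    have "openin (subtopology zariski X) {x \<in> X. \<Phi> x \<in> N}"
    proof (subst openin_subopen, intro ballI)
      fix p assume "p \<in> {x \<in> X. \<Phi> x \<in> N}"
      then obtain N' where "openin zariski N'" "p \<in> N'" "\<forall>x\<in>N' \<inter> X. \<Phi> x \<in> N" "p \<in> X"
        using cont[OF N(1)] by blast
      then show "\<exists>T. openin (subtopology zariski X) T \<and> p \<in> T \<and> T \<subseteq> {x \<in> X. \<Phi> x \<in> N}"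
        by (intro exI[of _ "N' \<inter> X"]) (auto simp: openin_subtopology)
    qed
    moreover have "{x \<in> topspace (subtopology zariski X). \<Phi> x \<in> U} = {x \<in> X. \<Phi> x \<in> N}"
      using img N by auto
    ultimately show "openin (subtopology zariski X) {x \<in> topspace (subtopology zariski X). \<Phi> x \<in> U}"
      by simp
  qed
  moreover have "regular (X \<inter> \<Phi> -` N) (f \<circ> \<Phi>)"
    if f: "regular N f" for N f
    unfolding regular_def
  proof
    fix p assume p: "p \<in> X \<inter> \<Phi> -` N"
    then obtain M a b where M: "openin zariski M" "\<Phi> p \<in> M" "a \<in> poly_fun" "b \<in> poly_fun"
      "\<forall>x \<in> M \<inter> N. b x \<noteq> 0 \<and> f x = a x / b x"
      using f unfolding regular_def by blast
    obtain M' where M': "openin zariski M'" "p \<in> M'" "\<forall>x\<in>M' \<inter> X. \<Phi> x \<in> M"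
      using cont M(1,2) p by blast
    obtain k a' where a': "a' \<in> poly_fun" "\<And>x. h x \<noteq> 0 \<Longrightarrow> h x ^ k * a (\<Phi> x) = a' x"
      using rat_map_poly_comp[OF h \<Phi> M(3)] by (metis rat_funE)
    obtain j b' where b': "b' \<in> poly_fun" "\<And>x. h x \<noteq> 0 \<Longrightarrow> h x ^ j * b (\<Phi> x) = b' x"
      using rat_map_poly_comp[OF h \<Phi> M(4)] by (metis rat_funE)
    show "\<exists>N' g h'. openin zariski N' \<and> p \<in> N' \<and> g \<in> poly_fun \<and> h' \<in> poly_fun \<and>
      (\<forall>x\<in>N' \<inter> (X \<inter> \<Phi> -` N). h' x \<noteq> 0 \<and> (f \<circ> \<Phi>) x = g x / h' x)"
    proof (intro exI conjI ballI)
      show "openin zariski M'" "p \<in> M'" by fact+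
      show "(\<lambda>x. h x ^ j * a' x) \<in> poly_fun" "(\<lambda>x. h x ^ k * b' x) \<in> poly_fun"
        using h a' b' by (auto intro: poly_fun_mult poly_fun_power)
      fix x assume x: "x \<in> M' \<inter> (X \<inter> \<Phi> -` N)"
      then have hx: "h x \<noteq> 0" using nz by blast
      have b: "b (\<Phi> x) \<noteq> 0" "f (\<Phi> x) = a (\<Phi> x) / b (\<Phi> x)" using x M' M(5) by auto
      show "h x ^ k * b' x \<noteq> 0" using b hx b'(2)[OF hx, symmetric] by simp
      show "(f \<circ> \<Phi>) x = (h x ^ j * a' x) / (h x ^ k * b' x)"
        using b hx b'(2)[OF hx, symmetric] a'(2)[OF hx, symmetric] by simp
    qed
  qed
  ultimately show ?thesis unfolding morphism_def by blast
qed

lemma morphism_pullback: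
  "morphism T R X T' R' Y \<phi> \<Longrightarrow> openin (subtopology T' Y) N \<Longrightarrow> R' N f \<Longrightarrow> R (X \<inter> \<phi> -` N) (f \<circ> \<phi>)"
  by (simp add: morphism_def)

lemma subspace_affine_space: "complex_vector.subspace (affine_space d)"
  by (auto simp: complex_vector.subspace_def affine_space_def zero_fun_def plus_fun_def
      scaleC_fun_def scaleC_complex_def)

text \<open>Irreducibility is inherited from the affine space. For birationality the image must be
  open in its closure, which follows because the rational left inverse \<open>\<Xi>\<close> remains
  a two-sided inverse on a basic open part of the closure.\<close>

lemma rational_variety_closure_of_param:
  fixes \<Theta> :: "(nat \<Rightarrow> complex) \<Rightarrow> 'b::complex_vector"
  assumes q: "q \<in> poly_fun" and h: "h \<in> poly_fun"
    and \<Theta>: "rat_map q \<Theta>" and \<Xi>: "rat_map h \<Xi>"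
    and A: "A = {p \<in> affine_space e. q p \<noteq> 0}" "A \<noteq> {}"
    and \<Xi>_aff: "\<And>z. \<Xi> z \<in> affine_space e"
    and hnz: "\<And>p. p \<in> A \<Longrightarrow> h (\<Theta> p) \<noteq> 0" and inv: "\<And>p. p \<in> A \<Longrightarrow> \<Xi> (\<Theta> p) = p"
  shows "rational_variety zariski regular (zariski closure_of (\<Theta> ` A))"
proof -
  let ?X = "zariski closure_of (\<Theta> ` A)"
  obtain p0 where p0: "p0 \<in> affine_space e" "q p0 \<noteq> 0" using A by auto
  have dense: "\<exists>p\<in>A. f p \<noteq> 0" if f: "f \<in> poly_fun" "x \<in> affine_space e" "f x \<noteq> 0" for f x
    using subspace_poly_fun_mult_nonzero[OF subspace_affine_space, of f x e q p0] f q p0 A by blast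
  have irr: "irreducible_in zariski ?X"
    unfolding irreducible_in_def
  proof (intro conjI allI impI)
    show "?X \<subseteq> topspace zariski" by simp
    show "?X \<noteq> {}" using A(2) by (simp add: closure_of_eq_empty)
    fix C D assume CD: "closedin zariski C \<and> closedin zariski D \<and> ?X \<subseteq> C \<union> D"
    show "?X \<subseteq> C \<or> ?X \<subseteq> D"
    proof (rule ccontr)
      assume "\<not> (?X \<subseteq> C \<or> ?X \<subseteq> D)"
      then have "\<not> \<Theta> ` A \<subseteq> C" "\<not> \<Theta> ` A \<subseteq> D" using CD closure_of_minimal by blast+
      then obtain p p' where p: "p \<in> A" "\<Theta> p \<notin> C" "p' \<in> A" "\<Theta> p' \<notin> D" by blast
      obtain f where f: "f \<in> poly_fun" "f (\<Theta> p) \<noteq> 0" "\<And>y. y \<in> C \<Longrightarrow> f y = 0"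
        using CD p by (metis closedin_zariskiE)
      obtain g where g: "g \<in> poly_fun" "g (\<Theta> p') \<noteq> 0" "\<And>y. y \<in> D \<Longrightarrow> g y = 0"
        using CD p by (metis closedin_zariskiE)
      obtain j f' where f': "f' \<in> poly_fun" "\<And>x. q x \<noteq> 0 \<Longrightarrow> q x ^ j * f (\<Theta> x) = f' x"
        using rat_map_poly_comp[OF q \<Theta> f(1)] by (metis rat_funE)
      obtain k g' where g': "g' \<in> poly_fun" "\<And>x. q x \<noteq> 0 \<Longrightarrow> q x ^ k * g (\<Theta> x) = g' x"
        using rat_map_poly_comp[OF q \<Theta> g(1)] by (metis rat_funE)
      have "f' p \<noteq> 0" "g' p' \<noteq> 0"
        using p A f(2) g(2) f'(2)[of p, symmetric] g'(2)[of p', symmetric] by auto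
      then obtain z where z: "z \<in> affine_space e" "f' z \<noteq> 0" "g' z \<noteq> 0"
        using subspace_poly_fun_mult_nonzero[OF subspace_affine_space, of f' p e g' p'] f'(1) g'(1) p A by blast
      then obtain w where w: "w \<in> A" "f' w * g' w \<noteq> 0"
        using dense[OF poly_fun_mult[OF f'(1) g'(1)], of z] by auto
      then have "f (\<Theta> w) \<noteq> 0" "g (\<Theta> w) \<noteq> 0"
        using A f'(2)[of w, symmetric] g'(2)[of w, symmetric] by auto
      then have "\<Theta> w \<notin> C \<union> D" using f g by blast
      moreover have "\<Theta> w \<in> ?X" using w closure_of_subset[of "\<Theta> ` A" zariski] by auto
      ultimately show False using CD by blast
    qed
  qed
  obtain s c where s: "s \<in> poly_fun" "\<And>z. h z \<noteq> 0 \<Longrightarrow> s z = h z ^ c * q (\<Xi> z)"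
    and cmp: "\<And>f. f \<in> rat_fun q \<Longrightarrow> (\<lambda>z. f (\<Xi> z)) \<in> rat_fun (\<lambda>z. h z * s z)"
    using rat_map_rat_comp[OF h \<Xi> q] by metis
  let ?H = "\<lambda>z. h z * s z"
  have H: "?H \<in> poly_fun" using h s(1) by (rule poly_fun_mult)
  have HA: "?H (\<Theta> p) \<noteq> 0" if "p \<in> A" for p
    using hnz[OF that] inv[OF that] s(2) that A by auto
  \<comment> \<open>On the image, \<open>\<Theta> (\<Xi> z) = z\<close>. Tested on functionals and
    multiplied by a power of \<open>?H\<close>, this is a family of polynomial equations, which
    persists on the closure.\<close>
  have retract: "\<Xi> z \<in> A \<and> \<Theta> (\<Xi> z) = z" if z: "z \<in> ?X" "?H z \<noteq> 0" for z
  proof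
    show "\<Xi> z \<in> A" using z s(2)[of z] \<Xi>_aff A by auto
    show "\<Theta> (\<Xi> z) = z"
    proof (rule clinear_functional_separates)
      fix l :: "'b \<Rightarrow> complex" assume l: "clinear l"
      have "(\<lambda>z. l (\<Theta> (\<Xi> z)) - l z) \<in> rat_fun ?H"
        using \<Theta> l by (intro rat_fun_diff[OF H] cmp[of "\<lambda>x. l (\<Theta> x)"] rat_fun_poly[OF poly_fun_linear[OF l]])
          (simp add: rat_map_def)
      then obtain k g where g: "g \<in> poly_fun" "\<And>z. ?H z \<noteq> 0 \<Longrightarrow> ?H z ^ k * (l (\<Theta> (\<Xi> z)) - l z) = g z"
        by (metis (no_types, lifting) rat_funE)
      have "\<forall>y\<in>\<Theta> ` A. g y = 0" using g(2)[symmetric, OF HA] inv by auto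
      then have "g z = 0" using z(1) g(1) unfolding zariski_closure_iff by blast
      then show "l (\<Theta> (\<Xi> z)) = l z" using g(2)[OF z(2)] z(2) by auto
    qed
  qed
  have im: "\<Theta> ` A = ?X \<inter> {z. ?H z \<noteq> 0}"
  proof (intro equalityI subsetI)
    fix z assume "z \<in> \<Theta> ` A"
    then show "z \<in> ?X \<inter> {z. ?H z \<noteq> 0}" using HA closure_of_subset[of "\<Theta> ` A" zariski] by auto
  next
    fix z assume "z \<in> ?X \<inter> {z. ?H z \<noteq> 0}"
    then have "\<Xi> z \<in> A \<and> \<Theta> (\<Xi> z) = z" by (intro retract) auto
    then show "z \<in> \<Theta> ` A" by (intro image_eqI[of _ _ "\<Xi> z"]) auto
  qed
  have "openin (subtopology zariski ?X) (\<Theta> ` A)"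
    unfolding openin_subtopology using openin_zariski_basic[OF H] im by blast
  moreover have "openin (subtopology zariski (affine_space e)) A"
    unfolding openin_subtopology A(1) using openin_zariski_basic[OF q] by blast
  moreover have "affine_space e \<subseteq> zariski closure_of A"
    using dense unfolding zariski_closure_iff subset_iff by blast
  moreover have "morphism zariski regular (\<Theta> ` A) zariski regular A \<Xi>"
    by (rule rat_map_morphism[OF h \<Xi>]) (use hnz inv in auto)
  moreover have "morphism zariski regular A zariski regular (\<Theta> ` A) \<Theta>"
    by (rule rat_map_morphism[OF q \<Theta>]) (use A(1) in auto)
  ultimately have "birational zariski regular ?X zariski regular (affine_space e)"
    unfolding birational_def using inv by (intro exI[of _ "\<Theta> ` A"] exI[of _ A] exI[of _ \<Xi>] exI[of _ \<Theta>]) auto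
  with irr show ?thesis unfolding rational_variety_def by auto
qed

section \<open>Linear systems with rational coefficients\<close>

text \<open>Gaussian elimination, one equation at a time. \<open>J\<close> holds the free unknowns,
  \<open>b\<close> expresses all unknowns through them, and \<open>r\<close> accumulates the pivots.
  The clause on \<open>J\<close> says that free unknowns are expressed by themselves, so every
  choice of their values occurs in a solution.\<close>

lemma rational_linear_system:
  fixes S :: "('i::finite \<Rightarrow> 'a::complex_vector \<Rightarrow> complex) set"
  assumes "finite S" "\<forall>a\<in>S. \<forall>i. a i \<in> rat_fun q"
    and q: "q \<in> poly_fun" and A: "complex_vector.subspace A" and q0: "\<exists>p\<in>A. q p \<noteq> 0"
  shows "\<exists>r J b. r \<in> poly_fun \<and> (\<exists>p\<in>A. q p * r p \<noteq> 0) \<and>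
    (\<forall>i j. b i j \<in> rat_fun (\<lambda>x. q x * r x)) \<and>
    (\<forall>p\<in>A. q p * r p \<noteq> 0 \<longrightarrow>
      (\<forall>i\<in>J. \<forall>j\<in>J. b i j p = of_bool (i = j)) \<and>
      (\<forall>\<nu>. (\<forall>a\<in>S. (\<Sum>i\<in>UNIV. a i p * \<nu> i) = 0) \<longleftrightarrow> (\<forall>i. \<nu> i = (\<Sum>j\<in>J. b i j p * \<nu> j))))"
  using assms(1,2)
proof (induction S rule: finite_induct)
  case empty
  show ?case
  proof (intro exI conjI allI ballI impI)
    show "(\<lambda>_. 1) \<in> poly_fun" by (rule poly_fun_const)
    show "\<exists>p\<in>A. q p * 1 \<noteq> 0" using q0 by simp
    show "(\<lambda>_. of_bool (i = j)) \<in> rat_fun (\<lambda>x. q x * 1)" for i j :: 'i by (rule rat_fun_const)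
    show "(\<forall>a\<in>{}. (\<Sum>i\<in>UNIV. a i p * \<nu> i) = 0) \<longleftrightarrow> (\<forall>i. \<nu> i = (\<Sum>j\<in>UNIV. of_bool (i = j) * \<nu> j))"
      for p :: 'a and \<nu> :: "'i \<Rightarrow> complex"
      by (simp add: of_bool_def if_distrib[of "\<lambda>x. x * _"] cong: if_cong)
  qed auto
next
  case (insert a S)
  have "\<forall>a\<in>S. \<forall>i. a i \<in> rat_fun q" using insert.prems by simp
  from insert.IH[OF this] obtain r J b
    where r: "r \<in> poly_fun" "\<exists>p\<in>A. q p * r p \<noteq> 0"
      and b: "\<forall>i j. b i j \<in> rat_fun (\<lambda>x. q x * r x)"
      and IH: "\<forall>p\<in>A. q p * r p \<noteq> 0 \<longrightarrow>
        (\<forall>i\<in>J. \<forall>j\<in>J. b i j p = of_bool (i = j)) \<and>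
        (\<forall>\<nu>. (\<forall>a\<in>S. (\<Sum>i\<in>UNIV. a i p * \<nu> i) = 0) \<longleftrightarrow> (\<forall>i. \<nu> i = (\<Sum>j\<in>J. b i j p * \<nu> j)))"
    by (elim exE conjE) (rule that)
  have \<delta>: "b i j p = of_bool (i = j)" if "p \<in> A" "q p * r p \<noteq> 0" "i \<in> J" "j \<in> J" for p i j
    using IH that by blast
  have sol: "(\<forall>a\<in>S. (\<Sum>i\<in>UNIV. a i p * \<nu> i) = 0) \<longleftrightarrow> (\<forall>i. \<nu> i = (\<Sum>j\<in>J. b i j p * \<nu> j))"
    if "p \<in> A" "q p * r p \<noteq> 0" for p \<nu>
    using IH that by blast
  define Q where "Q = (\<lambda>x. q x * r x)"
  have Q: "Q \<in> poly_fun" unfolding Q_def using q r by (intro poly_fun_mult)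
  \<comment> \<open>Coefficients of the new equation in the free unknowns, after substituting the
    solution of the old system.\<close>
  define c where "c j p = (\<Sum>i\<in>UNIV. a i p * b i j p)" for j p
  have c: "c j \<in> rat_fun Q" for j
    unfolding c_def Q_def[symmetric]
    using insert.prems b r rat_fun_mono[OF _ r(1), of _ q]
    by (intro rat_fun_sum[OF Q] rat_fun_mult) (auto simp: Q_def)
  have sub: "(\<Sum>i\<in>UNIV. a i p * \<nu> i) = (\<Sum>j\<in>J. c j p * \<nu> j)"
    if "\<forall>i. \<nu> i = (\<Sum>j\<in>J. b i j p * \<nu> j)" for p \<nu>
  proof -
    have "(\<Sum>i\<in>UNIV. a i p * \<nu> i) = (\<Sum>i\<in>UNIV. a i p * (\<Sum>j\<in>J. b i j p * \<nu> j))"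
      by (subst that[rule_format]) simp
    also have "\<dots> = (\<Sum>j\<in>J. c j p * \<nu> j)"
      unfolding c_def sum_distrib_left sum_distrib_right
      by (subst sum.swap) (simp add: mult.assoc)
    finally show ?thesis .
  qed
  show ?case
  proof (cases "\<forall>j\<in>J. \<forall>p\<in>A. Q p \<noteq> 0 \<longrightarrow> c j p = 0")
    \<comment> \<open>The new equation follows from the old ones at every admissible point.\<close>
    case True
    have "(\<forall>a'\<in>insert a S. (\<Sum>i\<in>UNIV. a' i p * \<nu> i) = 0) \<longleftrightarrow> (\<forall>i. \<nu> i = (\<Sum>j\<in>J. b i j p * \<nu> j))"
      if p: "p \<in> A" "Q p \<noteq> 0" for p \<nu>
    proof -
      have "(\<Sum>j\<in>J. c j p * \<nu> j) = 0" using True p by (intro sum.neutral) auto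
      then have "(\<Sum>i\<in>UNIV. a i p * \<nu> i) = 0" if "\<forall>i. \<nu> i = (\<Sum>j\<in>J. b i j p * \<nu> j)"
        using sub[OF that] by (rule trans[rotated])
      then show ?thesis using sol[OF p(1), of \<nu>] p(2) unfolding Q_def by blast
    qed
    with r b \<delta> show ?thesis
      unfolding Q_def by (intro exI[of _ r] exI[of _ J] exI[of _ b]) auto
  next
    case False
    then obtain j0 p1 where j0: "j0 \<in> J" and p1: "p1 \<in> A" "Q p1 \<noteq> 0" "c j0 p1 \<noteq> 0" by blast
    \<comment> \<open>\<open>c j0\<close> becomes the pivot; its numerator \<open>g\<close> is the
      factor that joins \<open>r\<close>.\<close>
    obtain k g where g: "g \<in> poly_fun" "\<And>x. Q x \<noteq> 0 \<Longrightarrow> Q x ^ k * c j0 x = g x"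
      using c[of j0] by (metis rat_funE)
    define J' where "J' = J - {j0}"
    \<comment> \<open>Equal to \<open>c j / c j0\<close> where \<open>Q\<close> is nonzero, but
      written with the polynomial denominator \<open>g\<close>.\<close>
    define e where "e j p = c j p * (Q p ^ k / g p)" for j p
    define b' where "b' i j p = b i j p - b i j0 p * e j p" for i j p
    have J: "sum f J = f j0 + sum f J'" for f :: "'i \<Rightarrow> complex"
      unfolding J'_def using j0 by (simp add: sum.remove)
    have Qg: "(\<lambda>x. q x * (r x * g x)) = (\<lambda>x. Q x * g x)" by (auto simp: Q_def)
    have Qgp: "(\<lambda>x. Q x * g x) \<in> poly_fun" using Q g(1) by (rule poly_fun_mult)
    have b': "b' i j \<in> rat_fun (\<lambda>x. Q x * g x)" for i j
    proof -
      have "e j \<in> rat_fun (\<lambda>x. Q x * g x)" unfolding e_def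
        by (intro rat_fun_mult rat_fun_mono[OF c g(1)] rat_fun_divide[OF Q _ g(1)]
            rat_fun_poly[OF poly_fun_power[OF Q]])
      moreover have "b i j \<in> rat_fun (\<lambda>x. Q x * g x)" for j
        using b by (intro rat_fun_mono[OF _ g(1)]) (auto simp: Q_def)
      ultimately show ?thesis unfolding b'_def by (intro rat_fun_diff[OF Qgp] rat_fun_mult)
    qed
    have nz: "\<exists>p\<in>A. Q p * g p \<noteq> 0"
      using p1 g(2)[of p1, symmetric] by (intro bexI[of _ p1]) auto
    have e: "e j p = c j p / c j0 p" if "Q p \<noteq> 0" for j p
      using g(2)[OF that, symmetric] that unfolding e_def by simp
    have main: "(\<forall>i\<in>J'. \<forall>j\<in>J'. b' i j p = of_bool (i = j)) \<and>
      ((\<forall>a'\<in>insert a S. (\<Sum>i\<in>UNIV. a' i p * \<nu> i) = 0) \<longleftrightarrow> (\<forall>i. \<nu> i = (\<Sum>j\<in>J'. b' i j p * \<nu> j)))"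
      if p: "p \<in> A" "Q p * g p \<noteq> 0" for p \<nu>
    proof
      have Qp: "Q p \<noteq> 0" and cp: "c j0 p \<noteq> 0" using p g(2)[of p] by auto
      have \<delta>p: "b i j p = of_bool (i = j)" if "i \<in> J" "j \<in> J" for i j
        using \<delta>[OF p(1) _ that] Qp unfolding Q_def by blast
      show "\<forall>i\<in>J'. \<forall>j\<in>J'. b' i j p = of_bool (i = j)"
        using \<delta>p j0 unfolding b'_def J'_def by auto
      have expand: "(\<Sum>j\<in>J'. b' i j p * \<nu> j)
          = (\<Sum>j\<in>J'. b i j p * \<nu> j) - b i j0 p * ((\<Sum>j\<in>J'. c j p * \<nu> j) / c j0 p)" for i
        unfolding b'_def e[OF Qp]
        by (simp add: algebra_simps sum_subtractf sum_distrib_left sum_divide_distrib)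
      show "(\<forall>a'\<in>insert a S. (\<Sum>i\<in>UNIV. a' i p * \<nu> i) = 0) \<longleftrightarrow> (\<forall>i. \<nu> i = (\<Sum>j\<in>J'. b' i j p * \<nu> j))"
      proof
        assume L: "\<forall>a'\<in>insert a S. (\<Sum>i\<in>UNIV. a' i p * \<nu> i) = 0"
        then have \<nu>: "\<forall>i. \<nu> i = (\<Sum>j\<in>J. b i j p * \<nu> j)"
          using sol[OF p(1), of \<nu>] Qp unfolding Q_def by blast
        have "(\<Sum>j\<in>J. c j p * \<nu> j) = 0" using sub[OF \<nu>] L by simp
        then have n0: "\<nu> j0 = - ((\<Sum>j\<in>J'. c j p * \<nu> j) / c j0 p)"
          using cp unfolding J by (simp add: field_simps eq_neg_iff_add_eq_0)
        show "\<forall>i. \<nu> i = (\<Sum>j\<in>J'. b' i j p * \<nu> j)"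
        proof
          fix i
          have e1: "\<nu> i = b i j0 p * \<nu> j0 + (\<Sum>j\<in>J'. b i j p * \<nu> j)"
            using \<nu>[rule_format, of i] J[of "\<lambda>j. b i j p * \<nu> j"] by (rule trans)
          have e2: "b i j0 p * \<nu> j0 = - (b i j0 p * ((\<Sum>j\<in>J'. c j p * \<nu> j) / c j0 p))"
            by (subst n0) simp
          show "\<nu> i = (\<Sum>j\<in>J'. b' i j p * \<nu> j)"
            unfolding expand e1 e2 by simp
        qed
      next
        assume R: "\<forall>i. \<nu> i = (\<Sum>j\<in>J'. b' i j p * \<nu> j)"
        have "(\<Sum>j\<in>J'. b j0 j p * \<nu> j) = 0"
          using \<delta>p[OF j0] unfolding J'_def by (intro sum.neutral) auto
        then have n0: "\<nu> j0 = - ((\<Sum>j\<in>J'. c j p * \<nu> j) / c j0 p)"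
          using R[rule_format, of j0] \<delta>p[OF j0 j0] unfolding expand by simp
        have \<nu>: "\<forall>i. \<nu> i = (\<Sum>j\<in>J. b i j p * \<nu> j)"
        proof
          fix i
          have e1: "\<nu> i = (\<Sum>j\<in>J'. b i j p * \<nu> j) - b i j0 p * ((\<Sum>j\<in>J'. c j p * \<nu> j) / c j0 p)"
            using R[rule_format, of i] expand[of i] by (rule trans)
          have e2: "b i j0 p * \<nu> j0 = - (b i j0 p * ((\<Sum>j\<in>J'. c j p * \<nu> j) / c j0 p))"
            by (subst n0) simp
          show "\<nu> i = (\<Sum>j\<in>J. b i j p * \<nu> j)"
            unfolding J e1 e2 by simp
        qed
        then have "\<forall>a\<in>S. (\<Sum>i\<in>UNIV. a i p * \<nu> i) = 0"
          using sol[OF p(1), of \<nu>] Qp unfolding Q_def by blast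
        moreover have "(\<Sum>i\<in>UNIV. a i p * \<nu> i) = 0"
          unfolding sub[OF \<nu>] J using n0 cp by simp
        ultimately show "\<forall>a'\<in>insert a S. (\<Sum>i\<in>UNIV. a' i p * \<nu> i) = 0" by simp
      qed
    qed
    show ?thesis
    proof (intro exI[of _ "\<lambda>x. r x * g x"] exI[of _ J'] exI[of _ b'] conjI)
      show "(\<lambda>x. r x * g x) \<in> poly_fun" using r(1) g(1) by (rule poly_fun_mult)
      show "\<exists>p\<in>A. q p * (r p * g p) \<noteq> 0" using nz unfolding Q_def by (simp add: mult.assoc)
      show "\<forall>i j. b' i j \<in> rat_fun (\<lambda>x. q x * (r x * g x))" unfolding Qg using b' by blast
      show "\<forall>p\<in>A. q p * (r p * g p) \<noteq> 0 \<longrightarrow>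
        (\<forall>i\<in>J'. \<forall>j\<in>J'. b' i j p = of_bool (i = j)) \<and>
        (\<forall>\<nu>. (\<forall>a\<in>insert a S. (\<Sum>i\<in>UNIV. a i p * \<nu> i) = 0) \<longleftrightarrow> (\<forall>i. \<nu> i = (\<Sum>j\<in>J'. b' i j p * \<nu> j)))"
      proof (intro ballI impI)
        fix p assume "p \<in> A" "q p * (r p * g p) \<noteq> 0"
        then have p: "p \<in> A" "Q p * g p \<noteq> 0" by (simp_all add: Q_def mult.assoc)
        note m = main[OF this]
        show "(\<forall>i\<in>J'. \<forall>j\<in>J'. b' i j p = of_bool (i = j)) \<and>
          (\<forall>\<nu>. (\<forall>a\<in>insert a S. (\<Sum>i\<in>UNIV. a i p * \<nu> i) = 0) \<longleftrightarrow> (\<forall>i. \<nu> i = (\<Sum>j\<in>J'. b' i j p * \<nu> j)))"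
          by (intro conjI allI m[THEN conjunct1] m[THEN conjunct2])
      qed
    qed
  qed
qed

section \<open>The dimension of a rationally parametrized set\<close>

definition unit_seq :: "nat \<Rightarrow> nat \<Rightarrow> complex" where
  "unit_seq i = (\<lambda>k. of_bool (k = i))"

lemma sum_fun_apply: "(\<Sum>i\<in>I. f i) x = (\<Sum>i\<in>I. f i x)"
  by (induction I rule: infinite_finite_induct) auto

lemma scaleC_seq_apply [simp]: "(c *\<^sub>C p) i = c * p i" for p :: "'i \<Rightarrow> complex"
  by (simp add: scaleC_fun_def scaleC_complex_def)

lemma affine_space_expand:
  assumes "p \<in> affine_space d"
  shows "p = (\<Sum>i<d. p i *\<^sub>C unit_seq i)"
proof
  fix k
  have "(\<Sum>i<d. p i *\<^sub>C unit_seq i) k = (\<Sum>i<d. if i = k then p k else 0)"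
    unfolding sum_fun_apply by (intro sum.cong) (auto simp: unit_seq_def)
  also have "\<dots> = p k" using assms by (auto simp: affine_space_def)
  finally show "p k = (\<Sum>i<d. p i *\<^sub>C unit_seq i) k" by simp
qed

lemma clinear_affine_space:
  "clinear l \<Longrightarrow> p \<in> affine_space d \<Longrightarrow> l p = (\<Sum>i<d. p i *\<^sub>C l (unit_seq i))"
  using arg_cong[OF affine_space_expand, of p d l] by (simp add: clinear_sum clinear_scale)

lemma unit_seq_affine: "i < d \<Longrightarrow> unit_seq i \<in> affine_space d"
  by (auto simp: unit_seq_def affine_space_def)

lemma clinear_coord: "clinear (\<lambda>p::'i \<Rightarrow> complex. p i)"
  by (intro clinear_functionalI) auto

lemma poly_fun_coord: "(\<lambda>p::'i \<Rightarrow> complex. p i) \<in> poly_fun"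
  by (intro poly_fun_linear clinear_coord)

text \<open>On affine \<open>d\<close>-space a functional is a finite combination of coordinates,
  although the space of all sequences is infinite-dimensional.\<close>

lemma rat_map_seqI:
  assumes h: "h \<in> poly_fun" and "\<And>x. \<Psi> x \<in> affine_space d"
    and "\<And>i. i < d \<Longrightarrow> (\<lambda>x. \<Psi> x i) \<in> rat_fun h"
  shows "rat_map h \<Psi>"
  unfolding rat_map_def
proof (intro allI impI)
  fix l :: "(nat \<Rightarrow> complex) \<Rightarrow> complex" assume l: "clinear l"
  have "(\<lambda>x. \<Sum>i<d. \<Psi> x i * l (unit_seq i)) \<in> rat_fun h"
    using assms by (intro rat_fun_sum rat_fun_mult rat_fun_const) auto
  then show "(\<lambda>x. l (\<Psi> x)) \<in> rat_fun h"
    using clinear_affine_space[OF l assms(2)] by (simp add: scaleC_complex_def)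
qed

text \<open>Bounding each exponent separately, not the total degree, keeps the count below the pure
  power \<open>(B + 1) ^ m\<close>.\<close>

definition box_monomials :: "nat \<Rightarrow> nat \<Rightarrow> ((nat \<Rightarrow> complex) \<Rightarrow> complex) set" where
  "box_monomials m B = {\<lambda>p. \<Prod>i<m. p i ^ \<alpha> i | \<alpha>. \<forall>i<m. \<alpha> i \<le> B}"

lemma box_monomials_card: "finite (box_monomials m B) \<and> card (box_monomials m B) \<le> (B + 1) ^ m"
proof -
  let ?E = "PiE {..<m} (\<lambda>_. {..B})"
  have "box_monomials m B \<subseteq> (\<lambda>\<alpha> p. \<Prod>i<m. p i ^ \<alpha> i) ` ?E"
  proof
    fix f assume "f \<in> box_monomials m B"
    then obtain \<alpha> where "f = (\<lambda>p. \<Prod>i<m. p i ^ \<alpha> i)" "\<forall>i<m. \<alpha> i \<le> B"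
      unfolding box_monomials_def by blast
    then show "f \<in> (\<lambda>\<alpha> p. \<Prod>i<m. p i ^ \<alpha> i) ` ?E"
      \<comment> \<open>Exponents at indices from \<open>m\<close> on do not enter the monomial;
        \<open>restrict\<close> makes the exponent functions range over a finite set.\<close>
      by (intro image_eqI[of _ _ "restrict \<alpha> {..<m}"]) auto
  qed
  moreover have "finite ?E" by (simp add: finite_PiE)
  moreover have "card ?E = (B + 1) ^ m" by (simp add: card_PiE)
  ultimately show ?thesis
    using card_mono[of "(\<lambda>\<alpha> p. \<Prod>i<m. p i ^ \<alpha> i) ` ?E" "box_monomials m B"]
      card_image_le[of ?E "\<lambda>\<alpha> p. \<Prod>i<m. p i ^ \<alpha> i"]
    by (auto intro: finite_subset le_trans)
qed

text \<open>A polynomial function on sequences may involve coordinates beyond \<open>m\<close>; only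
  its restriction to affine \<open>m\<close>-space is recorded.\<close>

definition box_poly :: "nat \<Rightarrow> nat \<Rightarrow> ((nat \<Rightarrow> complex) \<Rightarrow> complex) set" where
  "box_poly m B = {f. \<exists>g\<in>complex_vector.span (box_monomials m B). \<forall>p\<in>affine_space m. f p = g p}"

lemma box_poly_mono: "B \<le> C \<Longrightarrow> box_poly m B \<subseteq> box_poly m C"
proof -
  assume "B \<le> C"
  then have "box_monomials m B \<subseteq> box_monomials m C"
    unfolding box_monomials_def by (auto intro: order_trans)
  then show ?thesis using complex_vector.span_mono unfolding box_poly_def by blast
qed

text \<open>Exponents of monomials add; \<open>sub\<close> supplies linearity in one factor, for two
  nested span inductions.\<close>

lemma span_box_monomials_mult:
  assumes "f \<in> complex_vector.span (box_monomials m B)" "g \<in> complex_vector.span (box_monomials m C)"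
  shows "(\<lambda>p. f p * g p) \<in> complex_vector.span (box_monomials m (B + C))"
    (is "_ \<in> ?S")
proof -
  have sub: "complex_vector.subspace {f. (\<lambda>p. f p * h p) \<in> ?S}"
    for h :: "(nat \<Rightarrow> complex) \<Rightarrow> complex"
  proof -
    have "(\<lambda>p. (f + f') p * h p) = (\<lambda>p. f p * h p) + (\<lambda>p. f' p * h p)"
      "(\<lambda>p. (c *\<^sub>C f) p * h p) = c *\<^sub>C (\<lambda>p. f p * h p)"
      "(\<lambda>p. (0 :: (nat \<Rightarrow> complex) \<Rightarrow> complex) p * h p) = 0" for f f' c
      by (auto simp: fun_eq_iff algebra_simps)
    then show ?thesis
      by (auto simp only: complex_vector.subspace_def mem_Collect_eq
          intro: complex_vector.span_add complex_vector.span_scale complex_vector.span_zero)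
  qed
  show ?thesis
    using assms(1)
  proof (induction rule: complex_vector.span_induct)
    case base
    show ?case by (rule sub)
  next
    case (step f)
    then obtain \<alpha> where \<alpha>: "f = (\<lambda>p. \<Prod>i<m. p i ^ \<alpha> i)" "\<forall>i<m. \<alpha> i \<le> B"
      unfolding box_monomials_def by blast
    have "(\<lambda>p. g p * f p) \<in> ?S"
      using assms(2)
    proof (induction rule: complex_vector.span_induct)
      case base
      show ?case by (rule sub)
    next
      case (step g)
      then obtain \<beta> where \<beta>: "g = (\<lambda>p. \<Prod>i<m. p i ^ \<beta> i)" "\<forall>i<m. \<beta> i \<le> C"
        unfolding box_monomials_def by blast
      have "(\<lambda>p. g p * f p) = (\<lambda>p. \<Prod>i<m. p i ^ (\<alpha> i + \<beta> i))"
        unfolding \<alpha> \<beta> by (simp add: power_add prod.distrib mult.commute)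
      moreover have "\<forall>i<m. \<alpha> i + \<beta> i \<le> B + C" using \<alpha> \<beta> by (auto intro: add_mono)
      ultimately have "(\<lambda>p. g p * f p) \<in> box_monomials m (B + C)"
        unfolding box_monomials_def by (intro CollectI exI[of _ "\<lambda>i. \<alpha> i + \<beta> i"]) simp
      then show ?case by (rule complex_vector.span_base)
    qed
    then show ?case by (simp only: mult.commute)
  qed
qed

lemma box_poly_mult:
  assumes "f \<in> box_poly m B" "g \<in> box_poly m C"
  shows "(\<lambda>p. f p * g p) \<in> box_poly m (B + C)"
proof -
  obtain f' g' where "f' \<in> complex_vector.span (box_monomials m B)" "\<forall>p\<in>affine_space m. f p = f' p"
    "g' \<in> complex_vector.span (box_monomials m C)" "\<forall>p\<in>affine_space m. g p = g' p"
    using assms unfolding box_poly_def by blast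
  then show ?thesis unfolding box_poly_def
    by (intro CollectI bexI[of _ "\<lambda>p. f' p * g' p"]) (auto intro: span_box_monomials_mult)
qed

lemma box_poly_const: "(\<lambda>_. c) \<in> box_poly m B"
proof -
  have "(\<lambda>_. 1) \<in> box_monomials m B"
    unfolding box_monomials_def by (intro CollectI exI[of _ "\<lambda>_. 0"]) auto
  then have "c *\<^sub>C (\<lambda>_. 1) \<in> complex_vector.span (box_monomials m B)"
    by (intro complex_vector.span_scale complex_vector.span_base)
  then show ?thesis unfolding box_poly_def by (intro CollectI bexI[of _ "c *\<^sub>C (\<lambda>_. 1)"]) auto
qed

lemma box_poly_add:
  assumes "f \<in> box_poly m B" "g \<in> box_poly m B"
  shows "(\<lambda>p. f p + g p) \<in> box_poly m B"
proof -
  obtain f' g' where "f' \<in> complex_vector.span (box_monomials m B)" "\<forall>p\<in>affine_space m. f p = f' p"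
    "g' \<in> complex_vector.span (box_monomials m B)" "\<forall>p\<in>affine_space m. g p = g' p"
    using assms unfolding box_poly_def by blast
  then show ?thesis unfolding box_poly_def
    by (intro CollectI bexI[of _ "f' + g'"]) (auto intro: complex_vector.span_add)
qed

lemma box_poly_sum:
  "(\<And>i. i \<in> I \<Longrightarrow> f i \<in> box_poly m B) \<Longrightarrow> (\<lambda>p. \<Sum>i\<in>I. f i p) \<in> box_poly m B"
  by (induction I rule: infinite_finite_induct) (simp_all add: box_poly_const box_poly_add)

lemma box_poly_power: "f \<in> box_poly m B \<Longrightarrow> (\<lambda>p. f p ^ k) \<in> box_poly m (k * B)"
  by (induction k) (simp_all add: box_poly_const box_poly_mult)

lemma box_poly_prod:
  "(\<And>i. i \<in> I \<Longrightarrow> f i \<in> box_poly m B) \<Longrightarrow> (\<lambda>p. \<Prod>i\<in>I. f i p) \<in> box_poly m (card I * B)"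
  by (induction I rule: infinite_finite_induct) (simp_all add: box_poly_const box_poly_mult)

lemma poly_fun_box_poly:
  assumes "f \<in> poly_fun"
  shows "\<exists>B. f \<in> box_poly m B"
  using assms
proof induction
  case (poly_fun_const c)
  show ?case using box_poly_const by blast
next
  case (poly_fun_linear l)
  have c: "(\<lambda>p. p i) \<in> box_poly m 1" if "i < m" for i
  proof -
    have "(\<lambda>p::nat \<Rightarrow> complex. p i) = (\<lambda>p. \<Prod>j<m. p j ^ of_bool (j = i))"
    proof
      fix p :: "nat \<Rightarrow> complex"
      have "(\<Prod>j<m. p j ^ of_bool (j = i)) = (\<Prod>j<m. if j = i then p i else 1)"
        by (intro prod.cong) auto
      also have "\<dots> = p i" using that by simp
      finally show "p i = (\<Prod>j<m. p j ^ of_bool (j = i))" by simp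
    qed
    then have "(\<lambda>p. p i) \<in> box_monomials m 1"
      using that unfolding box_monomials_def by (intro CollectI exI[of _ "\<lambda>j. of_bool (j = i)"]) auto
    then show ?thesis unfolding box_poly_def
      by (intro CollectI bexI[of _ "\<lambda>p. p i"] ballI refl complex_vector.span_base)
  qed
  have "(\<lambda>p. \<Sum>i<m. p i * l (unit_seq i)) \<in> box_poly m (1 + 0)"
    by (intro box_poly_sum box_poly_mult box_poly_const c) simp
  then have "l \<in> box_poly m 1"
    using clinear_affine_space[OF poly_fun_linear] unfolding box_poly_def
    by (simp add: scaleC_complex_def)
  then show ?case by blast
next
  case (poly_fun_add f g)
  then obtain B C where "f \<in> box_poly m B" "g \<in> box_poly m C" by blast
  then have "f \<in> box_poly m (max B C)" "g \<in> box_poly m (max B C)"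
    using box_poly_mono[of B "max B C"] box_poly_mono[of C "max B C"] by auto
  then show ?case using box_poly_add by blast
next
  case (poly_fun_mult f g)
  then show ?case using box_poly_mult by blast
qed

text \<open>An injective family outnumbering its generators is dependent. If two members coincide,
  the image set may still be independent, and their difference is the relation.\<close>

lemma linear_relation_in_span:
  fixes g :: "nat \<Rightarrow> 'v::complex_vector"
  assumes "finite T" "card T < n" "\<And>k. k < n \<Longrightarrow> g k \<in> complex_vector.span T"
  obtains c k0 where "k0 < n" "c k0 \<noteq> 0" "(\<Sum>k<n. c k *\<^sub>C g k) = 0"
proof (cases "inj_on g {..<n}")
  case True
  have "\<not> complex_vector.independent (g ` {..<n})"
  proof
    assume "complex_vector.independent (g ` {..<n})"
    then have "card (g ` {..<n}) \<le> card T"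
      using assms by (intro conjunct2[OF complex_vector.independent_span_bound]) auto
    then show False using assms(2) by (simp add: card_image[OF True])
  qed
  then obtain u where u: "\<exists>v\<in>g ` {..<n}. u v \<noteq> 0" "(\<Sum>v\<in>g ` {..<n}. u v *\<^sub>C v) = 0"
    by (subst (asm) complex_vector.dependent_finite) auto
  then obtain k0 where "k0 < n" "u (g k0) \<noteq> 0" by blast
  moreover have "(\<Sum>k<n. u (g k) *\<^sub>C g k) = 0"
    using u(2) by (simp add: sum.reindex[OF True])
  ultimately show thesis using that[of k0 "\<lambda>k. u (g k)"] by blast
next
  case False
  then obtain i j where ij: "i < n" "j < n" "i \<noteq> j" "g i = g j" by (auto simp: inj_on_def)
  have "(\<Sum>k<n. (of_bool (k = i) - of_bool (k = j)) *\<^sub>C g k)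
      = (\<Sum>k<n. if k = i then g k else 0) - (\<Sum>k<n. if k = j then g k else 0)"
    unfolding sum_subtractf[symmetric]
    by (intro sum.cong) (auto simp: scaleC_one complex_vector.scale_minus_left)
  also have "\<dots> = 0" using ij by simp
  finally show thesis using ij that[of i "\<lambda>k. of_bool (k = i) - of_bool (k = j)"] by simp
qed

lemma sum_digits: "(\<Sum>i<e. D ^ i * ((k div D ^ i) mod D)) = k mod D ^ (e::nat)" for D k :: nat
  by (induction e) (simp_all add: power_Suc2 mod_mult2_eq add.commute del: power_Suc)

text \<open>The monomials in \<open>e\<close> variables with exponents below \<open>D\<close> are indexed by the numbers below
  \<open>D\<^sup>e\<close>, the exponents being the base \<open>D\<close> digits.  At the point with coordinates \<open>s ^ (D ^ i)\<close> the
  monomial of index \<open>k\<close> takes the value \<open>s ^ k\<close>, so distinct monomials are linearly independent.\<close>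

lemma digit_monomials_independent:
  fixes c :: "nat \<Rightarrow> complex"
  assumes "k0 < D ^ e" "c k0 \<noteq> 0"
  obtains y where "y \<in> affine_space e" "(\<Sum>k<D ^ e. c k * (\<Prod>i<e. y i ^ ((k div D ^ i) mod D))) \<noteq> 0"
proof (rule ccontr)
  assume neg: "\<not> thesis"
  let ?y = "\<lambda>s i. if i < e then s ^ (D ^ i) else (0::complex)"
  have "(\<Sum>k<D ^ e. c k * s ^ k) = 0" for s
  proof -
    have "(\<Prod>i<e. ?y s i ^ ((k div D ^ i) mod D)) = s ^ k" if "k < D ^ e" for k
    proof -
      have "(\<Prod>i<e. ?y s i ^ ((k div D ^ i) mod D)) = (\<Prod>i<e. s ^ (D ^ i * ((k div D ^ i) mod D)))"
        by (intro prod.cong) (simp_all add: power_mult)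
      also have "\<dots> = s ^ (\<Sum>i<e. D ^ i * ((k div D ^ i) mod D))" by (rule power_sum[symmetric])
      also have "\<dots> = s ^ k" using that by (simp add: sum_digits)
      finally show ?thesis .
    qed
    then have "(\<Sum>k<D ^ e. c k * s ^ k) = (\<Sum>k<D ^ e. c k * (\<Prod>i<e. ?y s i ^ ((k div D ^ i) mod D)))"
      by (intro sum.cong) simp_all
    also have "\<dots> = 0" using neg that[of "?y s"] by (auto simp: affine_space_def)
    finally show ?thesis .
  qed
  moreover have "{..<D ^ e} = {..D ^ e - 1}" using assms(1) by auto
  ultimately have "\<forall>k\<le>D ^ e - 1. c k = 0"
    using Transcendental.polyfun_eq_0[of c "D ^ e - 1"] by simp
  with assms show False by auto
qed

text \<open>With exponents below \<open>D\<close> there are \<open>D\<^sup>e\<close> monomials in \<open>e\<close> functions of \<open>m\<close> parameters, but up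
  to a common denominator they lie in a space of dimension \<open>O(D\<^sup>m)\<close>.\<close>

lemma rat_fun_algebraic_relation:
  fixes G :: "(nat \<Rightarrow> complex) \<Rightarrow> nat \<Rightarrow> complex"
  assumes q: "q \<in> poly_fun" and G: "\<And>i. i < e \<Longrightarrow> (\<lambda>p. G p i) \<in> rat_fun q" and me: "m < e"
  obtains P y where "P \<in> poly_fun" "y \<in> affine_space e" "P y \<noteq> 0"
    "\<And>p. p \<in> affine_space m \<Longrightarrow> q p \<noteq> 0 \<Longrightarrow> P (G p) = 0"
proof -
  have "\<exists>k g. g \<in> poly_fun \<and> (\<forall>x. q x \<noteq> 0 \<longrightarrow> q x ^ k * G x i = g x)" if "i < e" for i
    using rat_funE[OF G[OF that]] by metis
  then obtain a r where r: "\<And>i. i < e \<Longrightarrow> r i \<in> poly_fun"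
    "\<And>i x. i < e \<Longrightarrow> q x \<noteq> 0 \<Longrightarrow> q x ^ a i * G x i = r i x" by metis
  \<comment> \<open>A common exponent: all \<open>G p i\<close> get the denominator
    \<open>q ^ N\<close>.\<close>
  define N where "N = (\<Sum>i<e. a i)"
  have aN: "a i \<le> N" if "i < e" for i unfolding N_def using that by (intro member_le_sum) auto
  define R where "R i = (\<lambda>x. q x ^ (N - a i) * r i x)" for i
  have R: "R i \<in> poly_fun" if "i < e" for i
    unfolding R_def using that q r by (intro poly_fun_mult poly_fun_power)
  have RG: "R i x = q x ^ N * G x i" if "i < e" "q x \<noteq> 0" for i x
    unfolding R_def using r(2)[OF that, symmetric] aN[OF that(1)]
    by (simp add: power_add[symmetric] flip: mult.assoc)
  obtain b0 where b0: "q \<in> box_poly m b0" using poly_fun_box_poly[OF q] by blast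
  have "\<exists>B. R i \<in> box_poly m B" if "i < e" for i using poly_fun_box_poly[OF R[OF that]] .
  then obtain b where b: "\<And>i. i < e \<Longrightarrow> R i \<in> box_poly m (b i)" by metis
  define B where "B = b0 + (\<Sum>i<e. b i)"
  have RB: "R i \<in> box_poly m B" if "i < e" for i
  proof -
    have "b i \<le> (\<Sum>i<e. b i)" using that by (intro member_le_sum) auto
    then have "b i \<le> B" unfolding B_def by simp
    then show ?thesis using b[OF that] box_poly_mono by blast
  qed
  have qB: "q \<in> box_poly m B" using b0 box_poly_mono[of b0 B] unfolding B_def by auto
  \<comment> \<open>Each of the \<open>e\<close> factors of \<open>T k\<close> below has box bound
    \<open>(1 + N) * B * D\<close>: at most \<open>B * D\<close> from \<open>R i\<close> and
    \<open>N * B * D\<close> from the power of \<open>q\<close>.\<close>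
  define C where "C = e * ((1 + N) * B)"
  \<comment> \<open>Chosen just above \<open>(C + 1) ^ m\<close>, so that \<open>(C * D + 1) ^ m
    \<le> (C + 1) ^ m * D ^ m < D ^ (m + 1) \<le> D ^ e\<close>.\<close>
  define D where "D = (C + 1) ^ m + 1"
  have D1: "1 \<le> D" unfolding D_def by simp
  have card: "(C * D + 1) ^ m < D ^ e"
  proof -
    have "(C * D + 1) ^ m \<le> ((C + 1) * D) ^ m" using D1 by (intro power_mono) (auto simp: algebra_simps)
    also have "\<dots> = (C + 1) ^ m * D ^ m" by (rule power_mult_distrib)
    also have "\<dots> < D * D ^ m" using D1 by (intro mult_strict_right_mono) (auto simp: D_def)
    also have "\<dots> = D ^ Suc m" by simp
    also have "\<dots> \<le> D ^ e" using me D1 by (intro power_increasing) auto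
    finally show ?thesis .
  qed
  let ?d = "\<lambda>k i. (k div D ^ i) mod D"
  have dD: "?d k i < D" for k i using D1 by simp
  \<comment> \<open>The monomial of index \<open>k\<close> in the \<open>G p i\<close>, padded with
    powers of \<open>q\<close> so that the one factor \<open>q p ^ (N * D * e)\<close> clears the
    denominators of all monomials at once.\<close>
  define T where "T k = (\<lambda>p. \<Prod>i<e. R i p ^ ?d k i * q p ^ (N * (D - ?d k i)))" for k
  have TB: "T k \<in> box_poly m (C * D)" for k
  proof -
    have "(\<lambda>p. R i p ^ ?d k i * q p ^ (N * (D - ?d k i))) \<in> box_poly m ((1 + N) * B * D)"
      if "i < e" for i
    proof -
      have "?d k i * B + N * (D - ?d k i) * B \<le> D * B + N * D * B"
        using dD[of k i] by (intro add_mono mult_le_mono) auto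
      also have "\<dots> = (1 + N) * B * D" by (simp add: algebra_simps)
      finally show ?thesis
        using box_poly_mult[OF box_poly_power[OF RB[OF that]] box_poly_power[OF qB],
          of "?d k i" "N * (D - ?d k i)"] box_poly_mono by blast
    qed
    then have "T k \<in> box_poly m (card {..<e} * ((1 + N) * B * D))"
      unfolding T_def by (intro box_poly_prod) auto
    then show ?thesis by (simp add: C_def algebra_simps)
  qed
  then have "\<forall>k. \<exists>g\<in>complex_vector.span (box_monomials m (C * D)). \<forall>p\<in>affine_space m. T k p = g p"
    unfolding box_poly_def by blast
  then obtain g where g: "\<And>k. g k \<in> complex_vector.span (box_monomials m (C * D))"
    "\<And>k p. p \<in> affine_space m \<Longrightarrow> T k p = g k p" by metis
  obtain c k0 where c: "k0 < D ^ e" "c k0 \<noteq> 0" "(\<Sum>k<D ^ e. c k *\<^sub>C g k) = 0"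
  proof (rule linear_relation_in_span[of "box_monomials m (C * D)" "D ^ e" g])
    show "finite (box_monomials m (C * D))" "card (box_monomials m (C * D)) < D ^ e"
      using box_monomials_card[of m "C * D"] card by auto
  qed (use g in auto)
  define P where "P = (\<lambda>y. \<Sum>k<D ^ e. c k * (\<Prod>i<e. y i ^ ?d k i))"
  obtain y where y: "y \<in> affine_space e" "P y \<noteq> 0"
    using digit_monomials_independent[of k0 D e c] c(1,2) unfolding P_def by blast
  show thesis
  proof (rule that)
    show "P \<in> poly_fun" unfolding P_def
      by (intro poly_fun_sum poly_fun_cmult poly_fun_prod poly_fun_power poly_fun_coord)
    show "y \<in> affine_space e" "P y \<noteq> 0" by fact+
    fix p assume p: "p \<in> affine_space m" "q p \<noteq> 0"
    have T: "T k p = q p ^ (N * D * e) * (\<Prod>i<e. G p i ^ ?d k i)" for k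
    proof -
      have "R i p ^ ?d k i * q p ^ (N * (D - ?d k i)) = q p ^ (N * D) * G p i ^ ?d k i"
        if "i < e" for i
      proof -
        have "N * ?d k i + N * (D - ?d k i) = N * D"
          using dD[of k i] by (simp flip: distrib_left)
        then have "q p ^ (N * ?d k i) * q p ^ (N * (D - ?d k i)) = q p ^ (N * D)"
          by (simp flip: power_add)
        then show ?thesis
          unfolding RG[OF that p(2)] power_mult_distrib power_mult[symmetric]
          by (simp add: mult.assoc mult.left_commute mult.commute)
      qed
      then have "T k p = (\<Prod>i<e. q p ^ (N * D) * G p i ^ ?d k i)"
        unfolding T_def by (intro prod.cong) auto
      then show ?thesis by (simp add: prod.distrib power_mult)
    qed
    have "0 = (\<Sum>k<D ^ e. c k *\<^sub>C g k) p" using c(3) by simp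
    also have "\<dots> = (\<Sum>k<D ^ e. c k * T k p)" unfolding sum_fun_apply using g(2)[OF p(1)] by simp
    also have "\<dots> = q p ^ (N * D * e) * P (G p)"
      unfolding T P_def sum_distrib_left by (intro sum.cong) (auto simp: algebra_simps)
    finally show "P (G p) = 0" using p(2) by simp
  qed
qed

text \<open>On the line \<open>p\<^sub>0 + s u\<close> the point \<open>H(p)(p - p\<^sub>0)\<close> equals \<open>\<eta>(s) u\<close> with
  \<open>\<eta>(s) = s H(p\<^sub>0 + s u)\<close>, and the rational function \<open>\<eta>\<close> is not constant because \<open>H(p\<^sub>0) \<noteq> 0\<close>.\<close>

lemma poly_fun_vanishing_on_rescaling:
  assumes S: "complex_vector.subspace S" and q: "q \<in> poly_fun" and H: "H \<in> rat_fun q"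
    and p0: "p0 \<in> S" "q p0 \<noteq> 0" "H p0 \<noteq> 0" and P: "P \<in> poly_fun"
    and van: "\<And>p. p \<in> S \<Longrightarrow> q p \<noteq> 0 \<Longrightarrow> P (H p *\<^sub>C (p - p0)) = 0"
    and u: "u \<in> S"
  shows "P u = 0"
proof -
  obtain k r where r: "r \<in> poly_fun" "\<And>x. q x \<noteq> 0 \<Longrightarrow> q x ^ k * H x = r x"
    using H by (metis rat_funE)
  obtain Q where Q: "\<And>s. q (p0 + s *\<^sub>C u) = poly Q s" using poly_fun_on_line[OF q] by blast
  obtain R where R: "\<And>s. r (p0 + s *\<^sub>C u) = poly R s" using poly_fun_on_line[OF r(1)] by blast
  obtain \<pi> where \<pi>: "\<And>s. P (0 + s *\<^sub>C u) = poly \<pi> s" using poly_fun_on_line[OF P] by blast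
  have Q0: "poly Q 0 \<noteq> 0" using Q[of 0] p0 by simp
  have R0: "poly R 0 \<noteq> 0" using R[of 0] p0 r(2)[of p0] by auto
  have "\<pi> = 0"
  proof (rule ccontr)
    assume "\<pi> \<noteq> 0"
    let ?Z = "{x. poly \<pi> x = 0}"
    have fin: "finite ?Z" using \<open>\<pi> \<noteq> 0\<close> by (rule poly_roots_finite)
    \<comment> \<open>Where \<open>q\<close> is nonzero, \<open>H * s\<close> is one of the finitely
      many roots of \<open>\<pi>\<close>, so some factor of the product vanishes at
      \<open>s\<close>; the leading \<open>Q\<close> covers the other \<open>s\<close>.\<close>
    let ?M = "Q * (\<Prod>\<rho>\<in>?Z. [:0, 1:] * R - smult \<rho> (Q ^ k))"
    have "poly ?M s = 0" for s
    proof (cases "poly Q s = 0")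
      case False
      let ?p = "p0 + s *\<^sub>C u" and ?\<rho> = "H (p0 + s *\<^sub>C u) * s"
      have "?p \<in> S" using S p0 u
        by (intro complex_vector.subspace_add complex_vector.subspace_scale)
      then have "P (H ?p *\<^sub>C (s *\<^sub>C u)) = 0" using van[of ?p] False Q by simp
      then have "?\<rho> \<in> ?Z" using \<pi>[of ?\<rho>] by (simp add: scaleC_scaleC)
      moreover have "poly ([:0, 1:] * R - smult ?\<rho> (Q ^ k)) s = 0"
        using r(2)[of ?p] False by (simp add: Q R[symmetric] algebra_simps)
      ultimately have "(\<Prod>\<rho>\<in>?Z. poly ([:0, 1:] * R - smult \<rho> (Q ^ k)) s) = 0"
        using fin by (intro prod_zero) blast+
      then show ?thesis by (simp add: poly_prod)
    qed simp
    then have "?M = 0" using poly_all_0_iff_0 by blast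
    then obtain \<rho> where \<rho>: "[:0, 1:] * R - smult \<rho> (Q ^ k) = 0"
      using fin Q0 by (auto simp: prod_zero_iff)
    \<comment> \<open>At \<open>s = 0\<close> the first term vanishes while \<open>Q\<close> does
      not, which forces \<open>\<rho> = 0\<close>; then \<open>R\<close> would be zero, against
      \<open>R0\<close>.\<close>
    have "poly ([:0, 1:] * R - smult \<rho> (Q ^ k)) 0 = 0" unfolding \<rho> by simp
    then have "\<rho> = 0" using Q0 by simp
    then show False using \<rho> R0 by auto
  qed
  then show ?thesis using \<pi>[of 1] by (simp add: scaleC_one)
qed

section \<open>Tangent spaces of a rationally parametrized set\<close>

definition mat_unit :: "'n \<Rightarrow> 'n \<Rightarrow> complex^'n^'n" where
  "mat_unit i j = axis i (axis j 1)"

lemma scaleC_mat_apply [simp]: "(c *\<^sub>C Z) $ i $ j = c * Z $ i $ j" for Z :: "complex^'n^'m"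
  by (simp add: scaleC_vec_def scaleC_complex_def)

lemma scaleC_vec_apply [simp]: "(c *\<^sub>C v) $ i = c * v $ i" for v :: "complex^'n"
  by (simp add: scaleC_vec_def scaleC_complex_def)

lemma mat_unit_apply: "mat_unit a b $ i $ j = of_bool (i = a \<and> j = b)"
  by (simp add: mat_unit_def axis_def)

lemma mat_expand: "Z = (\<Sum>i\<in>UNIV. \<Sum>j\<in>UNIV. Z $ i $ j *\<^sub>C mat_unit i j)"
  for Z :: "complex^'n::finite^'n"
proof -
  have "(\<Sum>i\<in>UNIV. \<Sum>j\<in>UNIV. Z $ i $ j *\<^sub>C mat_unit i j) $ a $ b = Z $ a $ b" for a b
  proof -
    have "(\<Sum>i\<in>UNIV. \<Sum>j\<in>UNIV. Z $ i $ j *\<^sub>C mat_unit i j) $ a $ b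
       = (\<Sum>i\<in>UNIV. \<Sum>j\<in>UNIV. if j = b then if i = a then Z $ i $ j else 0 else 0)"
      unfolding sum_component scaleC_mat_apply mat_unit_apply by (intro sum.cong) auto
    then show ?thesis by simp
  qed
  then show ?thesis by (simp add: vec_eq_iff)
qed

lemma clinear_mat:
  fixes l :: "complex^'n::finite^'n \<Rightarrow> complex"
  assumes "clinear l"
  shows "l Z = (\<Sum>i\<in>UNIV. \<Sum>j\<in>UNIV. Z $ i $ j * l (mat_unit i j))"
  using arg_cong[OF mat_expand[of Z], of l] assms
  by (simp add: clinear_sum clinear_functional_scale)

lemma clinear_mat_entry: "clinear (\<lambda>Z::complex^'n^'m. Z $ i $ j)"
  by (intro clinear_functionalI) auto

lemma rat_map_matI:
  fixes \<Phi> :: "'a::complex_vector \<Rightarrow> complex^'n::finite^'n"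
  assumes "h \<in> poly_fun" "\<And>i j. (\<lambda>x. \<Phi> x $ i $ j) \<in> rat_fun h"
  shows "rat_map h \<Phi>"
  unfolding rat_map_def
proof (intro allI impI)
  fix l :: "complex^'n^'n \<Rightarrow> complex" assume l: "clinear l"
  have "(\<lambda>x. \<Sum>i\<in>UNIV. \<Sum>j\<in>UNIV. \<Phi> x $ i $ j * l (mat_unit i j)) \<in> rat_fun h"
    using assms by (intro rat_fun_sum rat_fun_mult rat_fun_const) auto
  then show "(\<lambda>x. l (\<Phi> x)) \<in> rat_fun h" by (subst clinear_mat[OF l])
qed

lemma rat_map_mat_entry: "rat_map h \<Phi> \<Longrightarrow> (\<lambda>x. \<Phi> x $ i $ j) \<in> rat_fun h"
  for \<Phi> :: "'a::complex_vector \<Rightarrow> complex^'n^'m"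
  unfolding rat_map_def using clinear_mat_entry by blast

definition mat_deriv :: "('a::complex_vector \<Rightarrow> complex^'n^'n) \<Rightarrow> 'a \<Rightarrow> 'a \<Rightarrow> complex^'n^'n" where
  "mat_deriv \<Phi> p v = (\<chi> i j. dir_deriv (\<lambda>x. \<Phi> x $ i $ j) p v)"

lemma mat_deriv_curve:
  fixes \<Phi> :: "'a::complex_vector \<Rightarrow> complex^'n::finite^'n"
  assumes q: "q \<in> poly_fun" "rat_map q \<Phi>" and "q (\<gamma> 0) \<noteq> 0" "curve_deriv \<gamma> v"
  shows "curve_deriv (\<lambda>t. \<Phi> (\<gamma> t)) (mat_deriv \<Phi> (\<gamma> 0) v)"
  unfolding curve_deriv_def
proof (intro allI impI)
  fix l :: "complex^'n^'n \<Rightarrow> complex" assume l: "clinear l"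
  have "((\<lambda>t. \<Sum>i\<in>UNIV. \<Sum>j\<in>UNIV. \<Phi> (\<gamma> t) $ i $ j * l (mat_unit i j)) has_field_derivative
      (\<Sum>i\<in>UNIV. \<Sum>j\<in>UNIV. dir_deriv (\<lambda>x. \<Phi> x $ i $ j) (\<gamma> 0) v * l (mat_unit i j))) (at 0)"
    by (intro DERIV_sum DERIV_cmult_right rat_fun_curve_deriv[OF q(1) rat_map_mat_entry[OF q(2)] assms(3,4)])
  then show "((\<lambda>t. l (\<Phi> (\<gamma> t))) has_field_derivative l (mat_deriv \<Phi> (\<gamma> 0) v)) (at 0)"
    by (subst (1 2) clinear_mat[OF l]) (simp add: mat_deriv_def)
qed

lemma clinear_mat_deriv:
  fixes \<Phi> :: "'a::complex_vector \<Rightarrow> complex^'n::finite^'n"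
  assumes "q \<in> poly_fun" "rat_map q \<Phi>" "q p \<noteq> 0"
  shows "clinear (mat_deriv \<Phi> p)"
proof -
  note lin = dir_deriv_rat_linear[OF assms(1) rat_map_mat_entry[OF assms(2)] assms(3)]
  show ?thesis
    by (intro clinearI) (simp_all add: vec_eq_iff mat_deriv_def clinear_add[OF lin] clinear_functional_scale[OF lin])
qed

lemma tangent_space_dir_deriv:
  "tangent_space W Z = {A. \<forall>f\<in>poly_fun. (\<forall>x\<in>W. f x = 0) \<longrightarrow> dir_deriv f Z A = 0}"
  unfolding tangent_space_def dir_deriv_def ..

lemma tangent_spaceD:
  assumes "A \<in> tangent_space W Z" "f \<in> poly_fun" "\<And>x. x \<in> W \<Longrightarrow> f x = 0"
  shows "dir_deriv f Z A = 0"
  using assms(1) bspec[of poly_fun _ f] assms(2,3) by (simp add: tangent_space_dir_deriv)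

text \<open>\<open>\<Phi>\<close> is a rational map from affine \<open>m\<close>-space with dense image in \<open>W\<close>, inverted on its image
  by the rational functions \<open>g k / h\<close>.\<close>

locale rational_param =
  fixes m :: nat and q :: "(nat \<Rightarrow> complex) \<Rightarrow> complex"
    and \<Phi> :: "(nat \<Rightarrow> complex) \<Rightarrow> complex^'n::finite^'n"
    and h :: "complex^'n^'n \<Rightarrow> complex" and g :: "nat \<Rightarrow> complex^'n^'n \<Rightarrow> complex"
    and W :: "(complex^'n^'n) set"
  assumes q_poly: "q \<in> poly_fun" and h_poly: "h \<in> poly_fun"
    and g_poly: "\<And>k. k < m \<Longrightarrow> g k \<in> poly_fun"
    and \<Phi>_rat: "rat_map q \<Phi>"
    and nonempty: "\<exists>p\<in>affine_space m. q p \<noteq> 0"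
    and h_\<Phi>: "\<And>p. p \<in> affine_space m \<Longrightarrow> q p \<noteq> 0 \<Longrightarrow> h (\<Phi> p) \<noteq> 0"
    and g_\<Phi>: "\<And>p k. p \<in> affine_space m \<Longrightarrow> q p \<noteq> 0 \<Longrightarrow> k < m \<Longrightarrow> g k (\<Phi> p) = p k * h (\<Phi> p)"
    and \<Phi>_in: "\<And>p. p \<in> affine_space m \<Longrightarrow> q p \<noteq> 0 \<Longrightarrow> \<Phi> p \<in> W"
    and dense: "\<And>f x. f \<in> poly_fun \<Longrightarrow> (\<And>p. p \<in> affine_space m \<Longrightarrow> q p \<noteq> 0 \<Longrightarrow> f (\<Phi> p) = 0) \<Longrightarrow>
      x \<in> W \<Longrightarrow> f x = 0"
begin

definition \<Psi> :: "complex^'n^'n \<Rightarrow> nat \<Rightarrow> complex" where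
  "\<Psi> Z = (\<lambda>k. if k < m then g k Z / h Z else 0)"

lemma \<Psi>_affine: "\<Psi> Z \<in> affine_space m"
  by (simp add: \<Psi>_def affine_space_def)

lemma \<Psi>_coord_rat: "(\<lambda>Z. \<Psi> Z k) \<in> rat_fun h"
proof (cases "k < m")
  case True
  then show ?thesis
    by (intro rat_funI[where k = 1, OF g_poly[OF True]]) (simp add: \<Psi>_def)
next
  case False
  then show ?thesis by (simp add: \<Psi>_def rat_fun_const)
qed

lemma \<Psi>_rat: "rat_map h \<Psi>"
  by (rule rat_map_seqI[OF h_poly \<Psi>_affine \<Psi>_coord_rat])

lemma \<Psi>_\<Phi>: "p \<in> affine_space m \<Longrightarrow> q p \<noteq> 0 \<Longrightarrow> \<Psi> (\<Phi> p) = p"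
  using h_\<Phi> g_\<Phi> by (auto simp: \<Psi>_def affine_space_def fun_eq_iff)

text \<open>More than \<open>m\<close> functions on \<open>W\<close> pull back along
  \<open>\<Phi>\<close> to rational functions of \<open>m\<close> parameters and are algebraically
  dependent, by counting. In the other direction \<open>m\<close> independent functions come from
  the numerators of the inverse.\<close>

lemma variety_dim_eq: "variety_dim W = m"
  unfolding variety_dim_def
proof (rule Max_eqI)
  let ?D = "{d. \<exists>F. (\<forall>x. F x \<in> affine_space d) \<and> (\<forall>i. (\<lambda>x. F x i) \<in> poly_fun) \<and>
     (\<forall>P\<in>poly_fun. (\<forall>x\<in>W. P (F x) = 0) \<longrightarrow> (\<forall>y\<in>affine_space d. P y = 0))}"
  show le: "d \<le> m" if "d \<in> ?D" for d
  proof (rule ccontr)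
    assume "\<not> d \<le> m"
    from that obtain F where F: "\<forall>x. F x \<in> affine_space d" "\<forall>i. (\<lambda>x. F x i) \<in> poly_fun"
      "\<forall>P\<in>poly_fun. (\<forall>x\<in>W. P (F x) = 0) \<longrightarrow> (\<forall>y\<in>affine_space d. P y = 0)" by blast
    have G: "(\<lambda>p. F (\<Phi> p) i) \<in> rat_fun q" for i
      using rat_map_poly_comp[OF q_poly \<Phi>_rat F(2)[rule_format, of i]] by simp
    obtain P y where P: "P \<in> poly_fun" "y \<in> affine_space d" "P y \<noteq> 0"
      "\<And>p. p \<in> affine_space m \<Longrightarrow> q p \<noteq> 0 \<Longrightarrow> P (F (\<Phi> p)) = 0"
      using rat_fun_algebraic_relation[of q d "\<lambda>p. F (\<Phi> p)" m] q_poly G \<open>\<not> d \<le> m\<close> by auto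
    have "(\<lambda>x. P (F x)) \<in> poly_fun"
    proof (intro rat_fun_one_poly rat_map_poly_comp[OF poly_fun_const _ P(1)])
      show "rat_map (\<lambda>_. 1) F"
        using F by (intro rat_map_seqI[of _ _ d] poly_fun_const rat_fun_poly) auto
    qed
    then have "\<forall>x\<in>W. P (F x) = 0" using dense P(4) by blast
    with F(3) P show False by blast
  qed
  show "finite ?D" using le by (intro finite_subset[of ?D "{..m}"]) auto
  obtain p0 where p0: "p0 \<in> affine_space m" "q p0 \<noteq> 0" using nonempty by blast
  \<comment> \<open>The coordinates \<open>g k / h\<close> of the inverse are not polynomials, and
    the bare numerators can be dependent: with \<open>m = 1\<close> and
    \<open>h (\<Phi> p) = 1 / p 0\<close> the numerator \<open>g 0\<close> is constant on the image.
    The shift by \<open>p0\<close> turns \<open>F (\<Phi> p)\<close> into a rescaling of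
    \<open>p - p0\<close>.\<close>
  define F where "F Z = (\<lambda>k. if k < m then g k Z - p0 k * h Z else 0)" for Z
  have F\<Phi>: "F (\<Phi> p) = h (\<Phi> p) *\<^sub>C (p - p0)" if "p \<in> affine_space m" "q p \<noteq> 0" for p
    using that p0(1) g_\<Phi>[OF that] by (auto simp: F_def fun_eq_iff affine_space_def algebra_simps)
  show "m \<in> ?D"
  proof (intro CollectI exI[of _ F] conjI allI ballI impI)
    show "F x \<in> affine_space m" for x by (simp add: F_def affine_space_def)
    show "(\<lambda>x. F x i) \<in> poly_fun" for i
      using g_poly h_poly
      by (cases "i < m") (auto simp: F_def intro!: poly_fun_const poly_fun_diff poly_fun_cmult)
    fix P y assume P: "P \<in> poly_fun" "\<forall>x\<in>W. P (F x) = 0" and y: "y \<in> affine_space m"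
    show "P y = 0"
    proof (rule poly_fun_vanishing_on_rescaling[OF subspace_affine_space q_poly _ p0 _ P(1) _ y])
      show "(\<lambda>p. h (\<Phi> p)) \<in> rat_fun q" by (rule rat_map_poly_comp[OF q_poly \<Phi>_rat h_poly])
      show "h (\<Phi> p0) \<noteq> 0" by (rule h_\<Phi>[OF p0])
      show "P (h (\<Phi> p) *\<^sub>C (p - p0)) = 0" if "p \<in> affine_space m" "q p \<noteq> 0" for p
        using P(2) \<Phi>_in[OF that] F\<Phi>[OF that] by metis
    qed
  qed
qed

lemma mat_deriv_line:
  assumes "q p \<noteq> 0"
  shows "curve_deriv (\<lambda>t. \<Phi> (p + t *\<^sub>C v)) (mat_deriv \<Phi> p v)"
  using mat_deriv_curve[OF q_poly \<Phi>_rat _ curve_deriv_line[of p v]] assms by simp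

text \<open>If \<open>f\<close> vanishes on \<open>W\<close>, it vanishes along the image under
  \<open>\<Phi>\<close> of a line through \<open>p\<close>; the chain rule computes the derivative
  of this zero function.\<close>

lemma mat_deriv_tangent:
  assumes p: "p \<in> affine_space m" "q p \<noteq> 0" and v: "v \<in> affine_space m"
  shows "mat_deriv \<Phi> p v \<in> tangent_space W (\<Phi> p)"
  unfolding tangent_space_dir_deriv
proof (intro CollectI ballI impI)
  fix f :: "complex^'n^'n \<Rightarrow> complex" assume f: "f \<in> poly_fun" "\<forall>x\<in>W. f x = 0"
  have "((\<lambda>t. f (\<Phi> (p + t *\<^sub>C v))) has_field_derivative dir_deriv f (\<Phi> p) (mat_deriv \<Phi> p v)) (at 0)"
    using poly_fun_curve_deriv[OF f(1) mat_deriv_line[OF p(2), of v]] by simp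
  moreover have "\<forall>\<^sub>F t in nhds 0. f (\<Phi> (p + t *\<^sub>C v)) = 0"
    using poly_fun_eventually_nonzero[of q p v, OF q_poly p(2)]
  proof eventually_elim
    case (elim t)
    have "p + t *\<^sub>C v \<in> affine_space m"
      using p(1) v subspace_affine_space
      by (intro complex_vector.subspace_add complex_vector.subspace_scale)
    then show ?case using f(2) \<Phi>_in elim by blast
  qed
  ultimately have "((\<lambda>t. 0) has_field_derivative dir_deriv f (\<Phi> p) (mat_deriv \<Phi> p v)) (at 0)"
    by (subst (asm) DERIV_cong_ev[OF refl _ refl])
  then show "dir_deriv f (\<Phi> p) (mat_deriv \<Phi> p v) = 0"
    using DERIV_unique DERIV_const by blast
qed

text \<open>Derivative of \<open>\<Psi> (\<Phi> p) = p\<close>: the differential of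
  \<open>\<Psi>\<close> is a left inverse of that of \<open>\<Phi>\<close> on affine
  \<open>m\<close>-space.\<close>

lemma \<Psi>_mat_deriv:
  assumes p: "p \<in> affine_space m" "q p \<noteq> 0" and v: "v \<in> affine_space m"
  shows "dir_deriv (\<lambda>Z. \<Psi> Z k) (\<Phi> p) (mat_deriv \<Phi> p v) = v k"
proof -
  have "((\<lambda>t. \<Psi> (\<Phi> (p + t *\<^sub>C v)) k) has_field_derivative
      dir_deriv (\<lambda>Z. \<Psi> Z k) (\<Phi> (p + 0 *\<^sub>C v)) (mat_deriv \<Phi> p v)) (at 0)"
    using h_\<Phi>[OF p] by (intro rat_fun_curve_deriv[OF h_poly \<Psi>_coord_rat _ mat_deriv_line[OF p(2)]]) simp
  moreover have "\<forall>\<^sub>F t in nhds 0. \<Psi> (\<Phi> (p + t *\<^sub>C v)) k = p k + t * v k"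
    using poly_fun_eventually_nonzero[of q p v, OF q_poly p(2)]
  proof eventually_elim
    case (elim t)
    have "p + t *\<^sub>C v \<in> affine_space m"
      using p(1) v subspace_affine_space
      by (intro complex_vector.subspace_add complex_vector.subspace_scale)
    then show ?case using \<Psi>_\<Phi> elim by simp
  qed
  ultimately have "((\<lambda>t. p k + t * v k) has_field_derivative
      dir_deriv (\<lambda>Z. \<Psi> Z k) (\<Phi> p) (mat_deriv \<Phi> p v)) (at 0)"
    by (subst (asm) DERIV_cong_ev[OF refl _ refl]) auto
  moreover have "((\<lambda>t. p k + t * v k) has_field_derivative v k) (at 0)"
    by (auto intro!: derivative_eq_intros)
  ultimately show ?thesis by (rule DERIV_unique)
qed

text \<open>The function \<open>l \<circ> \<Phi> \<circ> \<Psi> - l\<close> vanishes on \<open>W\<close>, so its derivative vanishes on tangent vectors.\<close>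

lemma tangent_mat_deriv:
  assumes p: "p \<in> affine_space m" "q p \<noteq> 0" and A: "A \<in> tangent_space W (\<Phi> p)"
  obtains v where "v \<in> affine_space m" "A = mat_deriv \<Phi> p v"
proof -
  let ?Z = "\<Phi> p"
  \<comment> \<open>The candidate preimage is the image of \<open>A\<close> under the differential
    of \<open>\<Psi>\<close>.\<close>
  define v where "v = (\<lambda>k. dir_deriv (\<lambda>Z. \<Psi> Z k) ?Z A)"
  have v: "v \<in> affine_space m"
    unfolding affine_space_def v_def by (auto simp: \<Psi>_def)
  let ?\<delta> = "\<lambda>t. \<Psi> (?Z + t *\<^sub>C A)"
  have \<delta>0: "?\<delta> 0 = p" using \<Psi>_\<Phi>[OF p] by simp
  have \<delta>: "curve_deriv ?\<delta> v"
    unfolding curve_deriv_def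
  proof (intro allI impI)
    fix l :: "(nat \<Rightarrow> complex) \<Rightarrow> complex" assume l: "clinear l"
    have "((\<lambda>t. \<Sum>k<m. ?\<delta> t k * l (unit_seq k)) has_field_derivative (\<Sum>k<m. v k * l (unit_seq k))) (at 0)"
      unfolding v_def
      by (intro DERIV_sum DERIV_cmult_right rat_fun_has_deriv[OF h_poly \<Psi>_coord_rat h_\<Phi>[OF p]])
    then show "((\<lambda>t. l (?\<delta> t)) has_field_derivative l v) (at 0)"
      using clinear_affine_space[OF l \<Psi>_affine] clinear_affine_space[OF l v]
      by (simp add: scaleC_complex_def)
  qed
  obtain s c where s: "s \<in> poly_fun" "\<And>Z. h Z \<noteq> 0 \<Longrightarrow> s Z = h Z ^ c * q (\<Psi> Z)"
    and cmp: "\<And>f. f \<in> rat_fun q \<Longrightarrow> (\<lambda>Z. f (\<Psi> Z)) \<in> rat_fun (\<lambda>Z. h Z * s Z)"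
    by (rule rat_map_rat_comp[OF h_poly \<Psi>_rat q_poly]) (rule that)
  let ?H = "\<lambda>Z. h Z * s Z"
  have H: "?H \<in> poly_fun" using h_poly s(1) by (rule poly_fun_mult)
  have H\<Phi>: "?H (\<Phi> p') \<noteq> 0" if "p' \<in> affine_space m" "q p' \<noteq> 0" for p'
    using h_\<Phi>[OF that] s(2)[OF h_\<Phi>[OF that]] \<Psi>_\<Phi>[OF that] that by simp
  have "mat_deriv \<Phi> p v = A"
  proof (rule clinear_functional_separates)
    fix l :: "complex^'n^'n \<Rightarrow> complex" assume l: "clinear l"
    let ?w = "\<lambda>Z. l (\<Phi> (\<Psi> Z)) - l Z"
    have w: "?w \<in> rat_fun ?H"
      using \<Phi>_rat l by (intro rat_fun_diff[OF H cmp[of "\<lambda>x. l (\<Phi> x)"] rat_fun_poly[OF poly_fun_linear[OF l]]])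
          (simp add: rat_map_def)
    then obtain k r where r: "r \<in> poly_fun" "\<And>Z. ?H Z \<noteq> 0 \<Longrightarrow> ?H Z ^ k * ?w Z = r Z"
      by (metis (no_types, lifting) rat_funE)
    have "r (\<Phi> p') = 0" if "p' \<in> affine_space m" "q p' \<noteq> 0" for p'
      using r(2)[OF H\<Phi>[OF that], symmetric] \<Psi>_\<Phi>[OF that] by simp
    then have "\<forall>x\<in>W. r x = 0" using dense[OF r(1)] by blast
    then have "dir_deriv r ?Z A = 0" using A r(1) unfolding tangent_space_dir_deriv by blast
    moreover have "?w ?Z = 0" using \<Psi>_\<Phi>[OF p] by simp
    \<comment> \<open>\<open>r\<close> is \<open>?w\<close> times a power of \<open>?H\<close>; as
      \<open>?w\<close> vanishes at \<open>?Z\<close>, a vanishing derivative of \<open>r\<close>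
      passes to \<open>?w\<close>. Below, the chain rule evaluates this derivative a second
      time.\<close>
    ultimately have "dir_deriv ?w ?Z A = 0"
      using rat_fun_dir_deriv_formula[OF H w r H\<Phi>[OF p], of A] by simp
    then have "((\<lambda>t. ?w (?Z + t *\<^sub>C A)) has_field_derivative 0) (at 0)"
      using rat_fun_has_deriv[OF H w H\<Phi>[OF p], of A] by simp
    moreover have "curve_deriv (\<lambda>t. \<Phi> (?\<delta> t)) (mat_deriv \<Phi> p v)"
      using mat_deriv_curve[OF q_poly \<Phi>_rat _ \<delta>] p(2) \<delta>0 by simp
    then have "((\<lambda>t. ?w (?Z + t *\<^sub>C A)) has_field_derivative l (mat_deriv \<Phi> p v) - l A) (at 0)"
      using curve_deriv_line[of ?Z A] l unfolding curve_deriv_def by (intro DERIV_diff) auto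
    ultimately have "0 = l (mat_deriv \<Phi> p v) - l A" by (rule DERIV_unique)
    then show "l (mat_deriv \<Phi> p v) = l A" by simp
  qed
  with v that show thesis by blast
qed

text \<open>The differential of \<open>\<Phi>\<close> sends the unit vectors to a basis of the
  tangent space; the differentials of the coordinates of \<open>\<Psi>\<close> are dual to
  it.\<close>

lemma dim_tangent_space:
  assumes p: "p \<in> affine_space m" "q p \<noteq> 0"
  shows "complex_vector.dim (tangent_space W (\<Phi> p)) = m"
proof -
  let ?a = "\<lambda>k. mat_deriv \<Phi> p (unit_seq k)"
  let ?T = "tangent_space W (\<Phi> p)"
  let ?d = "\<lambda>k. dir_deriv (\<lambda>Z. \<Psi> Z k) (\<Phi> p)"
  have d: "?d k (?a i) = of_bool (k = i)" if "i < m" for i k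
    using \<Psi>_mat_deriv[OF p unit_seq_affine[OF that], of k] by (simp add: unit_seq_def)
  have inj: "inj_on ?a {..<m}"
  proof (rule inj_onI)
    fix i j assume ij: "i \<in> {..<m}" "j \<in> {..<m}" "?a i = ?a j"
    have "of_bool (i = j) = ?d i (?a j)" using d[of j i] ij(2) by simp
    also have "\<dots> = ?d i (?a i)" by (simp only: ij(3))
    also have "\<dots> = 1" using d[of i i] ij(1) by simp
    finally show "i = j" by simp
  qed
  have lin: "clinear (?d k)" for k
    by (rule dir_deriv_rat_linear[OF h_poly \<Psi>_coord_rat h_\<Phi>[OF p]])
  have lin\<Phi>: "clinear (mat_deriv \<Phi> p)" by (rule clinear_mat_deriv[of q \<Phi> p, OF q_poly \<Phi>_rat p(2)])
  have "complex_vector.independent (?a ` {..<m})"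
  proof
    assume "complex_vector.dependent (?a ` {..<m})"
    then obtain u where u: "\<exists>x\<in>?a ` {..<m}. u x \<noteq> 0" "(\<Sum>x\<in>?a ` {..<m}. u x *\<^sub>C x) = 0"
      by (subst (asm) complex_vector.dependent_finite) auto
    have z: "(\<Sum>i<m. u (?a i) *\<^sub>C ?a i) = 0" using u(2) by (simp add: sum.reindex[OF inj])
    have "u (?a k) = 0" if "k < m" for k
    proof -
      have "0 = ?d k (\<Sum>i<m. u (?a i) *\<^sub>C ?a i)" unfolding z using clinear_zero[OF lin] by simp
      also have "\<dots> = (\<Sum>i<m. u (?a i) * ?d k (?a i))"
        by (simp add: clinear_sum[OF lin] clinear_functional_scale[OF lin])
      also have "\<dots> = (\<Sum>i<m. if i = k then u (?a k) else 0)"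
        using d by (intro sum.cong) auto
      finally show ?thesis using that by simp
    qed
    with u(1) show False by auto
  qed
  moreover have "?a ` {..<m} \<subseteq> ?T" using mat_deriv_tangent[OF p] unit_seq_affine by auto
  moreover have "?T \<subseteq> complex_vector.span (?a ` {..<m})"
  proof
    fix A assume "A \<in> ?T"
    then obtain v where v: "v \<in> affine_space m" "A = mat_deriv \<Phi> p v"
      using tangent_mat_deriv[OF p] by blast
    have "A = (\<Sum>k<m. v k *\<^sub>C ?a k)"
      unfolding v(2) using arg_cong[OF affine_space_expand[OF v(1)], of "mat_deriv \<Phi> p"]
      by (simp add: clinear_sum[OF lin\<Phi>] clinear_scale[OF lin\<Phi>])
    also have "\<dots> \<in> complex_vector.span (?a ` {..<m})"
      by (intro complex_vector.span_sum complex_vector.span_scale complex_vector.span_base) auto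
    finally show "A \<in> complex_vector.span (?a ` {..<m})" .
  qed
  moreover have "card (?a ` {..<m}) = m" by (simp add: card_image[OF inj])
  ultimately show ?thesis by (intro complex_vector.dim_unique)
qed

lemma \<Phi>_nonsingular:
  "p \<in> affine_space m \<Longrightarrow> q p \<noteq> 0 \<Longrightarrow> \<Phi> p \<in> nonsingular_locus W"
  unfolding nonsingular_locus_def using \<Phi>_in dim_tangent_space variety_dim_eq by simp

end

section \<open>Normal vectors and the Bombieri--Weyl correspondence\<close>

lemma bw_form_expand: "bw_form A B = (\<Sum>i\<in>UNIV. \<Sum>j\<in>UNIV. A $ i $ j * B $ j $ i)"
  by (simp add: bw_form_def trace_def matrix_matrix_mult_def)

lemma clinear_bw_form: "clinear (bw_form A)"
  by (intro clinear_functionalI)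
    (simp_all add: bw_form_expand sum.distrib sum_distrib_left algebra_simps)

lemma sym_matrices_iff: "A \<in> sym_matrices \<longleftrightarrow> (\<forall>i j. A $ i $ j = A $ j $ i)"
  by (auto simp: sym_matrices_def transpose_def vec_eq_iff)

text \<open>Gradient for the trace form, which pairs the entry \<open>(i, j)\<close> with the entry
  \<open>(j, i)\<close>; hence the transposed unit matrix.\<close>

definition mat_grad :: "(complex^'n^'n \<Rightarrow> complex) \<Rightarrow> complex^'n^'n \<Rightarrow> complex^'n::finite^'n" where
  "mat_grad f Z = (\<chi> i j. dir_deriv f Z (mat_unit j i))"

lemma bw_form_mat_grad:
  assumes "f \<in> poly_fun"
  shows "bw_form (mat_grad f Z) A = dir_deriv f Z A"
proof -
  have "dir_deriv f Z A = (\<Sum>i\<in>UNIV. \<Sum>j\<in>UNIV. A $ i $ j * dir_deriv f Z (mat_unit i j))"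
    by (rule clinear_mat[OF dir_deriv_poly_linear[OF assms]])
  also have "\<dots> = (\<Sum>j\<in>UNIV. \<Sum>i\<in>UNIV. A $ i $ j * dir_deriv f Z (mat_unit i j))"
    by (rule sum.swap)
  finally show ?thesis by (simp add: bw_form_expand mat_grad_def mult.commute)
qed

lemma clinear_functional_separates_subspace:
  assumes S: "complex_vector.subspace S" and x: "x \<notin> S"
  obtains l :: "'a::complex_vector \<Rightarrow> complex" where "clinear l" "\<forall>s\<in>S. l s = 0" "l x = 1"
proof -
  obtain B where B: "B \<subseteq> S" "complex_vector.independent B" "S \<subseteq> complex_vector.span B"
    using complex_vector.maximal_independent_subset[of S] by blast
  then have "complex_vector.span B = S"
    using S by (metis complex_vector.span_subspace)
  with x have ind: "complex_vector.independent (insert x B)" and xB: "x \<notin> B"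
    using B by (auto simp: complex_vector.independent_insert complex_vector.span_base)
  obtain l :: "'a \<Rightarrow> complex" where l: "clinear l" "\<forall>v\<in>insert x B. l v = of_bool (v = x)"
    using clin.linear_independent_extend[OF ind, of "\<lambda>v. of_bool (v = x)"] by metis
  show thesis
  proof (rule that[OF l(1)])
    show "\<forall>s\<in>S. l s = 0"
    proof
      fix s assume "s \<in> S"
      then show "l s = 0"
        using clin.linear_eq_0_on_span[OF l(1), of B s] l(2) xB B(3) by (auto split: if_splits)
    qed
    show "l x = 1" using l(2) by simp
  qed
qed

text \<open>Double orthogonality: gradients at \<open>Z\<close> of equations of \<open>W\<close>
  form a subspace. A functional separating \<open>\<nu>\<close> from it is the trace pairing with
  some matrix \<open>A\<close>; vanishing on all gradients makes \<open>A\<close> tangent, yet it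
  pairs to 1 with \<open>\<nu>\<close>.\<close>

lemma normal_vector_is_gradient:
  fixes Z \<nu> :: "complex^'a::finite^'a"
  assumes \<nu>: "\<And>A. A \<in> tangent_space W Z \<Longrightarrow> bw_form \<nu> A = 0"
  obtains f where "f \<in> poly_fun" "\<And>x. x \<in> W \<Longrightarrow> f x = 0" "\<nu> = mat_grad f Z"
proof -
  let ?S = "{mat_grad f Z | f. f \<in> poly_fun \<and> (\<forall>x\<in>W. f x = 0)}"
  have "\<nu> \<in> ?S"
  proof (rule ccontr)
    assume notin: "\<nu> \<notin> ?S"
    have sub: "complex_vector.subspace ?S"
      unfolding complex_vector.subspace_def
    proof (intro conjI ballI allI)
      show "0 \<in> ?S"
        by (intro CollectI exI[of _ "\<lambda>_. 0"]) (simp add: mat_grad_def vec_eq_iff poly_fun_const)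
    next
      fix x y assume "x \<in> ?S" "y \<in> ?S"
      then obtain f g where "x = mat_grad f Z" "y = mat_grad g Z" "f \<in> poly_fun" "g \<in> poly_fun"
        "\<forall>x\<in>W. f x = 0" "\<forall>x\<in>W. g x = 0" by blast
      then show "x + y \<in> ?S"
        by (intro CollectI exI[of _ "\<lambda>x. f x + g x"])
          (simp add: mat_grad_def vec_eq_iff dir_deriv_add poly_fun_add)
    next
      fix c x assume "x \<in> ?S"
      then obtain f where "x = mat_grad f Z" "f \<in> poly_fun" "\<forall>x\<in>W. f x = 0" by blast
      then show "c *\<^sub>C x \<in> ?S"
        by (intro CollectI exI[of _ "\<lambda>x. c * f x"])
          (simp add: mat_grad_def vec_eq_iff dir_deriv_mult poly_fun_const poly_fun_cmult)
    qed
    obtain l :: "complex^'a^'a \<Rightarrow> complex" where l: "clinear l" "\<forall>s\<in>?S. l s = 0" "l \<nu> = 1"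
      using clinear_functional_separates_subspace[OF sub notin] by blast
    define A where "A = (\<chi> i j. l (mat_unit j i))"
    have lA: "l X = bw_form X A" for X
      by (subst clinear_mat[OF l(1)]) (simp add: bw_form_expand A_def)
    have "A \<in> tangent_space W Z"
      unfolding tangent_space_dir_deriv
    proof (intro CollectI ballI impI)
      fix f assume f: "f \<in> poly_fun" "\<forall>x\<in>W. f x = 0"
      then have "l (mat_grad f Z) = 0" by (intro bspec[OF l(2)]) blast
      then show "dir_deriv f Z A = 0" unfolding lA bw_form_mat_grad[OF f(1)] .
    qed
    then show False using \<nu> lA[of \<nu>] l(3) by simp
  qed
  with that show thesis by blast
qed

text \<open>The symmetry conditions are linear equations of \<open>W\<close>, so their differentials
  are the same conditions on tangent vectors.\<close>

lemma tangent_space_sym: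
  fixes W :: "(complex^'n::finite^'n) set"
  assumes "W \<subseteq> sym_matrices" "A \<in> tangent_space W Z"
  shows "A \<in> sym_matrices"
  unfolding sym_matrices_iff
proof (intro allI)
  fix i j
  let ?l = "\<lambda>Z::complex^'n^'n. Z $ i $ j - Z $ j $ i"
  have l: "clinear ?l" by (intro clinear_functionalI) (auto simp: algebra_simps)
  have "?l x = 0" if "x \<in> W" for x
    using subsetD[OF assms(1) that] by (simp add: sym_matrices_iff)
  then have "dir_deriv ?l Z A = 0"
    by (rule tangent_spaceD[OF assms(2) poly_fun_linear[OF l]])
  then show "A $ i $ j = A $ j $ i" by (simp add: dir_deriv_linear[OF l])
qed

text \<open>Gradients are formed in the space of all matrices and need not be symmetric; this
  projection does not change their pairing with symmetric matrices.\<close>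

definition sym_part :: "complex^'n^'n \<Rightarrow> complex^'n::finite^'n" where
  "sym_part A = (\<chi> i j. (A $ i $ j + A $ j $ i) / 2)"

lemma sym_part_sym: "sym_part A \<in> sym_matrices"
  by (simp add: sym_matrices_iff sym_part_def add.commute)

lemma sym_part_id: "A \<in> sym_matrices \<Longrightarrow> sym_part A = A"
  by (simp add: sym_matrices_iff sym_part_def vec_eq_iff)

lemma bw_form_sym_part:
  assumes "X \<in> sym_matrices"
  shows "bw_form (sym_part A) X = bw_form A X"
proof -
  have X: "X $ i $ j = X $ j $ i" for i j using assms by (simp add: sym_matrices_iff)
  have "bw_form (sym_part A) X = (\<Sum>i\<in>UNIV. \<Sum>j\<in>UNIV. A $ i $ j * X $ j $ i / 2 + A $ j $ i * X $ i $ j / 2)"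
  proof -
    have "(A $ i $ j + A $ j $ i) / 2 * X $ j $ i = A $ i $ j * X $ j $ i / 2 + A $ j $ i * X $ i $ j / 2" for i j
      by (simp add: X[of j i] field_simps)
    then show ?thesis by (simp only: bw_form_expand sym_part_def vec_lambda_beta)
  qed
  also have "\<dots> = bw_form A X / 2 + (\<Sum>i\<in>UNIV. \<Sum>j\<in>UNIV. A $ j $ i * X $ i $ j) / 2"
    by (simp add: sum.distrib bw_form_expand sum_divide_distrib)
  also have "(\<Sum>i\<in>UNIV. \<Sum>j\<in>UNIV. A $ j $ i * X $ i $ j) = bw_form A X"
    unfolding bw_form_expand by (rule sum.swap)
  finally show ?thesis by simp
qed

text \<open>Linear projection to the first \<open>m\<close> coordinates; it extracts the base point
  from a parameter sequence that carries additional coordinates.\<close>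

definition take_seq :: "nat \<Rightarrow> (nat \<Rightarrow> complex) \<Rightarrow> nat \<Rightarrow> complex" where
  "take_seq m y = (\<lambda>k. if k < m then y k else 0)"

lemma clinear_take_seq: "clinear (take_seq m)"
  by (intro clinearI) (auto simp: take_seq_def fun_eq_iff)

lemma take_seq_affine: "take_seq m y \<in> affine_space m"
  by (simp add: take_seq_def affine_space_def)

lemma clinear_fst: "clinear (fst :: 'a::complex_vector \<times> 'b::complex_vector \<Rightarrow> 'a)"
  by (intro clinearI) (auto simp: scaleC_prod_def)

lemma rat_map_Pair:
  fixes f :: "'a::complex_vector \<Rightarrow> 'b::complex_vector" and g :: "'a \<Rightarrow> 'c::complex_vector"
  assumes h: "h \<in> poly_fun" and f: "rat_map h f" and g: "rat_map h g"
  shows "rat_map h (\<lambda>x. (f x, g x))"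
  unfolding rat_map_def
proof (intro allI impI)
  fix l :: "'b \<times> 'c \<Rightarrow> complex" assume l: "clinear l"
  have "clinear (\<lambda>x. (x :: 'b, 0 :: 'c))" "clinear (\<lambda>y. (0 :: 'b, y :: 'c))"
    by (auto intro!: clinearI simp: scaleC_prod_def)
  then have "clinear (\<lambda>x. l (x, 0))" "clinear (\<lambda>y. l (0, y))"
    using clinear_compose[OF l] by blast+
  then have "(\<lambda>x. l (f x, 0) + l (0, g x)) \<in> rat_fun h"
    using f g unfolding rat_map_def by (intro rat_fun_add[OF h]) auto
  moreover have "l (f x, g x) = l (f x, 0) + l (0, g x)" for x
    using clinear_add[OF l, of "(f x, 0)" "(0, g x)"] by simp
  ultimately show "(\<lambda>x. l (f x, g x)) \<in> rat_fun h" by simp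
qed

lemma rat_map_mono: "rat_map h \<Phi> \<Longrightarrow> s \<in> poly_fun \<Longrightarrow> rat_map (\<lambda>x. h x * s x) \<Phi>"
  unfolding rat_map_def using rat_fun_mono by blast

lemma rat_map_comp_linear: "clinear L \<Longrightarrow> rat_map h \<Phi> \<Longrightarrow> rat_map (\<lambda>x. h (L x)) (\<lambda>x. \<Phi> (L x))"
  unfolding rat_map_def using rat_fun_comp_linear[of L] by blast

context rational_param
begin

text \<open>Were \<open>f (\<Phi> p)\<close> nonzero for some \<open>p\<close>, its numerator and
  \<open>q * r\<close> would have a common point of nonvanishing.\<close>

lemma dense_shrink:
  assumes r: "r \<in> poly_fun" "\<exists>p\<in>affine_space m. q p * r p \<noteq> 0"
    and f: "f \<in> poly_fun" "\<And>p. p \<in> affine_space m \<Longrightarrow> q p * r p \<noteq> 0 \<Longrightarrow> f (\<Phi> p) = 0" and x: "x \<in> W"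
  shows "f x = 0"
proof (rule dense[OF f(1) _ x], rule ccontr)
  fix p assume p: "p \<in> affine_space m" "q p \<noteq> 0" "f (\<Phi> p) \<noteq> 0"
  obtain k f' where f': "f' \<in> poly_fun" "\<And>x. q x \<noteq> 0 \<Longrightarrow> q x ^ k * f (\<Phi> x) = f' x"
    using rat_map_poly_comp[OF q_poly \<Phi>_rat f(1)] by (metis rat_funE)
  obtain p1 where p1: "p1 \<in> affine_space m" "q p1 * r p1 \<noteq> 0" using r by blast
  have "f' p \<noteq> 0" using p f'(2)[OF p(2), symmetric] by simp
  then obtain z where "z \<in> affine_space m" "f' z \<noteq> 0" "q z * r z \<noteq> 0"
    using subspace_poly_fun_mult_nonzero[OF subspace_affine_space, of f' p m "\<lambda>x. q x * r x" p1]
      f'(1) p(1) poly_fun_mult[OF q_poly r(1)] p1 by blast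
  then show False using f(2) f'(2)[of z] by simp
qed

text \<open>Normality becomes \<open>m\<close> linear equations, since the differential of
  \<open>\<Phi>\<close> maps affine \<open>m\<close>-space onto the tangent space.\<close>

lemma bw_form_tangent_iff:
  assumes p: "p \<in> affine_space m" "q p \<noteq> 0"
  shows "(\<forall>A\<in>tangent_space W (\<Phi> p). bw_form N A = 0) \<longleftrightarrow>
    (\<forall>k<m. bw_form N (mat_deriv \<Phi> p (unit_seq k)) = 0)"
proof (intro iffI ballI allI impI)
  fix k assume "\<forall>A\<in>tangent_space W (\<Phi> p). bw_form N A = 0" "k < m"
  then show "bw_form N (mat_deriv \<Phi> p (unit_seq k)) = 0"
    using mat_deriv_tangent[OF p unit_seq_affine] by blast
next
  fix A assume *: "\<forall>k<m. bw_form N (mat_deriv \<Phi> p (unit_seq k)) = 0"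
    and A: "A \<in> tangent_space W (\<Phi> p)"
  obtain v where v: "v \<in> affine_space m" "A = mat_deriv \<Phi> p v"
    using tangent_mat_deriv[OF p A] by blast
  have "clinear (\<lambda>v. bw_form N (mat_deriv \<Phi> p v))"
    by (rule clinear_compose[OF clinear_bw_form clinear_mat_deriv[of q \<Phi> p, OF q_poly \<Phi>_rat p(2)]])
  from clinear_affine_space[OF this v(1)] * show "bw_form N A = 0"
    unfolding v(2) by (simp add: scaleC_complex_def)
qed

text \<open>The pairs \<open>(Z, H)\<close> with \<open>Z = \<Phi> p\<close> form a vector bundle over the parameter space, trivialized by
  solving the normality equations.  Every other critical pair \<open>(Z\<^sub>0, H\<^sub>0)\<close> lies in its closure:
  \<open>Z\<^sub>0 - H\<^sub>0\<close> is the gradient at \<open>Z\<^sub>0\<close> of some \<open>f\<close> vanishing on \<open>W\<close>, and \<open>Z \<mapsto> (Z, Z - grad f Z)\<close>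
  maps \<open>W\<close> polynomially to pairs in normal position.\<close>

theorem rational_variety_critical_pairs:
  assumes sym: "W \<subseteq> sym_matrices"
  shows "rational_variety zariski regular
    (zariski closure_of {(Z, H). H \<in> sym_matrices \<and> bw_critical W H Z})"
proof -
  \<comment> \<open>The swapped indices come from the trace form: the unknown entry
    \<open>(i, j)\<close> meets the entry \<open>(j, i)\<close> of a tangent vector.\<close>
  define a where "a k = (\<lambda>(i, j) p. mat_deriv \<Phi> p (unit_seq k) $ j $ i)" for k
  \<comment> \<open>Symmetry of the unknown matrix is imposed by linear equations with constant
    coefficients, so one elimination handles normality and symmetry together.\<close>
  define s where "s = (\<lambda>(c :: 'n \<times> 'n) c' (p :: nat \<Rightarrow> complex).
    of_bool (c' = c) - of_bool (c' = (snd c, fst c)) :: complex)"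
  define S :: "('n \<times> 'n \<Rightarrow> (nat \<Rightarrow> complex) \<Rightarrow> complex) set" where "S = a ` {..<m} \<union> range s"
  have finS: "finite S" unfolding S_def by simp
  have ratS: "\<forall>c\<in>S. \<forall>i. c i \<in> rat_fun q"
  proof -
    have "a k c \<in> rat_fun q" for k c
      unfolding a_def mat_deriv_def
      using rat_fun_dir_deriv[OF q_poly rat_map_mat_entry[OF \<Phi>_rat]] by (cases c) simp
    moreover have "s c c' \<in> rat_fun q" for c c' unfolding s_def by (rule rat_fun_const)
    ultimately show ?thesis unfolding S_def by auto
  qed
  from rational_linear_system[OF finS ratS q_poly subspace_affine_space nonempty]
  obtain r J b where r: "r \<in> poly_fun" "\<exists>p\<in>affine_space m. q p * r p \<noteq> 0"
    and b: "\<forall>i j. b i j \<in> rat_fun (\<lambda>x. q x * r x)"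
    and sol: "\<forall>p\<in>affine_space m. q p * r p \<noteq> 0 \<longrightarrow>
      (\<forall>i\<in>J. \<forall>j\<in>J. b i j p = of_bool (i = j)) \<and>
      (\<forall>\<nu>. (\<forall>a\<in>S. (\<Sum>i\<in>UNIV. a i p * \<nu> i) = 0) \<longleftrightarrow> (\<forall>i. \<nu> i = (\<Sum>j\<in>J. b i j p * \<nu> j)))"
    by (elim exE conjE) (rule that)
  have sol\<delta>: "b i j p = of_bool (i = j)"
    if "p \<in> affine_space m" "q p * r p \<noteq> 0" "i \<in> J" "j \<in> J" for p i j
    using sol that by blast
  have sol_iff: "(\<forall>a\<in>S. (\<Sum>i\<in>UNIV. a i p * \<nu> i) = 0) \<longleftrightarrow> (\<forall>i. \<nu> i = (\<Sum>j\<in>J. b i j p * \<nu> j))"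
    if "p \<in> affine_space m" "q p * r p \<noteq> 0" for p \<nu>
    using sol that by blast
  let ?Q = "\<lambda>p. q p * r p"
  have Q_poly: "?Q \<in> poly_fun" using q_poly r(1) by (rule poly_fun_mult)
  have normal: "N \<in> sym_matrices \<and> (\<forall>A\<in>tangent_space W (\<Phi> p). bw_form N A = 0) \<longleftrightarrow>
      (\<forall>i j. N $ i $ j = (\<Sum>c\<in>J. b (i, j) c p * N $ fst c $ snd c))"
    if p: "p \<in> affine_space m" "?Q p \<noteq> 0" for N p
  proof -
    let ?\<nu> = "\<lambda>c. N $ fst c $ snd c"
    have "(\<Sum>c\<in>UNIV. a k c p * ?\<nu> c) = bw_form N (mat_deriv \<Phi> p (unit_seq k))" for k
      unfolding bw_form_expand a_def UNIV_Times_UNIV[symmetric] sum.cartesian_product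
      by (intro sum.cong) (auto simp: mult.commute)
    moreover have "(\<Sum>c\<in>UNIV. s c0 c p * ?\<nu> c) = ?\<nu> c0 - ?\<nu> (snd c0, fst c0)" for c0
    proof -
      have "(\<Sum>c\<in>UNIV. s c0 c p * ?\<nu> c) = (\<Sum>c\<in>UNIV. if c = c0 then ?\<nu> c else 0)
         - (\<Sum>c\<in>UNIV. if c = (snd c0, fst c0) then ?\<nu> c else 0)"
        unfolding sum_subtractf[symmetric] s_def by (intro sum.cong) auto
      then show ?thesis by simp
    qed
    ultimately have 1: "(\<forall>c\<in>S. (\<Sum>i\<in>UNIV. c i p * ?\<nu> i) = 0) \<longleftrightarrow>
      (\<forall>k<m. bw_form N (mat_deriv \<Phi> p (unit_seq k)) = 0) \<and> N \<in> sym_matrices"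
      unfolding S_def sym_matrices_iff by (auto simp: ball_Un)
    have 2: "(\<forall>A\<in>tangent_space W (\<Phi> p). bw_form N A = 0) \<longleftrightarrow>
      (\<forall>k<m. bw_form N (mat_deriv \<Phi> p (unit_seq k)) = 0)"
      using p by (intro bw_form_tangent_iff) auto
    have 3: "(\<forall>c. ?\<nu> c = (\<Sum>j\<in>J. b c j p * ?\<nu> j)) \<longleftrightarrow>
      (\<forall>i j. N $ i $ j = (\<Sum>c\<in>J. b (i, j) c p * N $ fst c $ snd c))"
      by (simp only: split_paired_All fst_conv snd_conv)
    show ?thesis
      unfolding 3[symmetric] sol_iff[OF p, of ?\<nu>, symmetric] 1 2 by (rule conj_commute)
  qed
  obtain idx where idx: "bij_betw idx J {..<card J}"
    using ex_bij_betw_finite_nat[of J] by (auto simp: atLeast0LessThan)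
  let ?e = "m + card J"
  let ?c = "\<lambda>k. inv_into J idx (k - m)"
  have c: "?c k \<in> J \<and> m + idx (?c k) = k" if "m \<le> k" "k < ?e" for k
  proof -
    have "k - m \<in> idx ` J" using idx that by (auto simp: bij_betw_def)
    then show ?thesis using that by (simp add: inv_into_into f_inv_into_f)
  qed
  have idx_less: "idx c < card J" if "c \<in> J" for c using idx that by (auto simp: bij_betw_def)
  define N where "N y = (\<chi> i j. \<Sum>c\<in>J. b (i, j) c (take_seq m y) * y (m + idx c))" for y
  \<comment> \<open>The last \<open>card J\<close> coordinates of \<open>y\<close> are the free
    entries of the normal matrix \<open>N y = Z - H\<close>.\<close>
  define \<Theta> where "\<Theta> y = (\<Phi> (take_seq m y), \<Phi> (take_seq m y) - N y)" for y
  let ?q = "\<lambda>y. ?Q (take_seq m y)"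
  define A where "A = {y \<in> affine_space ?e. ?q y \<noteq> 0}"
  \<comment> \<open>The base point is recovered from \<open>Z\<close> alone and the fibre
    coordinates from the free entries of \<open>Z - H\<close>.\<close>
  define \<Xi> where "\<Xi> X = (\<lambda>k. if k < m then \<Psi> (fst X) k
      else if k < ?e then (fst X - snd X) $ fst (?c k) $ snd (?c k) else 0)" for X
  let ?h = "\<lambda>X :: (complex^'n^'n) \<times> (complex^'n^'n). h (fst X)"
  have q: "?q \<in> poly_fun" by (rule poly_fun_comp_linear[OF clinear_take_seq Q_poly])
  have h: "?h \<in> poly_fun" by (rule poly_fun_comp_linear[OF clinear_fst h_poly])
  have AD: "take_seq m y \<in> affine_space m" "?Q (take_seq m y) \<noteq> 0" "q (take_seq m y) \<noteq> 0"
    if "y \<in> A" for y using that unfolding A_def by (auto intro: take_seq_affine)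
  have NJ: "N y $ fst c $ snd c = y (m + idx c)" if "y \<in> A" "c \<in> J" for y c
  proof -
    have "N y $ fst c $ snd c = (\<Sum>c'\<in>J. if c' = c then y (m + idx c') else 0)"
      unfolding N_def using sol\<delta>[OF AD(1,2)[OF that(1)] that(2)] by (auto intro!: sum.cong)
    then show ?thesis using that(2) by simp
  qed
  have "rational_variety zariski regular (zariski closure_of (\<Theta> ` A))"
  proof (rule rational_variety_closure_of_param[OF q h _ _ A_def])
    have \<Phi>': "rat_map ?q (\<lambda>y. \<Phi> (take_seq m y))"
      by (rule rat_map_comp_linear[OF clinear_take_seq rat_map_mono[OF \<Phi>_rat r(1)]])
    have "(\<lambda>y. \<Phi> (take_seq m y) $ i $ j - N y $ i $ j) \<in> rat_fun ?q" for i j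
      unfolding N_def using b
      by (auto intro!: rat_fun_diff[OF q] rat_map_mat_entry[OF \<Phi>'] rat_fun_sum[OF q] rat_fun_mult
          rat_fun_comp_linear[OF clinear_take_seq, of "b _ _"] rat_fun_poly[OF poly_fun_coord])
    then show "rat_map ?q \<Theta>"
      unfolding \<Theta>_def by (intro rat_map_Pair[OF q \<Phi>'] rat_map_matI[OF q]) simp
    show aff: "\<Xi> X \<in> affine_space ?e" for X by (simp add: \<Xi>_def affine_space_def)
    have lin: "clinear (\<lambda>X :: (complex^'n^'n) \<times> (complex^'n^'n). (fst X - snd X) $ i $ j)" for i j
      by (intro clinear_functionalI) (auto simp: scaleC_prod_def algebra_simps)
    show "rat_map ?h \<Xi>"
    proof (rule rat_map_seqI[OF h aff])
      fix k assume "k < ?e"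
      then show "(\<lambda>X. \<Xi> X k) \<in> rat_fun ?h"
        using rat_fun_comp_linear[OF clinear_fst \<Psi>_coord_rat] rat_fun_poly[OF poly_fun_linear[OF lin]]
        unfolding \<Xi>_def by (cases "k < m") simp_all
    qed
    obtain p1 where p1: "p1 \<in> affine_space m" "?Q p1 \<noteq> 0" using r by blast
    then have "take_seq m p1 = p1" by (auto simp: take_seq_def affine_space_def fun_eq_iff)
    with p1 have "p1 \<in> A" unfolding A_def by (auto simp: affine_space_def)
    then show "A \<noteq> {}" by blast
    fix y assume y: "y \<in> A"
    show "?h (\<Theta> y) \<noteq> 0" using h_\<Phi>[OF AD(1,3)[OF y]] by (simp add: \<Theta>_def)
    have "\<Xi> (\<Theta> y) k = y k" for k
    proof -
      consider "k < m" | "m \<le> k" "k < ?e" | "?e \<le> k" by linarith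
      then show ?thesis
      proof cases
        case 1
        then show ?thesis using \<Psi>_\<Phi>[OF AD(1,3)[OF y]] by (simp add: \<Xi>_def \<Theta>_def take_seq_def)
      next
        case 2
        then show ?thesis using NJ[OF y] c[OF 2] by (simp add: \<Xi>_def \<Theta>_def)
      next
        case 3
        then show ?thesis using y by (simp add: \<Xi>_def A_def affine_space_def)
      qed
    qed
    then show "\<Xi> (\<Theta> y) = y" by blast
  qed
  moreover have "zariski closure_of (\<Theta> ` A) = zariski closure_of {(Z, H). H \<in> sym_matrices \<and> bw_critical W H Z}"
    (is "_ = zariski closure_of ?C")
  proof
    have "\<Theta> y \<in> ?C" if y: "y \<in> A" for y
    proof -
      let ?p = "take_seq m y"
      have "N y $ i $ j = (\<Sum>c\<in>J. b (i, j) c ?p * N y $ fst c $ snd c)" for i j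
        using NJ[OF y] by (simp add: N_def)
      then have Ny: "N y \<in> sym_matrices" "\<forall>A\<in>tangent_space W (\<Phi> ?p). bw_form (N y) A = 0"
        using normal[OF AD(1,2)[OF y]] by blast+
      moreover have "\<Phi> ?p \<in> sym_matrices" using \<Phi>_in[OF AD(1,3)[OF y]] sym by blast
      ultimately show ?thesis
        using \<Phi>_nonsingular[OF AD(1,3)[OF y]] unfolding \<Theta>_def bw_critical_def
        by (simp add: sym_matrices_iff)
    qed
    then show "zariski closure_of (\<Theta> ` A) \<subseteq> zariski closure_of ?C"
      by (intro closure_of_mono image_subsetI)
    have "X \<in> zariski closure_of (\<Theta> ` A)" if "X \<in> ?C" for X
    proof -
      obtain Z0 H0 where X: "X = (Z0, H0)" "H0 \<in> sym_matrices" "Z0 \<in> W"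
        "\<And>B. B \<in> tangent_space W Z0 \<Longrightarrow> bw_form (Z0 - H0) B = 0"
        using \<open>X \<in> ?C\<close> unfolding bw_critical_def nonsingular_locus_def by blast
      obtain f where f: "f \<in> poly_fun" "\<And>x. x \<in> W \<Longrightarrow> f x = 0" "Z0 - H0 = mat_grad f Z0"
        using normal_vector_is_gradient[OF X(4)] by blast
      \<comment> \<open>Symmetrizing keeps \<open>H = Z - ?S Z\<close> symmetric at every point of
        \<open>W\<close>, and changes nothing at \<open>Z0\<close>, where the gradient is already
        symmetric.\<close>
      let ?S = "\<lambda>Z. sym_part (mat_grad f Z)"
      have "Z0 - H0 \<in> sym_matrices" using X sym by (auto simp: sym_matrices_iff subset_iff)
      then have S0: "Z0 - ?S Z0 = H0" using f(3) sym_part_id by (metis diff_diff_eq2 add_diff_cancel_left')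
      show ?thesis
        unfolding zariski_closure_iff
      proof (intro ballI impI)
        fix F :: "(complex^'n^'n) \<times> (complex^'n^'n) \<Rightarrow> complex"
        assume F: "F \<in> poly_fun" "\<forall>y\<in>\<Theta> ` A. F y = 0"
        have "(\<lambda>Z. F (Z, Z - ?S Z)) \<in> poly_fun"
        proof (rule rat_fun_one_poly, rule rat_map_poly_comp[OF poly_fun_const _ F(1)],
            intro rat_map_Pair rat_map_matI poly_fun_const)
          fix i j
          have e: "(\<lambda>Z::complex^'n^'n. Z $ i $ j) \<in> poly_fun" by (intro poly_fun_linear clinear_mat_entry)
          show "(\<lambda>Z::complex^'n^'n. Z $ i $ j) \<in> rat_fun (\<lambda>_. 1)" using e by (rule rat_fun_poly)
          have "(\<lambda>Z. Z $ i $ j - (1/2) * (dir_deriv f Z (mat_unit j i) + dir_deriv f Z (mat_unit i j))) \<in> poly_fun"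
            by (intro poly_fun_diff e poly_fun_cmult poly_fun_add poly_fun_dir_deriv f(1))
          then show "(\<lambda>Z. (Z - ?S Z) $ i $ j) \<in> rat_fun (\<lambda>_. 1)"
            by (intro rat_fun_poly) (simp add: sym_part_def mat_grad_def)
        qed
        moreover have "F (\<Phi> p, \<Phi> p - ?S (\<Phi> p)) = 0" if p: "p \<in> affine_space m" "?Q p \<noteq> 0" for p
        proof -
          let ?M = "?S (\<Phi> p)"
          have "bw_form ?M B = 0" if B: "B \<in> tangent_space W (\<Phi> p)" for B
          proof -
            have "bw_form ?M B = dir_deriv f (\<Phi> p) B"
              using bw_form_sym_part[OF tangent_space_sym[OF sym B]] bw_form_mat_grad[OF f(1)] by simp
            then show ?thesis using tangent_spaceD[OF B f(1,2)] by simp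
          qed
          then have M: "?M $ i $ j = (\<Sum>c\<in>J. b (i, j) c p * ?M $ fst c $ snd c)" for i j
            using normal[OF p, of ?M] sym_part_sym by blast
          \<comment> \<open>The parameter of the pair at hand: \<open>p\<close> followed by the free
            entries of \<open>?M\<close>. The elimination then determines the remaining
            entries.\<close>
          define y where "y = (\<lambda>k. if k < m then p k else
             if k < ?e then ?M $ fst (?c k) $ snd (?c k) else 0)"
          have yp: "take_seq m y = p"
            using p(1) by (auto simp: take_seq_def y_def affine_space_def fun_eq_iff)
          have yc: "y (m + idx c) = ?M $ fst c $ snd c" if "c \<in> J" for c
            using that idx_less[OF that] idx by (simp add: y_def bij_betw_def inv_into_f_f)
          have "N y $ i $ j = ?M $ i $ j" for i j
          proof -
            have "N y $ i $ j = (\<Sum>c\<in>J. b (i, j) c p * ?M $ fst c $ snd c)"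
              unfolding N_def yp by (simp add: yc)
            also have "\<dots> = ?M $ i $ j" by (rule M[symmetric])
            finally show ?thesis .
          qed
          then have "N y = ?M" by (simp only: vec_eq_iff) blast
          then have "\<Theta> y = (\<Phi> p, \<Phi> p - ?M)" unfolding \<Theta>_def yp by simp
          moreover have "y \<in> A" using p yp unfolding A_def by (auto simp: y_def affine_space_def)
          ultimately show ?thesis using F(2) by (metis imageI)
        qed
        ultimately have "F (Z0, Z0 - ?S Z0) = 0"
          using X(3) by (rule dense_shrink[OF r, of "\<lambda>Z. F (Z, Z - ?S Z)"])
        then show "F X = 0" unfolding S0 X(1) .
      qed
    qed
    then show "zariski closure_of ?C \<subseteq> zariski closure_of (\<Theta> ` A)"
      by (intro closure_of_minimal) auto
  qed
  ultimately show ?thesis by simp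
qed

end

section \<open>Parametrizing the affine cone over the Veronese image\<close>

lemma homogeneous_poly_add:
  "homogeneous_poly d f \<Longrightarrow> homogeneous_poly d g \<Longrightarrow> homogeneous_poly d (\<lambda>x. f x + g x)"
  by (auto simp: homogeneous_poly_def distrib_left intro: poly_fun_add)

lemma homogeneous_poly_zero: "homogeneous_poly d (\<lambda>_. 0)"
  by (simp add: homogeneous_poly_def poly_fun_const)

lemma homogeneous_poly_sum:
  "(\<And>i. i \<in> I \<Longrightarrow> homogeneous_poly d (f i)) \<Longrightarrow> homogeneous_poly d (\<lambda>x. \<Sum>i\<in>I. f i x)"
  by (induction I rule: infinite_finite_induct) (simp_all add: homogeneous_poly_add homogeneous_poly_zero)

lemma homogeneous_poly_linear: "clinear l \<Longrightarrow> homogeneous_poly 1 l"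
  by (simp add: homogeneous_poly_def poly_fun_linear clinear_functional_scale)

text \<open>The component of degree \<open>k\<close> is the coefficient of \<open>t ^ k\<close> in
  \<open>f (t *\<^sub>C x)\<close>, which avoids expanding \<open>f\<close> into monomials. Products
  of components of degrees \<open>i\<close> and \<open>k - i\<close> give the multiplication
  case.\<close>

lemma poly_fun_homogeneous_components:
  assumes "f \<in> poly_fun"
  shows "\<exists>P. (\<forall>k. homogeneous_poly k (\<lambda>x. coeff (P x) k)) \<and> (\<forall>x t. poly (P x) t = f (t *\<^sub>C x))"
  using assms
proof induction
  case (poly_fun_const c)
  have hom: "homogeneous_poly k (\<lambda>x::'a. coeff [:c:] k)" for k
    by (cases k) (auto simp: homogeneous_poly_def intro: poly_fun.poly_fun_const)
  show ?case by (intro exI[of _ "\<lambda>_. [:c:]"] conjI allI hom) simp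
next
  case (poly_fun_linear l)
  have hom: "homogeneous_poly k (\<lambda>x. coeff [:0, l x:] k)" for k
  proof (cases "k = 1")
    case True
    then show ?thesis using homogeneous_poly_linear[OF poly_fun_linear] by simp
  next
    case False
    then have "(\<lambda>x. coeff [:0, l x:] k) = (\<lambda>_. 0)"
      by (auto simp: fun_eq_iff coeff_pCons split: nat.split)
    then show ?thesis by (simp add: homogeneous_poly_zero)
  qed
  show ?case
    by (intro exI[of _ "\<lambda>x. [:0, l x:]"] conjI allI hom)
      (simp add: clinear_functional_scale[OF poly_fun_linear])
next
  case (poly_fun_add f g)
  then obtain P Q where "\<forall>k. homogeneous_poly k (\<lambda>x. coeff (P x) k)" "\<forall>x t. poly (P x) t = f (t *\<^sub>C x)"
    "\<forall>k. homogeneous_poly k (\<lambda>x. coeff (Q x) k)" "\<forall>x t. poly (Q x) t = g (t *\<^sub>C x)" by blast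
  then show ?case by (intro exI[of _ "\<lambda>x. P x + Q x"]) (simp add: homogeneous_poly_add)
next
  case (poly_fun_mult f g)
  then obtain P Q where P: "\<forall>k. homogeneous_poly k (\<lambda>x. coeff (P x) k)" "\<forall>x t. poly (P x) t = f (t *\<^sub>C x)"
    and Q: "\<forall>k. homogeneous_poly k (\<lambda>x. coeff (Q x) k)" "\<forall>x t. poly (Q x) t = g (t *\<^sub>C x)" by blast
  have "homogeneous_poly k (\<lambda>x. coeff (P x * Q x) k)" for k
    unfolding coeff_mult
  proof (rule homogeneous_poly_sum)
    fix i assume "i \<in> {..k}"
    then show "homogeneous_poly k (\<lambda>x. coeff (P x) i * coeff (Q x) (k - i))"
      using homogeneous_poly_mult[OF P(1)[rule_format, of i] Q(1)[rule_format, of "k - i"]] by simp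
  qed
  then show ?case using P Q by (intro exI[of _ "\<lambda>x. P x * Q x"]) simp
qed

section \<open>Projective Zariski topology, lines and the affine cone\<close>

lemma topspace_proj_zariski: "topspace (proj_zariski :: 'a::complex_vector set topology) = proj_space"
proof -
  have "openin proj_zariski (proj_space :: 'a set set)"
    unfolding openin_proj_zariski
  proof (intro exI conjI)
    show "\<forall>f\<in>{\<lambda>_ :: 'a. 1}. \<exists>d. homogeneous_poly d f"
      by (auto simp: homogeneous_poly_def poly_fun_const intro: exI[of _ 0])
    show "proj_space = {L::'a set. L \<in> proj_space \<and> (\<exists>f\<in>{\<lambda>_. 1 :: complex}. \<exists>v\<in>L. f v \<noteq> 0)}"
      by (auto simp: proj_space_def intro: complex_vector.span_zero)
  qed
  moreover have "U \<subseteq> proj_space" if "openin proj_zariski U" for U :: "'a set set"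
    using that unfolding openin_proj_zariski by blast
  ultimately show ?thesis unfolding topspace_def by blast
qed

lemma openin_proj_zariski_basic:
  "homogeneous_poly d f \<Longrightarrow> openin proj_zariski {L \<in> proj_space. \<exists>v\<in>L. f v \<noteq> 0}"
  unfolding openin_proj_zariski by (intro exI[of _ "{f}"]) auto

lemma closedin_proj_zariski_basic:
  assumes "homogeneous_poly d f"
  shows "closedin proj_zariski {L \<in> proj_space. \<forall>v\<in>L. f v = 0}"
proof -
  have "proj_space - {L \<in> proj_space. \<forall>v\<in>L. f v = 0} = {L \<in> proj_space. \<exists>v\<in>L. f v \<noteq> 0}" by auto
  then show ?thesis
    using openin_proj_zariski_basic[OF assms] by (simp add: closedin_def topspace_proj_zariski)
qed

lemma proj_space_line:
  assumes "L \<in> proj_space" "v \<in> L" "v \<noteq> 0"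
  shows "L = range (\<lambda>c. c *\<^sub>C v)"
proof -
  obtain u where u: "L = range (\<lambda>c. c *\<^sub>C u)"
    using assms(1) by (auto simp: proj_space_def complex_vector.span_singleton)
  with assms obtain a where a: "v = a *\<^sub>C u" "a \<noteq> 0" by auto
  show ?thesis
  proof
    show "L \<subseteq> range (\<lambda>c. c *\<^sub>C v)"
    proof
      fix w assume "w \<in> L"
      then obtain c where "w = c *\<^sub>C u" using u by blast
      then have "w = (c / a) *\<^sub>C v" using a by (simp add: scaleC_scaleC)
      then show "w \<in> range (\<lambda>c. c *\<^sub>C v)" by blast
    qed
    show "range (\<lambda>c. c *\<^sub>C v) \<subseteq> L" unfolding u a(1) by (auto simp: scaleC_scaleC)
  qed
qed

lemma proj_space_nonzero: "L \<in> proj_space \<Longrightarrow> \<exists>v\<in>L. v \<noteq> 0"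
  by (auto simp: proj_space_def intro: complex_vector.span_base)

lemma proj_space_scale: "L \<in> proj_space \<Longrightarrow> v \<in> L \<Longrightarrow> c *\<^sub>C v \<in> L"
  by (auto simp: proj_space_def intro: complex_vector.span_scale)

lemma outer_square_scale: "outer_square (c *\<^sub>C v) = c\<^sup>2 *\<^sub>C outer_square v"
  by (simp add: outer_square_def vec_eq_iff power2_eq_square)

text \<open>A scalar \<open>c\<close> is absorbed into the vector as \<open>csqrt c\<close>. The
  cone point is the outer square of 0, which lies on every line of the nonempty
  \<open>V\<close>.\<close>

lemma affine_cone_veronese2:
  fixes V :: "(complex^'n::finite) set set"
  assumes "V \<subseteq> proj_space" "V \<noteq> {}"
  shows "affine_cone (veronese2 ` V) = {outer_square v | v L. L \<in> V \<and> v \<in> L}"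
proof (intro equalityI subsetI)
  fix Z assume "Z \<in> affine_cone (veronese2 ` V)"
  then consider "Z = 0" | L where "L \<in> V" "Z \<in> complex_vector.span (outer_square ` L)"
    by (auto simp: affine_cone_def veronese2_def)
  then show "Z \<in> {outer_square v | v L. L \<in> V \<and> v \<in> L}"
  proof cases
    case 1
    obtain L where L: "L \<in> V" using assms by blast
    then have "0 \<in> L" using assms by (auto simp: proj_space_def complex_vector.span_zero)
    moreover have "Z = outer_square 0" using 1 by (simp add: outer_square_def vec_eq_iff)
    ultimately show ?thesis using L by blast
  next
    case 2
    then have LP: "L \<in> proj_space" using assms by blast
    then obtain u where u: "u \<in> L" "u \<noteq> 0" using proj_space_nonzero by blast
    have "outer_square ` L \<subseteq> complex_vector.span {outer_square u}"
      unfolding proj_space_line[OF LP u]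
      by (auto simp: outer_square_scale complex_vector.span_singleton)
    then have "Z \<in> complex_vector.span {outer_square u}"
      using 2(2) complex_vector.span_minimal[OF _ complex_vector.subspace_span] by blast
    then obtain c where "Z = c *\<^sub>C outer_square u" by (auto simp: complex_vector.span_singleton)
    then have "Z = outer_square (csqrt c *\<^sub>C u)" by (simp add: outer_square_scale)
    moreover have "csqrt c *\<^sub>C u \<in> L" by (rule proj_space_scale[OF LP u(1)])
    ultimately show ?thesis using 2(1) by blast
  qed
next
  fix Z assume "Z \<in> {outer_square v | v L. L \<in> V \<and> v \<in> L}"
  then obtain v L where "Z = outer_square v" "L \<in> V" "v \<in> L" by blast
  then show "Z \<in> affine_cone (veronese2 ` V)"
    unfolding affine_cone_def veronese2_def by (auto intro!: complex_vector.span_base)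
qed

text \<open>A vanishing polynomial need not be homogeneous; its homogeneous components vanish on the
  lines of the open set, hence on \<open>V\<close>.\<close>

lemma poly_fun_vanishing_cone:
  assumes V: "irreducible_in proj_zariski V" and U: "openin (subtopology proj_zariski V) U" "U \<noteq> {}"
    and f: "f \<in> poly_fun"
    and van: "\<And>L. L \<in> U \<Longrightarrow> \<exists>v\<in>L. v \<noteq> 0 \<and> (\<forall>t. t \<noteq> 0 \<longrightarrow> f (t *\<^sub>C v) = 0)"
    and L: "L \<in> V" "v \<in> L"
  shows "f v = 0"
proof -
  have VP: "V \<subseteq> proj_space" using V by (simp add: irreducible_in_def topspace_proj_zariski)
  obtain P where P: "\<forall>k. homogeneous_poly k (\<lambda>x. coeff (P x) k)" "\<forall>x t. poly (P x) t = f (t *\<^sub>C x)"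
    using poly_fun_homogeneous_components[OF f] by blast
  obtain O1 where O1: "openin proj_zariski O1" "U = O1 \<inter> V" using U(1) by (auto simp: openin_subtopology)
  have "coeff (P v) k = 0" for k
  proof -
    let ?C = "{L \<in> proj_space. \<forall>v\<in>L. coeff (P v) k = 0}"
    have C: "closedin proj_zariski ?C" by (rule closedin_proj_zariski_basic[OF P(1)[rule_format]])
    have D: "closedin proj_zariski (proj_space - O1)"
      using O1(1) closedin_diff[OF closedin_topspace, of proj_zariski] by (simp add: topspace_proj_zariski)
    have "U \<subseteq> ?C"
    proof
      fix L assume "L \<in> U"
      then have LP: "L \<in> proj_space" using O1 VP by blast
      obtain u where u: "u \<in> L" "u \<noteq> 0" "\<forall>t. t \<noteq> 0 \<longrightarrow> f (t *\<^sub>C u) = 0" using van[OF \<open>L \<in> U\<close>] by blast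
      \<comment> \<open>Vanishing is known only for \<open>t \<noteq> 0\<close>; the extra factor
        \<open>t\<close> covers 0.\<close>
      have "poly ([:0, 1:] * P u) t = 0" for t using u(3) P(2) by auto
      then have "[:0, 1:] * P u = 0" using poly_all_0_iff_0 by blast
      then have "P u = 0" by auto
      have "coeff (P (c *\<^sub>C u)) k = 0" for c
        using P(1)[rule_format, of k] \<open>P u = 0\<close> by (simp add: homogeneous_poly_def)
      then show "L \<in> ?C" using LP proj_space_line[OF LP u(1,2)] by auto
    qed
    \<comment> \<open>Irreducibility applied to this cover: the second closed set misses the
      nonempty \<open>U\<close>.\<close>
    then have "V \<subseteq> ?C \<union> (proj_space - O1)" using O1(2) VP by blast
    then have "V \<subseteq> ?C \<or> V \<subseteq> proj_space - O1" using V C D unfolding irreducible_in_def by blast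
    moreover have "\<not> V \<subseteq> proj_space - O1" using O1(2) U(2) by blast
    ultimately show ?thesis using L by blast
  qed
  then have "P v = 0" by (simp add: poly_eq_iff)
  then show "f v = 0" using P(2)[rule_format, of v 1] by (simp add: scaleC_one)
qed

text \<open>Near a point of \<open>V\<close> with nonzero \<open>i0\<close>-th coordinate the birational map and its inverse are given
  by global quotients of polynomials; lines are represented by vectors normalized at \<open>i0\<close>.\<close>

lemma rational_variety_chart:
  fixes V :: "(complex^'n::finite) set set"
  assumes irr: "irreducible_in proj_zariski V"
    and rat: "rational_variety proj_zariski proj_regular V"
  obtains d i0 u a b a' b' U where
    "u \<in> poly_fun" "\<exists>y\<in>affine_space d. u y * (\<Prod>j\<in>UNIV. b j y) \<noteq> 0"
    "\<And>j. a j \<in> poly_fun" "\<And>j. b j \<in> poly_fun"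
    "\<And>k. k < d \<Longrightarrow> a' k \<in> poly_fun" "\<And>k. k < d \<Longrightarrow> b' k \<in> poly_fun"
    "openin (subtopology proj_zariski V) U" "U \<noteq> {}"
    "\<And>y. y \<in> affine_space d \<Longrightarrow> u y * (\<Prod>j\<in>UNIV. b j y) \<noteq> 0 \<Longrightarrow>
       a i0 y / b i0 y = 1 \<and>
       (\<exists>L\<in>V. (\<chi> j. a j y / b j y) \<in> L \<and>
         (\<forall>v\<in>L. v \<noteq> 0 \<longrightarrow> (\<forall>k<d. b' k v \<noteq> 0 \<and> a' k v = y k * b' k v)))"
    "\<And>L. L \<in> U \<Longrightarrow> \<exists>y\<in>affine_space d. u y * (\<Prod>j\<in>UNIV. b j y) \<noteq> 0 \<and> (\<chi> j. a j y / b j y) \<in> L"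
proof -
  have VP: "V \<subseteq> proj_space" and Vne: "V \<noteq> {}"
    using irr by (simp_all add: irreducible_in_def topspace_proj_zariski)
  obtain d U U' \<phi> \<psi> where U: "openin (subtopology proj_zariski V) U" "V \<subseteq> proj_zariski closure_of U"
    and U': "openin (subtopology zariski (affine_space d)) U'"
    and \<phi>: "morphism proj_zariski proj_regular U zariski regular U' \<phi>"
    and \<psi>: "morphism zariski regular U' proj_zariski proj_regular U \<psi>"
    and inv: "\<forall>x\<in>U. \<psi> (\<phi> x) = x" "\<forall>y\<in>U'. \<phi> (\<psi> y) = y"
    using rat unfolding rational_variety_def birational_def by (elim conjE exE) (rule that)
  have UV: "U \<subseteq> V" using U(1) by (auto simp: openin_subtopology)
  have "U \<noteq> {}" using U(2) Vne by auto
  then obtain L0 where L0: "L0 \<in> U" by blast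
  have contU: "continuous_map (subtopology proj_zariski U) (subtopology zariski U') \<phi>"
    using \<phi> by (simp add: morphism_def)
  have contU': "continuous_map (subtopology zariski U') (subtopology proj_zariski U) \<psi>"
    using \<psi> by (simp add: morphism_def)
  have topU: "topspace (subtopology proj_zariski U) = U"
    using UV VP by (auto simp: topspace_proj_zariski)
  have \<phi>U: "\<phi> L \<in> U'" if "L \<in> U" for L
    using continuous_map_image_subset_topspace[OF contU] that topU by auto
  let ?y0 = "\<phi> L0"
  have y0: "?y0 \<in> U'" "\<psi> ?y0 = L0" using \<phi>U L0 inv by auto
  obtain w where w: "w \<in> L0" "w \<noteq> 0" using proj_space_nonzero L0 UV VP by blast
  then obtain i0 where i0: "w $ i0 \<noteq> 0" by (auto simp: vec_eq_iff)
  have coord: "homogeneous_poly 1 (\<lambda>v::complex^'n. v $ j)" for j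
    by (intro homogeneous_poly_linear clinear_functionalI) auto
  let ?N0 = "{L \<in> proj_space. \<exists>v\<in>L. (v::complex^'n) $ i0 \<noteq> 0}"
  have N0: "openin proj_zariski ?N0" by (rule openin_proj_zariski_basic[OF coord])
  have N0nz: "v $ i0 \<noteq> 0" if "L \<in> ?N0" "v \<in> L" "v \<noteq> 0" for L v
    using homogeneous_poly_nonzero_on_line[OF coord[of i0], of L _ v] that by blast
  \<comment> \<open>The affine coordinate \<open>v $ j / v $ i0\<close> of a line, independent of
    the chosen representative.\<close>
  define F where "F j L = (let v = SOME v. v \<in> L \<and> v $ i0 \<noteq> 0 in v $ j / v $ i0)" for j and L :: "(complex^'n) set"
  have F: "F j L = v $ j / v $ i0" if "L \<in> ?N0" "v \<in> L" "v \<noteq> 0" for j L v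
  proof -
    let ?v = "SOME v. v \<in> L \<and> v $ i0 \<noteq> 0"
    have LP: "L \<in> proj_space" using that(1) by simp
    have "\<exists>v. v \<in> L \<and> v $ i0 \<noteq> 0" using that(1) by blast
    then have v': "?v \<in> L \<and> ?v $ i0 \<noteq> 0" by (rule someI_ex)
    then have "?v \<in> range (\<lambda>c. c *\<^sub>C v)"
      by (simp only: proj_space_line[OF LP that(2,3), symmetric])
    then obtain c where "?v = c *\<^sub>C v" by (rule rangeE)
    with v' show ?thesis by (auto simp: F_def Let_def)
  qed
  let ?D = "U \<inter> ?N0"
  have D: "openin (subtopology proj_zariski U) ?D"
    using N0 by (auto simp: openin_subtopology)
  have pr: "proj_regular ?D (F j)" for j
    unfolding proj_regular_def
  proof
    fix p assume p: "p \<in> ?D"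
    show "\<exists>N d g h. openin proj_zariski N \<and> p \<in> N \<and> homogeneous_poly d g \<and> homogeneous_poly d h \<and>
      (\<forall>L\<in>N \<inter> ?D. \<forall>v\<in>L - {0}. h v \<noteq> 0 \<and> F j L = g v / h v)"
    proof (rule exI[of _ ?N0], rule exI[of _ 1], rule exI[of _ "\<lambda>v. v $ j"],
        rule exI[of _ "\<lambda>v. v $ i0"], intro conjI ballI)
      show "openin proj_zariski ?N0" by (rule N0)
      show "p \<in> ?N0" using p by (rule IntD2)
      show "homogeneous_poly 1 (\<lambda>v::complex^'n. v $ j)"
        by (rule coord)
      show "homogeneous_poly 1 (\<lambda>v::complex^'n. v $ i0)"
        by (rule coord)
      fix L v assume L: "L \<in> ?N0 \<inter> ?D" and v: "v \<in> L - {0}"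
      have Lv: "L \<in> ?N0" "v \<in> L" "v \<noteq> 0" using IntD1[OF L] v by simp_all
      show "v $ i0 \<noteq> 0" by (rule N0nz[OF Lv])
      show "F j L = v $ j / v $ i0" by (rule F[OF Lv])
    qed
  qed
  have "regular (U' \<inter> \<psi> -` ?D) (F j \<circ> \<psi>)" for j
    by (intro morphism_pullback[OF \<psi> D pr])
  moreover have y0D: "?y0 \<in> U' \<inter> \<psi> -` ?D" using y0 L0 UV VP w i0 by auto
  ultimately have "\<forall>j. \<exists>N g h. openin zariski N \<and> ?y0 \<in> N \<and> g \<in> poly_fun \<and> h \<in> poly_fun \<and>
     (\<forall>x \<in> N \<inter> (U' \<inter> \<psi> -` ?D). h x \<noteq> 0 \<and> (F j \<circ> \<psi>) x = g x / h x)"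
    unfolding regular_def by blast
  then obtain N a b where Nab: "\<forall>j. openin zariski (N j) \<and> ?y0 \<in> N j \<and> a j \<in> poly_fun \<and> b j \<in> poly_fun \<and>
     (\<forall>x \<in> N j \<inter> (U' \<inter> \<psi> -` ?D). b j x \<noteq> 0 \<and> (F j \<circ> \<psi>) x = a j x / b j x)"
    unfolding choice_iff by (elim exE) (rule that)
  then have N: "\<And>j. openin zariski (N j)" "\<And>j. ?y0 \<in> N j"
    and ab: "\<And>j. a j \<in> poly_fun" "\<And>j. b j \<in> poly_fun"
      "\<And>j x. x \<in> N j \<inter> (U' \<inter> \<psi> -` ?D) \<Longrightarrow> b j x \<noteq> 0 \<and> (F j \<circ> \<psi>) x = a j x / b j x"
    by auto
  \<comment> \<open>Pulling the coordinates of affine space back along \<open>\<phi>\<close> writes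
    the inverse through homogeneous quotients \<open>a' k / b' k\<close>.\<close>
  have "regular U' (\<lambda>y. y k)" for k
    unfolding regular_def
  proof
    fix p assume "p \<in> U'"
    show "\<exists>N g h. openin zariski N \<and> p \<in> N \<and> g \<in> poly_fun \<and> h \<in> poly_fun \<and>
      (\<forall>x\<in>N \<inter> U'. h x \<noteq> 0 \<and> x k = g x / h x)"
      by (rule exI[of _ UNIV], rule exI[of _ "\<lambda>y. y k"], rule exI[of _ "\<lambda>_. 1"])
        (simp add: poly_fun_coord poly_fun_const openin_topspace[of zariski, unfolded topspace_zariski])
  qed
  then have "proj_regular (U \<inter> \<phi> -` U') ((\<lambda>y. y k) \<circ> \<phi>)" for k
    by (intro morphism_pullback[OF \<phi>]) (simp_all add: openin_subtopology_refl)
  moreover have "L0 \<in> U \<inter> \<phi> -` U'" using L0 y0 by simp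
  ultimately have "\<forall>k. \<exists>M e g h. openin proj_zariski M \<and> L0 \<in> M \<and> homogeneous_poly e g \<and> homogeneous_poly e h \<and>
     (\<forall>L \<in> M \<inter> (U \<inter> \<phi> -` U'). \<forall>v \<in> L - {0}. h v \<noteq> 0 \<and> ((\<lambda>y. y k) \<circ> \<phi>) L = g v / h v)"
    unfolding proj_regular_def by blast
  then obtain M e a' b' where Mab: "\<forall>k. openin proj_zariski (M k) \<and> L0 \<in> M k \<and>
     homogeneous_poly (e k) (a' k) \<and> homogeneous_poly (e k) (b' k) \<and>
     (\<forall>L \<in> M k \<inter> (U \<inter> \<phi> -` U'). \<forall>v \<in> L - {0}. b' k v \<noteq> 0 \<and> ((\<lambda>y. y k) \<circ> \<phi>) L = a' k v / b' k v)"
    unfolding choice_iff by (elim exE) (rule that)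
  then have M: "\<And>k. openin proj_zariski (M k)" "\<And>k. L0 \<in> M k"
    and ab': "\<And>k. homogeneous_poly (e k) (a' k)" "\<And>k. homogeneous_poly (e k) (b' k)"
      "\<And>k L v. L \<in> M k \<inter> (U \<inter> \<phi> -` U') \<Longrightarrow> v \<in> L - {0} \<Longrightarrow> b' k v \<noteq> 0 \<and> \<phi> L k = a' k v / b' k v"
    by auto
  \<comment> \<open>\<open>proj_space\<close> keeps this set open for \<open>d = 0\<close>, where
    the indexed intersection is the whole type.\<close>
  let ?M = "proj_space \<inter> (\<Inter>k\<in>{..<d}. M k)"
  have "openin proj_zariski ?M"
    using M(1) by (cases "d = 0") (auto simp: topspace_proj_zariski[symmetric] intro!: openin_Int openin_INT)
  then have "openin (subtopology proj_zariski U) (U \<inter> (?N0 \<inter> ?M))"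
    using openin_Int[OF N0] unfolding openin_subtopology by blast
  then have "openin (subtopology zariski U') {y \<in> topspace (subtopology zariski U'). \<psi> y \<in> U \<inter> (?N0 \<inter> ?M)}"
    by (rule openin_continuous_map_preimage[OF contU'])
  then obtain O2 where O2: "openin zariski O2" "{y \<in> U'. \<psi> y \<in> U \<inter> (?N0 \<inter> ?M)} = O2 \<inter> U'"
    by (auto simp: openin_subtopology)
  obtain O3 where O3: "openin zariski O3" "U' = O3 \<inter> affine_space d"
    using U' by (auto simp: openin_subtopology)
  \<comment> \<open>All local conditions near \<open>?y0\<close> at once; \<open>u\<close> then cuts
    out a basic open neighbourhood inside.\<close>
  let ?O = "O2 \<inter> O3 \<inter> (\<Inter>j. N j)"
  have Oop: "openin zariski ?O"
    using O2 O3 N(1) by (intro openin_Int openin_INT2) auto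
  have "?y0 \<in> U' \<and> \<psi> ?y0 \<in> U \<inter> (?N0 \<inter> ?M)"
    using y0 y0D M(2) L0 UV VP by auto
  then have y0O: "?y0 \<in> ?O" using N(2) O2(2) O3(2) by blast
  obtain u where u: "u \<in> poly_fun" "u ?y0 \<noteq> 0" "\<And>y. u y \<noteq> 0 \<Longrightarrow> y \<in> ?O"
    using openin_zariskiE[OF Oop y0O] by metis
  \<comment> \<open>A denominator must work at all sequences where it is nonzero, also outside
    affine \<open>d\<close>-space, where \<open>u y \<noteq> 0\<close> is not known to make the
    \<open>b j y\<close> nonzero.\<close>
  let ?q = "\<lambda>y. u y * (\<Prod>j\<in>UNIV. b j y)"
  let ?x = "\<lambda>y. \<chi> j. a j y / b j y"
  have good: "y \<in> U' \<and> \<psi> y \<in> U \<inter> (?N0 \<inter> ?M) \<and> y \<in> N j" if "y \<in> affine_space d" "u y \<noteq> 0" for y j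
  proof -
    have "y \<in> ?O" by (rule u(3)[OF that(2)])
    moreover then have "y \<in> U'" using that(1) O3(2) by blast
    ultimately show ?thesis using O2(2) by blast
  qed
  have xF: "a j y / b j y = F j (\<psi> y) \<and> b j y \<noteq> 0" if "y \<in> affine_space d" "u y \<noteq> 0" for y j
    using ab(3)[of y j] good[OF that, of j] by auto
  have x: "a i0 y / b i0 y = 1 \<and> ?x y \<in> \<psi> y" if y: "y \<in> affine_space d" "u y \<noteq> 0" for y
  proof -
    have L: "\<psi> y \<in> ?N0" using good[OF y] by blast
    then obtain v where v: "v \<in> \<psi> y" "v \<noteq> 0" using proj_space_nonzero by blast
    have nz: "v $ i0 \<noteq> 0" by (rule N0nz[OF L v])
    have "?x y = (1 / v $ i0) *\<^sub>C v"
      using xF[OF y] F[OF L v] by (simp add: vec_eq_iff)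
    moreover have "(1 / v $ i0) *\<^sub>C v \<in> \<psi> y" using L v(1) by (intro proj_space_scale) auto
    moreover have "a i0 y / b i0 y = 1" using xF[OF y, of i0] F[OF L v, of i0] nz by simp
    ultimately show ?thesis by simp
  qed
  define U1 where "U1 = {L \<in> topspace (subtopology proj_zariski U). \<phi> L \<in> {y. ?q y \<noteq> 0} \<inter> U'}"
  have q: "?q \<in> poly_fun" using u(1) ab(2) by (intro poly_fun_mult poly_fun_prod)
  have y0aff: "?y0 \<in> affine_space d" using y0(1) O3(2) by blast
  have q0: "?q ?y0 \<noteq> 0" using u(2) xF[OF y0aff u(2)] by simp
  show thesis
  proof (rule that[of u d b a a' b' U1 i0])
    show "\<exists>y\<in>affine_space d. ?q y \<noteq> 0" using y0aff q0 by blast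
    show "a' k \<in> poly_fun" "b' k \<in> poly_fun" for k
      using ab' by (auto simp: homogeneous_poly_def)
    have "openin (subtopology proj_zariski U) U1"
      unfolding U1_def using openin_zariski_basic[OF q]
      by (intro openin_continuous_map_preimage[OF contU]) (auto simp: openin_subtopology)
    then have "openin (subtopology (subtopology proj_zariski V) U) U1"
      using UV by (simp add: subtopology_subtopology Int_absorb1)
    then show "openin (subtopology proj_zariski V) U1"
      using openin_trans_full U(1) by blast
    have "L0 \<in> U1" unfolding U1_def topU using L0 y0 q0 by simp
    then show "U1 \<noteq> {}" by blast
    fix y assume y: "y \<in> affine_space d" "?q y \<noteq> 0"
    then have uy: "u y \<noteq> 0" by auto
    have "\<forall>v\<in>\<psi> y. v \<noteq> 0 \<longrightarrow> (\<forall>k<d. b' k v \<noteq> 0 \<and> a' k v = y k * b' k v)"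
    proof (intro ballI impI allI)
      fix v k assume v: "v \<in> \<psi> y" "v \<noteq> 0" "k < d"
      have "\<psi> y \<in> M k \<inter> (U \<inter> \<phi> -` U')" "\<phi> (\<psi> y) = y" using good[OF y(1) uy] v(3) inv(2) by auto
      then show "b' k v \<noteq> 0 \<and> a' k v = y k * b' k v" using ab'(3)[of "\<psi> y" k v] v by auto
    qed
    moreover have "\<psi> y \<in> V" using good[OF y(1) uy] UV by blast
    ultimately show "a i0 y / b i0 y = 1 \<and> (\<exists>L\<in>V. ?x y \<in> L \<and>
         (\<forall>v\<in>L. v \<noteq> 0 \<longrightarrow> (\<forall>k<d. b' k v \<noteq> 0 \<and> a' k v = y k * b' k v)))"
      using x[OF y(1) uy] by blast
  next
    fix L assume "L \<in> U1"
    then have L: "L \<in> U" "?q (\<phi> L) \<noteq> 0" "\<phi> L \<in> U'" unfolding U1_def topU by auto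
    then have "\<phi> L \<in> affine_space d" "\<psi> (\<phi> L) = L" "u (\<phi> L) \<noteq> 0" using O3(2) inv(1) by auto
    then show "\<exists>y\<in>affine_space d. ?q y \<noteq> 0 \<and> ?x y \<in> L" using x[of "\<phi> L"] L(2) by auto
  qed (use u ab in auto)
qed

theorem corollary4p7:
  fixes V :: "(complex^'n) set set"
  assumes "closedin proj_zariski V"
    and "irreducible_in proj_zariski V"
    and "rational_variety proj_zariski proj_regular V"
  shows "rational_variety zariski regular (bw_correspondence V)"
proof -
  have VP: "V \<subseteq> proj_space" and Vne: "V \<noteq> {}"
    using assms(2) by (simp_all add: irreducible_in_def topspace_proj_zariski)
  obtain d :: nat and i0 :: 'n and u a b a' b' U where
    u: "u \<in> poly_fun" and ne: "\<exists>y\<in>affine_space d. u y * (\<Prod>j\<in>UNIV. b j y) \<noteq> 0"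
    and ab: "\<And>j. a j \<in> poly_fun" "\<And>j. b j \<in> poly_fun"
    and ab': "\<And>k. k < d \<Longrightarrow> a' k \<in> poly_fun" "\<And>k. k < d \<Longrightarrow> b' k \<in> poly_fun"
    and U: "openin (subtopology proj_zariski V) U" "U \<noteq> {}"
    and chart: "\<And>y. y \<in> affine_space d \<Longrightarrow> u y * (\<Prod>j\<in>UNIV. b j y) \<noteq> 0 \<Longrightarrow>
       a i0 y / b i0 y = 1 \<and>
       (\<exists>L\<in>V. (\<chi> j. a j y / b j y) \<in> L \<and>
         (\<forall>v\<in>L. v \<noteq> 0 \<longrightarrow> (\<forall>k<d. b' k v \<noteq> 0 \<and> a' k v = y k * b' k v)))"
    and cover: "\<And>L. L \<in> U \<Longrightarrow> \<exists>y\<in>affine_space d. u y * (\<Prod>j\<in>UNIV. b j y) \<noteq> 0 \<and> (\<chi> j. a j y / b j y) \<in> L"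
    by (rule rational_variety_chart[OF assms(2,3)]) (rule that)
  let ?q0 = "\<lambda>y. u y * (\<Prod>j\<in>UNIV. b j y)"
  define x where "x y = (\<chi> j. a j y / b j y)" for y
  let ?W = "affine_cone (veronese2 ` V)"
  have W: "?W = {outer_square v | v L. L \<in> V \<and> v \<in> L}" by (rule affine_cone_veronese2[OF VP Vne])
  \<comment> \<open>Coordinate \<open>d\<close> carries the scalar \<open>t\<close>, kept nonzero so
    that row \<open>i0\<close> is a nonzero vector on the line.\<close>
  define q where "q p = ?q0 (take_seq d p) * p d" for p
  define \<Phi> where "\<Phi> p = p d *\<^sub>C outer_square (x (take_seq d p))" for p
  define h where "h Z = (\<Prod>k<d. b' k (Z $ i0))" for Z :: "complex^'n^'n"
  \<comment> \<open>Numerators over the common denominator \<open>h\<close>. The last coordinate is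
    the entry at \<open>(i0, i0)\<close>, equal to \<open>t\<close> by the normalization.\<close>
  define g where "g k Z = (if k < d then a' k (Z $ i0) * (\<Prod>j\<in>{..<d} - {k}. b' j (Z $ i0))
    else Z $ i0 $ i0 * h Z)" for k and Z :: "complex^'n^'n"
  have q0: "?q0 \<in> poly_fun" using u ab by (intro poly_fun_mult poly_fun_prod)
  have q_poly: "q \<in> poly_fun" unfolding q_def
    by (intro poly_fun_mult poly_fun_comp_linear[OF clinear_take_seq q0] poly_fun_coord)
  have row: "clinear (\<lambda>Z::complex^'n^'n. Z $ i0)"
    by (intro clinearI) (auto simp: scaleC_vec_def)
  have h_poly: "h \<in> poly_fun"
    unfolding h_def using ab' by (intro poly_fun_prod poly_fun_comp_linear[OF row]) auto
  have key: "x y $ i0 = 1 \<and> (\<exists>L\<in>V. x y \<in> L \<and>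
      (\<forall>t. t \<noteq> 0 \<longrightarrow> (\<forall>k<d. b' k (t *\<^sub>C x y) \<noteq> 0 \<and> a' k (t *\<^sub>C x y) = y k * b' k (t *\<^sub>C x y))))"
    if y: "y \<in> affine_space d" "?q0 y \<noteq> 0" for y
  proof -
    have x1: "x y $ i0 = 1" using chart[OF y] by (simp add: x_def)
    obtain L where L: "L \<in> V" "x y \<in> L"
      "\<forall>v\<in>L. v \<noteq> 0 \<longrightarrow> (\<forall>k<d. b' k v \<noteq> 0 \<and> a' k v = y k * b' k v)"
      using chart[OF y] unfolding x_def by blast
    have "t *\<^sub>C x y \<in> L \<and> t *\<^sub>C x y \<noteq> 0" if "t \<noteq> 0" for t
      using proj_space_scale[of L "x y" t] L VP that x1 by (auto simp: vec_eq_iff intro!: exI[of _ i0])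
    with x1 L show ?thesis by blast
  qed
  have \<Phi>_row: "\<Phi> p $ i0 = p d *\<^sub>C x (take_seq d p)" if "x (take_seq d p) $ i0 = 1" for p
    using that by (simp add: \<Phi>_def outer_square_def vec_eq_iff)
  have pD: "take_seq d p \<in> affine_space d" "?q0 (take_seq d p) \<noteq> 0" "p d \<noteq> 0" if "q p \<noteq> 0" for p
    using that by (auto simp: q_def take_seq_affine)
  have ab\<Phi>: "b' k (\<Phi> p $ i0) \<noteq> 0 \<and> a' k (\<Phi> p $ i0) = p k * b' k (\<Phi> p $ i0)" if "q p \<noteq> 0" "k < d" for p k
  proof -
    have "b' k (p d *\<^sub>C x (take_seq d p)) \<noteq> 0 \<and>
      a' k (p d *\<^sub>C x (take_seq d p)) = take_seq d p k * b' k (p d *\<^sub>C x (take_seq d p))"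
      using key[OF pD(1,2)[OF that(1)]] pD(3)[OF that(1)] that(2) by blast
    then show ?thesis
      using \<Phi>_row[of p] key[OF pD(1,2)[OF that(1)]] that(2) by (simp add: take_seq_def)
  qed
  have "rational_param (Suc d) q \<Phi> h g ?W"
  proof
    show "q \<in> poly_fun" "h \<in> poly_fun" by fact+
    show "g k \<in> poly_fun" if "k < Suc d" for k
    proof (cases "k < d")
      case True
      then show ?thesis unfolding g_def using ab'
        by (auto intro!: poly_fun_mult poly_fun_prod poly_fun_comp_linear[OF row])
    next
      case False
      then show ?thesis unfolding g_def
        using poly_fun_mult[OF poly_fun_linear[OF clinear_mat_entry[of i0 i0]] h_poly] by simp
    qed
    have "(\<lambda>y. x y $ j) \<in> rat_fun ?q0" for j
    proof (rule rat_fun_cong)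
      show "(\<lambda>y. (a j y * (u y * (\<Prod>k\<in>UNIV - {j}. b k y))) * inverse (?q0 y)) \<in> rat_fun ?q0"
        using u ab
        by (intro rat_fun_mult[OF rat_fun_poly rat_fun_inverse] poly_fun_mult poly_fun_prod)
      fix y assume "?q0 y \<noteq> 0"
      moreover have "(\<Prod>k\<in>UNIV. b k y) = b j y * (\<Prod>k\<in>UNIV - {j}. b k y)" by (rule prod.remove) auto
      ultimately show "(a j y * (u y * (\<Prod>k\<in>UNIV - {j}. b k y))) * inverse (?q0 y) = x y $ j"
        by (simp add: x_def field_simps)
    qed
    then have xr: "(\<lambda>p. x (take_seq d p) $ j) \<in> rat_fun q" for j
      unfolding q_def
      using rat_fun_mono[OF rat_fun_comp_linear[OF clinear_take_seq, of "\<lambda>y. x y $ j"] poly_fun_coord] by blast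
    show "rat_map q \<Phi>"
    proof (rule rat_map_matI[OF q_poly])
      show "(\<lambda>p. \<Phi> p $ i $ j) \<in> rat_fun q" for i j
        using rat_fun_mult[OF rat_fun_poly[OF poly_fun_coord] rat_fun_mult[OF xr[of i] xr[of j]], of d]
        by (simp add: \<Phi>_def outer_square_def)
    qed
    obtain y where y: "y \<in> affine_space d" "?q0 y \<noteq> 0" using ne by blast
    then have "take_seq d (y(d := 1)) = y"
      by (auto simp: take_seq_def affine_space_def fun_eq_iff)
    then show "\<exists>p\<in>affine_space (Suc d). q p \<noteq> 0"
      using y by (intro bexI[of _ "y(d := 1)"]) (auto simp: q_def affine_space_def)
    fix p assume p: "q p \<noteq> 0"
    show hnz: "h (\<Phi> p) \<noteq> 0" unfolding h_def using ab\<Phi>[OF p] by simp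
    note kp = key[OF pD(1,2)[OF p]]
    show "g k (\<Phi> p) = p k * h (\<Phi> p)" if "k < Suc d" for k
    proof (cases "k < d")
      case True
      have "h (\<Phi> p) = b' k (\<Phi> p $ i0) * (\<Prod>j\<in>{..<d} - {k}. b' j (\<Phi> p $ i0))"
        unfolding h_def using True by (intro prod.remove) auto
      then show ?thesis using ab\<Phi>[OF p True] True by (simp add: g_def)
    next
      case False
      then have "k = d" using that by simp
      then show ?thesis using \<Phi>_row[of p] kp by (simp add: g_def)
    qed
    obtain L where L: "L \<in> V" "x (take_seq d p) \<in> L" using kp by blast
    have "\<Phi> p = outer_square (csqrt (p d) *\<^sub>C x (take_seq d p))" by (simp add: \<Phi>_def outer_square_scale)
    moreover have "csqrt (p d) *\<^sub>C x (take_seq d p) \<in> L" using L VP by (intro proj_space_scale) auto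
    ultimately show "\<Phi> p \<in> ?W" unfolding W using L by blast
  next
    fix f Z assume f: "f \<in> poly_fun" "\<And>p. p \<in> affine_space (Suc d) \<Longrightarrow> q p \<noteq> 0 \<Longrightarrow> f (\<Phi> p) = 0"
      and "Z \<in> ?W"
    then obtain v L where Z: "Z = outer_square v" "L \<in> V" "v \<in> L" unfolding W by blast
    have "f (outer_square v) = 0"
    proof (rule poly_fun_vanishing_cone[OF assms(2) U _ _ Z(2,3)])
      have "rat_map (\<lambda>_. 1) (outer_square :: complex^'n \<Rightarrow> _)"
      proof (rule rat_map_matI[OF poly_fun_const])
        have c: "(\<lambda>v::complex^'n. v $ i) \<in> poly_fun" for i
          by (intro poly_fun_linear clinear_functionalI) auto
        show "(\<lambda>v::complex^'n. outer_square v $ i $ j) \<in> rat_fun (\<lambda>_. 1)" for i j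
          using rat_fun_poly[OF poly_fun_mult[OF c[of i] c[of j]]] by (simp add: outer_square_def)
      qed
      then show "(\<lambda>v. f (outer_square v)) \<in> poly_fun"
        by (intro rat_fun_one_poly rat_map_poly_comp[OF poly_fun_const _ f(1)])
      fix L assume "L \<in> U"
      then obtain y where y: "y \<in> affine_space d" "?q0 y \<noteq> 0" "x y \<in> L"
        using cover unfolding x_def by blast
      have ty: "take_seq d (y(d := c)) = y" for c
        using y(1) by (auto simp: take_seq_def affine_space_def fun_eq_iff)
      have "f (outer_square (t *\<^sub>C x y)) = 0" if "t \<noteq> 0" for t
      proof -
        \<comment> \<open>The scalar is the square of \<open>t\<close> because scaling a vector by
          \<open>t\<close> scales its outer square by that square.\<close>
        have "\<Phi> (y(d := t\<^sup>2)) = outer_square (t *\<^sub>C x y)"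
          by (simp add: \<Phi>_def ty outer_square_scale)
        moreover have "q (y(d := t\<^sup>2)) \<noteq> 0" using y(2) that by (simp add: q_def ty)
        moreover have "y(d := t\<^sup>2) \<in> affine_space (Suc d)" using y(1) by (auto simp: affine_space_def)
        ultimately show ?thesis using f(2) by metis
      qed
      moreover have "x y \<noteq> 0" using key[OF y(1,2)] by (auto simp: vec_eq_iff intro!: exI[of _ i0])
      ultimately show "\<exists>v\<in>L. v \<noteq> 0 \<and> (\<forall>t. t \<noteq> 0 \<longrightarrow> f (outer_square (t *\<^sub>C v)) = 0)"
        using y(3) by blast
    qed
    then show "f Z = 0" using Z(1) by simp
  qed
  moreover have "?W \<subseteq> sym_matrices"
    unfolding W by (auto simp: sym_matrices_iff outer_square_def mult.commute)
  ultimately show ?thesis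
    unfolding bw_correspondence_def by (rule rational_param.rational_variety_critical_pairs)
qed

end
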